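(* Let $G$ be a hyperbolic group and let $\partial G$ be its Gromov boundary. Then for every finitely supported, generating probability measure $\lambda$ on $G$ and every convex function $f:(0,\infty)\to\mathbb{R}$ with $f(1)=0$, we have $$I^{top}_{\lambda,f}(\partial G)=I_{\lambda,f}(G).$$
   Context: A probability measure $\lambda$ on $G$ is generating if its support generates $G$. For probability measures $P,Q$ on a Borel space, choose a measure $R$ with $P,Q\ll R$, put $p=\frac{dP}{dR}$, $q=\frac{dQ}{dR}$, $f'(\infty)=\lim_{t\to\infty}f(t)/t$, $f(0)=f(0^+)$, and define (independently of $R$, with $0\cdot\infty=0$) $$D_f(P\|Q)=\int_{\{q>0\}}f\Big(\frac pq\Big)q\,dR+P(\{q=0\})f'(\infty)\in[0,\infty].$$ For a probability measure $\nu$ on a Borel $G$-space $X$, $h_{\lambda,f}(X,\nu)=\sum_{g\in G}\lambda(g)D_f(g\nu\|\nu)$, where $g\nu$ is the push-forward of $\nu$ by $g$. For a topological $G$-space $X$ (continuous action), $I^{top}_{\lambda,f}(X)=\inf_\nu h_{\lambda,f}(X,\nu)$ over all Borel probability measures $\nu$ on $X$. The number $I_{\lambda,f}(G)$ is the infimum of $h_{\lambda,f}(G,\omega)$ over all probability measures $\omega$ on $G$ with $\omega(g)>0$ for every $g\in G$, where $G$ acts on itself by left translation.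
   Formalization: The hyperbolic group G is assumed infinite: for finite G the boundary is empty, so the infimum defining I^top is over the empty set (+∞), while I(G) = 0 by the uniform measure. *)

theory Defs
  imports "HOL-Algebra.Generated_Groups" "HOL-Probability.Probability"
begin

section \<open>f-divergence\<close>

text \<open>
  A convex function on \<open>(0,\<infinity>)\<close> is a function \<open>real \<Rightarrow> real\<close> of which only the values on
  \<open>{0<..}\<close> matter; the value \<open>f 0\<close> is never used, it is replaced by the limit \<open>f(0+)\<close>, which
  may be \<open>\<infinity>\<close>.
\<close>

definition at_zero :: "(real \<Rightarrow> real) \<Rightarrow> ereal" where
  "at_zero f = Lim (at_right 0) (\<lambda>t. ereal (f t))"

definition slope_at_infinity :: "(real \<Rightarrow> real) \<Rightarrow> ereal" where
  "slope_at_infinity f = Lim at_top (\<lambda>t. ereal (f t / t))"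

definition ext_zero :: "(real \<Rightarrow> real) \<Rightarrow> real \<Rightarrow> ereal" where
  "ext_zero f t = (if t = 0 then at_zero f else ereal (f t))"

definition ereal_integral :: "'x measure \<Rightarrow> ('x \<Rightarrow> ereal) \<Rightarrow> ereal" where
  "ereal_integral M u =
     enn2ereal (\<integral>\<^sup>+ x. e2ennreal (u x) \<partial>M) - enn2ereal (\<integral>\<^sup>+ x. e2ennreal (- u x) \<partial>M)"

text \<open>
  \<open>e2ennreal\<close> sends negative arguments to \<open>0\<close>, so the two terms above are the integrals of the
  positive and of the negative part.  In the use below the negative part has finite integral,
  because \<open>f t \<ge> a * (t - 1)\<close> for some \<open>a\<close>.
\<close>

definition f_divergence_wrt ::
  "'x measure \<Rightarrow> (real \<Rightarrow> real) \<Rightarrow> 'x measure \<Rightarrow> 'x measure \<Rightarrow> ereal" where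
  "f_divergence_wrt R f P Q =
     (let p = (\<lambda>x. enn2real (RN_deriv R P x)); q = (\<lambda>x. enn2real (RN_deriv R Q x)) in
        ereal_integral R (\<lambda>x. if 0 < q x then ext_zero f (p x / q x) * ereal (q x) else 0)
        + ereal (measure P {x \<in> space R. q x = 0}) * slope_at_infinity f)"

definition plus_measure :: "'x measure \<Rightarrow> 'x measure \<Rightarrow> 'x measure" where
  "plus_measure P Q = measure_of (space P) (sets P) (\<lambda>A. emeasure P A + emeasure Q A)"

text \<open>
  The divergence does not depend on the dominating measure \<open>R\<close>
  (lemma \<open>f_divergence_eq_wrt\<close> below); we take \<open>R = P + Q\<close>.
\<close>

definition f_divergence :: "(real \<Rightarrow> real) \<Rightarrow> 'x measure \<Rightarrow> 'x measure \<Rightarrow> ereal" where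
  "f_divergence f P Q = f_divergence_wrt (plus_measure P Q) f P Q"

lemma sets_plus_measure [simp]: "sets (plus_measure P Q) = sets P"
  and space_plus_measure [simp]: "space (plus_measure P Q) = space P"
  by (simp_all add: plus_measure_def sets.space_closed)

lemma emeasure_plus_measure:
  assumes "sets Q = sets P" "A \<in> sets P"
  shows "emeasure (plus_measure P Q) A = emeasure P A + emeasure Q A"
  unfolding plus_measure_def
proof (rule emeasure_measure_of_sigma)
  show "sigma_algebra (space P) (sets P)" by (rule sets.sigma_algebra_axioms)
  show "positive (sets P) (\<lambda>A. emeasure P A + emeasure Q A)" by (simp add: positive_def)
  show "countably_additive (sets P) (\<lambda>A. emeasure P A + emeasure Q A)"
  proof (rule countably_additiveI)
    fix F :: "nat \<Rightarrow> 'a set"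
    assume F: "range F \<subseteq> sets P" "disjoint_family F" "\<Union> (range F) \<in> sets P"
    have "(\<Sum>i. emeasure P (F i)) = emeasure P (\<Union> (range F))"
         "(\<Sum>i. emeasure Q (F i)) = emeasure Q (\<Union> (range F))"
      using F assms(1) by (auto intro!: suminf_emeasure)
    then show "(\<Sum>i. emeasure P (F i) + emeasure Q (F i))
        = emeasure P (\<Union> (range F)) + emeasure Q (\<Union> (range F))"
      by (simp add: suminf_add[symmetric])
  qed
qed (use assms in auto)

lemma e2ennreal_mult_pos: "e2ennreal (ereal c * e) = ennreal c * e2ennreal e" if "0 < c"
proof (cases "0 \<le> e")
  case True
  have "e2ennreal (ereal c * e) = e2ennreal (ereal c) * e2ennreal e"
    using True that by (metis e2ennreal_enn2ereal enn2ereal_e2ennreal ereal_less_eq(5)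
        less_imp_le times_ennreal.rep_eq)
  then show ?thesis by (simp add: e2ennreal_ereal)
next
  case False
  then have "ereal c * e \<le> 0"
    using that by (simp add: ereal_mult_le_0_iff)
  then show ?thesis using False by (simp add: e2ennreal_neg)
qed

lemma f_divergence_eq_wrt:
  assumes f: "convex_on {0<..} f"
    and "sigma_finite_measure R" "finite_measure P" "finite_measure Q"
    and sets: "sets P = sets R" "sets Q = sets R"
    and ac: "absolutely_continuous R P" "absolutely_continuous R Q"
  shows "f_divergence f P Q = f_divergence_wrt R f P Q"
proof -
  interpret R: sigma_finite_measure R by fact
  interpret P: finite_measure P by fact
  interpret Q: finite_measure Q by fact
  define T where "T = plus_measure P Q"
  have sT: "sets T = sets R" by (simp add: T_def sets)
  have eT: "emeasure T A = emeasure P A + emeasure Q A" if "A \<in> sets R" for A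
    using that by (simp add: T_def sets emeasure_plus_measure)
  have space: "space P = space R" "space Q = space R" "space T = space R"
    using sets sT by (auto dest: sets_eq_imp_space_eq)
  interpret T: finite_measure T
  proof
    show "emeasure T (space T) \<noteq> \<infinity>"
      using P.emeasure_finite Q.emeasure_finite by (simp add: eT space)
  qed
  have acRT: "absolutely_continuous R T" and acTP: "absolutely_continuous T P"
    and acTQ: "absolutely_continuous T Q"
    using ac by (auto simp: absolutely_continuous_def null_sets_def eT sets sT)
  define r where "r = RN_deriv R T"
  define p where "p = RN_deriv T P"
  define q where "q = RN_deriv T Q"
  have [measurable]: "r \<in> borel_measurable R" by (simp add: r_def)
  have "p \<in> borel_measurable T" "q \<in> borel_measurable T" by (simp_all add: p_def q_def)
  then have [measurable]: "p \<in> borel_measurable R" "q \<in> borel_measurable R"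
    by (simp_all add: measurable_cong_sets[OF sT refl])
  have dT: "density R r = T"
    unfolding r_def by (rule R.density_RN_deriv[OF acRT sT])
  have dP: "density T p = P" and dQ: "density T q = Q"
    unfolding p_def q_def using acTP acTQ by (auto intro!: T.density_RN_deriv simp: sT sets)
  have "density R (\<lambda>x. r x * p x) = P" "density R (\<lambda>x. r x * q x) = Q"
    using dP dQ by (simp_all add: dT[symmetric] density_density_eq)
  then have RN: "AE x in R. r x * p x = RN_deriv R P x" "AE x in R. r x * q x = RN_deriv R Q x"
    by (auto intro!: R.RN_deriv_unique)
  have fin: "AE x in R. r x \<noteq> \<infinity>"
    unfolding r_def by (intro R.RN_deriv_finite T.sigma_finite_measure_axioms acRT sT)
  define p' where "p' x = enn2real (p x)" for x
  define q' where "q' x = enn2real (q x)" for x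
  define pR where "pR x = enn2real (RN_deriv R P x)" for x
  define qR where "qR x = enn2real (RN_deriv R Q x)" for x
  have eq: "AE x in R. pR x = enn2real (r x) * p' x \<and> qR x = enn2real (r x) * q' x"
    using RN by eventually_elim (simp add: pR_def qR_def p'_def q'_def flip: enn2real_mult)
  define u where "u x = (if 0 < q' x then ext_zero f (p' x / q' x) * ereal (q' x) else 0)" for x
  define uR where "uR x = (if 0 < qR x then ext_zero f (pR x / qR x) * ereal (qR x) else 0)" for x
  have key: "AE x in R. e2ennreal (uR x) = r x * e2ennreal (u x) \<and>
                        e2ennreal (- uR x) = r x * e2ennreal (- u x)"
    using eq fin
  proof eventually_elim
    case (elim x)
    define c where "c = enn2real (r x)"
    have rc: "r x = ennreal c" using elim by (simp add: c_def less_top)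
    have c0: "0 \<le> c" by (simp add: c_def)
    show ?case
    proof (cases "c = 0")
      case True
      then show ?thesis using elim by (simp add: rc uR_def e2ennreal_neg)
    next
      case False
      with c0 have c: "0 < c" by simp
      have "uR x = ereal c * u x"
        using elim c
        by (auto simp: uR_def u_def c_def[symmetric] zero_less_mult_iff ac_simps
              simp flip: times_ereal.simps(1))
      then show ?thesis
        using c e2ennreal_mult_pos[OF c, of "- u x"] by (simp add: rc e2ennreal_mult_pos)
    qed
  qed
  have [measurable]: "u \<in> borel_measurable R"
  proof -
    have cont: "continuous_on {0<..} f"
      using f by (rule convex_on_continuous[OF open_greaterThan])
    define k where "k t = (if t \<in> {0<..} then f t else 0)" for t
    have [measurable]: "k \<in> borel_measurable borel"
      unfolding k_def by (rule borel_measurable_continuous_on_if) (use cont in auto)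
    have "u = (\<lambda>x. if 0 < q' x then
        (if p' x / q' x = 0 then at_zero f else ereal (k (p' x / q' x))) * ereal (q' x) else 0)"
      by (rule ext) (auto simp: u_def ext_zero_def k_def p'_def q'_def zero_less_divide_iff
          less_le)
    also have "\<dots> \<in> borel_measurable R" unfolding p'_def q'_def by measurable
    finally show ?thesis .
  qed
  have "(\<integral>\<^sup>+ x. e2ennreal (uR x) \<partial>R) = (\<integral>\<^sup>+ x. r x * e2ennreal (u x) \<partial>R)"
       "(\<integral>\<^sup>+ x. e2ennreal (- uR x) \<partial>R) = (\<integral>\<^sup>+ x. r x * e2ennreal (- u x) \<partial>R)"
    using key by (auto intro!: nn_integral_cong_AE)
  then have int: "ereal_integral R uR = ereal_integral T u"
    by (simp add: ereal_integral_def dT[symmetric] nn_integral_density)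
  have "AE x in T. qR x = 0 \<longleftrightarrow> q' x = 0"
    unfolding dT[symmetric] AE_density[OF \<open>r \<in> borel_measurable R\<close>]
    using eq fin by eventually_elim (auto simp: enn2real_eq_0_iff)
  then have "AE x in P. qR x = 0 \<longleftrightarrow> q' x = 0"
    unfolding dP[symmetric]
    by (subst AE_density) (auto simp: p_def)
  moreover have "{x \<in> space R. qR x = 0} \<in> sets P" "{x \<in> space R. q' x = 0} \<in> sets P"
    unfolding sets qR_def q'_def by measurable
  ultimately have "measure P {x \<in> space R. qR x = 0} = measure P {x \<in> space R. q' x = 0}"
    by (intro P.finite_measure_eq_AE) auto
  with int show ?thesis
    by (simp add: f_divergence_def f_divergence_wrt_def Let_def space uR_def[abs_def] u_def[abs_def]
        pR_def qR_def p'_def q'_def p_def q_def T_def[symmetric] cong: if_cong)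
qed

section \<open>Entropy of measures on spaces with a group action\<close>

text \<open>
  An action is given by its maps \<open>act g\<close>; the push-forward \<open>g\<nu>\<close> is \<open>distr \<nu> \<nu> (act g)\<close>.
\<close>

definition furstenberg_entropy ::
  "('a, 'b) monoid_scheme \<Rightarrow> 'a pmf \<Rightarrow> (real \<Rightarrow> real) \<Rightarrow> ('a \<Rightarrow> 'x \<Rightarrow> 'x) \<Rightarrow> 'x measure \<Rightarrow> ereal" where
  "furstenberg_entropy G lam f act \<nu> =
     (\<Sum>\<^sub>\<infinity>g\<in>carrier G. ereal (pmf lam g) * f_divergence f (distr \<nu> \<nu> (act g)) \<nu>)"

definition borel_of_topology :: "'x topology \<Rightarrow> 'x measure" where
  "borel_of_topology X = sigma (topspace X) {U. openin X U}"

definition I_top ::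
  "('a, 'b) monoid_scheme \<Rightarrow> 'a pmf \<Rightarrow> (real \<Rightarrow> real) \<Rightarrow> 'x topology \<Rightarrow> ('a \<Rightarrow> 'x \<Rightarrow> 'x) \<Rightarrow> ereal" where
  "I_top G lam f X act =
     (INF \<nu> \<in> {\<nu>. prob_space \<nu> \<and> sets \<nu> = sets (borel_of_topology X)}.
        furstenberg_entropy G lam f act \<nu>)"

definition I_group :: "('a, 'b) monoid_scheme \<Rightarrow> 'a pmf \<Rightarrow> (real \<Rightarrow> real) \<Rightarrow> ereal" where
  "I_group G lam f =
     (INF \<omega> \<in> {\<omega>. prob_space \<omega> \<and> sets \<omega> = sets (count_space (carrier G)) \<and>
                   (\<forall>g\<in>carrier G. 0 < measure \<omega> {g})}.
        furstenberg_entropy G lam f (\<lambda>g x. g \<otimes>\<^bsub>G\<^esub> x) \<omega>)"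

definition generating :: "('a, 'b) monoid_scheme \<Rightarrow> 'a pmf \<Rightarrow> bool" where
  "generating G lam \<longleftrightarrow> set_pmf lam \<subseteq> carrier G \<and> generate G (set_pmf lam) = carrier G"

section \<open>Hyperbolic groups and the Gromov boundary\<close>

definition gromov_product :: "('a \<Rightarrow> 'a \<Rightarrow> real) \<Rightarrow> 'a \<Rightarrow> 'a \<Rightarrow> 'a \<Rightarrow> real" where
  "gromov_product d w x y = (d w x + d w y - d x y) / 2"

definition gromov_hyperbolic :: "'a set \<Rightarrow> ('a \<Rightarrow> 'a \<Rightarrow> real) \<Rightarrow> bool" where
  "gromov_hyperbolic M d \<longleftrightarrow>
     (\<exists>\<delta>. \<forall>w\<in>M. \<forall>x\<in>M. \<forall>y\<in>M. \<forall>z\<in>M.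
        gromov_product d w x z \<ge> min (gromov_product d w x y) (gromov_product d w y z) - \<delta>)"

definition word_length :: "('a, 'b) monoid_scheme \<Rightarrow> 'a set \<Rightarrow> 'a \<Rightarrow> nat" where
  "word_length G S g =
     (LEAST n. \<exists>ws. length ws = n \<and> set ws \<subseteq> S \<union> m_inv G ` S \<and> foldr (\<otimes>\<^bsub>G\<^esub>) ws \<one>\<^bsub>G\<^esub> = g)"

definition word_dist :: "('a, 'b) monoid_scheme \<Rightarrow> 'a set \<Rightarrow> 'a \<Rightarrow> 'a \<Rightarrow> real" where
  "word_dist G S g h = real (word_length G S (inv\<^bsub>G\<^esub> g \<otimes>\<^bsub>G\<^esub> h))"

text \<open>
  A hyperbolic group comes with a finite generating set with respect to which it is
  hyperbolic; the boundary is defined from the word metric of that set.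
\<close>

definition hyperbolic_group :: "('a, 'b) monoid_scheme \<Rightarrow> 'a set \<Rightarrow> bool" where
  "hyperbolic_group G S \<longleftrightarrow>
     group G \<and> finite S \<and> S \<subseteq> carrier G \<and> generate G S = carrier G \<and>
     gromov_hyperbolic (carrier G) (word_dist G S)"

definition product_diverges ::
  "('a \<Rightarrow> 'a \<Rightarrow> real) \<Rightarrow> 'a \<Rightarrow> (nat \<Rightarrow> 'a) \<Rightarrow> (nat \<Rightarrow> 'a) \<Rightarrow> bool" where
  "product_diverges d w u v \<longleftrightarrow>
     filterlim (\<lambda>(i, j). gromov_product d w (u i) (v j)) at_top (sequentially \<times>\<^sub>F sequentially)"

definition converging_to_infinity ::
  "'a set \<Rightarrow> ('a \<Rightarrow> 'a \<Rightarrow> real) \<Rightarrow> 'a \<Rightarrow> (nat \<Rightarrow> 'a) set" where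
  "converging_to_infinity M d w = {u. range u \<subseteq> M \<and> product_diverges d w u u}"

definition gromov_boundary ::
  "'a set \<Rightarrow> ('a \<Rightarrow> 'a \<Rightarrow> real) \<Rightarrow> 'a \<Rightarrow> (nat \<Rightarrow> 'a) set set" where
  "gromov_boundary M d w =
     converging_to_infinity M d w //
       {(u, v). u \<in> converging_to_infinity M d w \<and> v \<in> converging_to_infinity M d w \<and>
                product_diverges d w u v}"

definition boundary_product ::
  "('a \<Rightarrow> 'a \<Rightarrow> real) \<Rightarrow> 'a \<Rightarrow> (nat \<Rightarrow> 'a) set \<Rightarrow> (nat \<Rightarrow> 'a) set \<Rightarrow> ereal" where
  "boundary_product d w \<xi> \<eta> =
     (SUP u\<in>\<xi>. SUP v\<in>\<eta>.
        Liminf (sequentially \<times>\<^sub>F sequentially) (\<lambda>(i, j). ereal (gromov_product d w (u i) (v j))))"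

text \<open>
  The topology in which the sets \<open>{\<eta>. boundary_product d w \<xi> \<eta> > r}\<close>, \<open>r\<close> real, form a
  neighbourhood base at \<open>\<xi>\<close>.
\<close>

definition boundary_open ::
  "'a set \<Rightarrow> ('a \<Rightarrow> 'a \<Rightarrow> real) \<Rightarrow> 'a \<Rightarrow> (nat \<Rightarrow> 'a) set set \<Rightarrow> bool" where
  "boundary_open M d w U \<longleftrightarrow>
     U \<subseteq> gromov_boundary M d w \<and>
     (\<forall>\<xi>\<in>U. \<exists>r::real. \<forall>\<eta>\<in>gromov_boundary M d w.
        ereal r < boundary_product d w \<xi> \<eta> \<longrightarrow> \<eta> \<in> U)"

definition boundary_topology ::
  "'a set \<Rightarrow> ('a \<Rightarrow> 'a \<Rightarrow> real) \<Rightarrow> 'a \<Rightarrow> (nat \<Rightarrow> 'a) set topology" where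
  "boundary_topology M d w = topology (boundary_open M d w)"

lemma openin_boundary_topology: "openin (boundary_topology M d w) = boundary_open M d w"
proof -
  have "istopology (boundary_open M d w)"
    unfolding istopology_def
  proof safe
    fix U V assume U: "boundary_open M d w U" and V: "boundary_open M d w V"
    show "boundary_open M d w (U \<inter> V)"
      unfolding boundary_open_def
    proof safe
      fix \<xi> assume "\<xi> \<in> U" "\<xi> \<in> V"
      then obtain r s :: real where
        "\<forall>\<eta>\<in>gromov_boundary M d w. ereal r < boundary_product d w \<xi> \<eta> \<longrightarrow> \<eta> \<in> U"
        "\<forall>\<eta>\<in>gromov_boundary M d w. ereal s < boundary_product d w \<xi> \<eta> \<longrightarrow> \<eta> \<in> V"
        using U V unfolding boundary_open_def by blast
      then show "\<exists>r::real. \<forall>\<eta>\<in>gromov_boundary M d w.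
          ereal r < boundary_product d w \<xi> \<eta> \<longrightarrow> \<eta> \<in> U \<inter> V"
        by (intro exI[of _ "max r s"]) (auto elim: le_less_trans[rotated])
    qed (use U in \<open>auto simp: boundary_open_def\<close>)
  next
    fix \<K> assume \<K>: "\<forall>K\<in>\<K>. boundary_open M d w K"
    show "boundary_open M d w (\<Union> \<K>)"
      using \<K> unfolding boundary_open_def by (meson Union_iff Union_least)
  qed
  then show ?thesis
    by (simp add: boundary_topology_def)
qed

lemma topspace_boundary_topology: "topspace (boundary_topology M d w) = gromov_boundary M d w"
proof -
  have "boundary_open M d w (gromov_boundary M d w)"
    by (simp add: boundary_open_def)
  then show ?thesis
    by (intro equalityI openin_subset)
      (auto simp: topspace_def openin_boundary_topology boundary_open_def)
qed

definition group_boundary :: "('a, 'b) monoid_scheme \<Rightarrow> 'a set \<Rightarrow> (nat \<Rightarrow> 'a) set topology" where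
  "group_boundary G S = boundary_topology (carrier G) (word_dist G S) \<one>\<^bsub>G\<^esub>"

definition boundary_action ::
  "('a, 'b) monoid_scheme \<Rightarrow> 'a \<Rightarrow> (nat \<Rightarrow> 'a) set \<Rightarrow> (nat \<Rightarrow> 'a) set" where
  "boundary_action G g \<xi> = (\<lambda>u n. g \<otimes>\<^bsub>G\<^esub> u n) ` \<xi>"

end

theory Submission
  imports Defs "HOL-Real_Asymp.Real_Asymp"
begin

text \<open>
  Write \<open>X\<close> for the boundary. The two infima are compared by moving measures between \<open>G\<close> and \<open>X\<close>
  along equivariant maps, since a Markov kernel does not increase an \<open>f\<close>-divergence.

  The inequality \<open>I_top \<le> I_group\<close> uses an orbit map. Fix a boundary point \<open>\<xi>\<close>, which exists because
  an infinite group has a geodesic ray. The map \<open>h \<mapsto> h\<xi>\<close> is equivariant, so the image \<open>\<nu>\<close> of a measure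
  \<open>\<omega>\<close> on \<open>G\<close> satisfies \<open>D_f(g\<nu> \<parallel> \<nu>) \<le> D_f(g\<omega> \<parallel> \<omega>)\<close> for every \<open>g\<close> (lemma \<open>I_top_le_I_group\<close>).

  The inequality \<open>I_group \<le> I_top\<close> uses the amenability of the action on \<open>X\<close>: for every finite \<open>F\<close> and
  \<open>\<epsilon> > 0\<close> there are a finite \<open>B\<close> and Borel maps \<open>m : X \<rightarrow> Prob(B)\<close> with \<open>\<parallel>g m(x) - m(gx)\<parallel> \<le> \<epsilon>\<close> for
  \<open>g \<in> F\<close> and \<open>x \<in> X\<close> (lemma \<open>boundary_action_amenable\<close>). Given \<open>\<nu>\<close> on \<open>X\<close>, put \<open>W = \<integral> m(x) d\<nu>(x)\<close> and
  \<open>\<rho>_g = \<integral> m(gx) d\<nu>(x)\<close>. Data processing gives \<open>D_f(\<rho>_g \<parallel> W) \<le> D_f(g\<nu> \<parallel> \<nu>)\<close>, but \<open>gW\<close> differs from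
  \<open>\<rho>_g\<close> by an error \<open>d_g\<close> that is small only in total mass, and \<open>D_f\<close> is not continuous in that norm.
  The remedy is to add to \<open>W\<close> a positive weight \<open>\<kappa>\<close> of small mass that dominates a large multiple of
  every \<open>\<bar>d_g\<bar>\<close>, \<open>g \<in> F\<close>, and is comparable to its translates with constants depending on \<open>F\<close> alone (lemma \<open>smoothing_density\<close>).
  After a supporting line at \<open>1\<close> is subtracted, \<open>f \<ge> 0\<close>. The perspective \<open>(p, q) \<mapsto> q f(p/q)\<close> is
  subadditive, so, with \<open>D_f\<close> extended to finite measures,
  \<open>D_f(g(W + \<kappa>) \<parallel> W + \<kappa>) \<le> D_f(\<rho>_g \<parallel> W) + D_f(d_g + g\<kappa> \<parallel> \<kappa>)\<close>, and in the last term the density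
  ranges over a fixed compact subset of \<open>(0,\<infinity>)\<close>, which bounds it by a constant times the mass of \<open>\<kappa>\<close>.

  For amenability let \<open>S\<^sub>k(x,\<xi>)\<close> be the set of points at distance \<open>l\<close> from some \<open>x'\<close> with \<open>d(x,x') \<le> k\<close> that
  lie on a geodesic from \<open>x'\<close> towards \<open>\<xi>\<close>. Hyperbolicity bounds its size linearly in \<open>k\<close> when \<open>l\<close> is
  large (lemma \<open>card_shell_le\<close>), and \<open>S\<^sub>k(x,\<xi>) \<subseteq> S\<^sub>k\<^sub>+\<^sub>r(y,\<xi>)\<close> when \<open>d(x,y) \<le> r\<close>. The average over \<open>n\<close>
  consecutive values of \<open>k\<close> of the uniform distributions on \<open>S\<^sub>k(1,\<xi>)\<close> is then almost equivariant: the
  error telescopes to \<open>O(ln n / n)\<close>. Borel measurability holds because "on a geodesic towards \<open>\<xi>\<close>" says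
  that \<open>\<xi>\<close> is a limit of a sequence in a fixed subset of \<open>G\<close>, a closed condition on \<open>\<xi>\<close>.
\<close>

section \<open>The perspective of a convex function\<close>

text \<open>
  The affine minorants \<open>t \<mapsto> a * t + b\<close> of \<open>f\<close> on \<open>(0,\<infinity>)\<close>, as pairs \<open>(a, b)\<close>.
\<close>

definition minorants :: "(real \<Rightarrow> real) \<Rightarrow> (real \<times> real) set" where
  "minorants f = {l. \<forall>t>0. fst l * t + snd l \<le> f t}"

text \<open>
  The closed perspective of \<open>f\<close>, that is \<open>q * f (p / q)\<close> extended to the boundary of the quadrant
  \<open>p, q \<ge> 0\<close>. As a supremum of linear functions it is subadditive, positively homogeneous and satisfies
  Jensen's inequality without any case distinction. It is used for \<open>f \<ge> 0\<close> only; then \<open>(0, 0)\<close> is a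
  minorant, and the truncation of negative values by \<open>ennreal\<close> does not change the supremum.
\<close>

definition persp :: "(real \<Rightarrow> real) \<Rightarrow> real \<Rightarrow> real \<Rightarrow> ennreal" where
  "persp f p q = (SUP l\<in>minorants f. ennreal (fst l * p + snd l * q))"

lemma persp_least:
  "(\<And>a b. (\<And>t. 0 < t \<Longrightarrow> a * t + b \<le> f t) \<Longrightarrow> ennreal (a * p + b * q) \<le> u) \<Longrightarrow> persp f p q \<le> u"
  unfolding persp_def minorants_def by (rule SUP_least) auto

lemma persp_upper:
  "(\<And>t. 0 < t \<Longrightarrow> a * t + b \<le> f t) \<Longrightarrow> ennreal (a * p + b * q) \<le> persp f p q"
  unfolding persp_def minorants_def by (rule SUP_upper2[of "(a, b)"]) auto

lemma persp_add_le: "persp f (p + p') (q + q') \<le> persp f p q + persp f p' q'"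
proof (rule persp_least)
  fix a b assume ab: "\<And>t. 0 < t \<Longrightarrow> a * t + b \<le> f t"
  have le: "ennreal (x + y) \<le> ennreal x + ennreal y" for x y
    by (auto simp: ennreal_plus_if intro: ennreal_leI)
  have "ennreal (a * (p + p') + b * (q + q')) \<le> ennreal (a * p + b * q) + ennreal (a * p' + b * q')"
    using le[of "a * p + b * q" "a * p' + b * q'"] by (simp add: algebra_simps)
  also have "\<dots> \<le> persp f p q + persp f p' q'"
    by (intro add_mono persp_upper ab)
  finally show "ennreal (a * (p + p') + b * (q + q')) \<le> persp f p q + persp f p' q'" .
qed

lemma persp_scale:
  assumes "0 \<le> c" shows "persp f (c * p) (c * q) = ennreal c * persp f p q"
  unfolding persp_def SUP_mult_left_ennreal
  by (rule SUP_cong) (use assms in \<open>auto simp: ennreal_mult'[symmetric] algebra_simps\<close>)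

lemma persp_scale_right: "0 \<le> q \<Longrightarrow> persp f 0 q = ennreal q * persp f 0 1"
  using persp_scale[of q f 0 1] by simp

lemma persp_scale_left: "0 \<le> p \<Longrightarrow> persp f p 0 = ennreal p * persp f 1 0"
  using persp_scale[of p f 1 0] by simp

text \<open>
  The line through \<open>(t, f t)\<close> with slope \<open>a\<close> is a minorant.
\<close>

lemma convex_supporting_line:
  assumes f: "convex_on {0<..} f" and t: "0 < (t::real)"
  obtains a where "\<And>s. 0 < s \<Longrightarrow> a * s + (f t - a * t) \<le> f s"
proof -
  define a where "a = Inf ((\<lambda>s. (f t - f s) / (t - s)) ` ({t<..} \<inter> {0<..}))"
  have "a * s + (f t - a * t) \<le> f s" if "0 < s" for s
    using convex_le_Inf_differential[OF f, of t s] t that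
    by (simp add: interior_open a_def[symmetric] algebra_simps)
  then show ?thesis by (rule that)
qed

lemma persp_pos:
  assumes f: "convex_on {0<..} f" and p: "0 < p" and q: "0 < q"
  shows "persp f p q = ennreal (q * f (p / q))"
proof (rule antisym)
  show "persp f p q \<le> ennreal (q * f (p / q))"
  proof (rule persp_least)
    fix a b assume "\<And>t. 0 < t \<Longrightarrow> a * t + b \<le> f t"
    from this[of "p / q"] have "q * (a * (p / q) + b) \<le> q * f (p / q)"
      using p q by (intro mult_left_mono) auto
    moreover have "q * (a * (p / q) + b) = a * p + b * q"
      using q by (simp add: field_simps)
    ultimately show "ennreal (a * p + b * q) \<le> ennreal (q * f (p / q))"
      by (intro ennreal_leI) simp
  qed
  obtain a where a: "\<And>s. 0 < s \<Longrightarrow> a * s + (f (p / q) - a * (p / q)) \<le> f s"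
    using convex_supporting_line[OF f, of "p / q"] p q by auto
  have "q * f (p / q) = a * p + (f (p / q) - a * (p / q)) * q"
    using q by (simp add: field_simps)
  then show "ennreal (q * f (p / q)) \<le> persp f p q"
    using persp_upper[of a "f (p / q) - a * (p / q)" f p q, OF a] by simp
qed

text \<open>
  The upper bound uses the supporting line at a small \<open>t\<close>: its slope is at most \<open>2 * f 1\<close>, and its
  intercept is at most \<open>persp f 0 1\<close>.
\<close>

lemma tendsto_at_zero_persp:
  assumes f: "convex_on {0<..} f" and f0: "\<And>t. 0 < t \<Longrightarrow> 0 \<le> f t"
  shows "((\<lambda>t. ennreal (f t)) \<longlongrightarrow> persp f 0 1) (at_right 0)"
proof (rule order_tendstoI)
  fix y assume "y < persp f 0 1"
  then obtain l where l: "l \<in> minorants f" "y < ennreal (snd l)"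
    unfolding persp_def less_SUP_iff by auto
  have "((\<lambda>t. ennreal (fst l * t + snd l)) \<longlongrightarrow> ennreal (fst l * 0 + snd l)) (at_right 0)"
    by (intro tendsto_intros)
  then have "\<forall>\<^sub>F t in at_right 0. y < ennreal (fst l * t + snd l)"
    using l by (intro order_tendstoD) auto
  then show "\<forall>\<^sub>F t in at_right 0. y < ennreal (f t)"
    using eventually_at_right_less[of 0]
  proof eventually_elim
    case (elim t)
    then show ?case using l(1) unfolding minorants_def
      by (auto intro: less_le_trans ennreal_leI)
  qed
next
  fix y assume y: "persp f 0 1 < y"
  have "((\<lambda>t. ennreal (2 * f 1 * t) + persp f 0 1) \<longlongrightarrow> ennreal (2 * f 1 * 0) + persp f 0 1) (at_right 0)"
    by (intro tendsto_intros)
  then have "\<forall>\<^sub>F t in at_right 0. ennreal (2 * f 1 * t) + persp f 0 1 < y"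
    using y by (intro order_tendstoD) auto
  moreover have "\<forall>\<^sub>F t::real in at_right 0. t < 1/2"
    by (rule order_tendstoD(2)[OF tendsto_ident_at]) simp
  ultimately show "\<forall>\<^sub>F t in at_right 0. ennreal (f t) < y"
    using eventually_at_right_less[of 0]
  proof eventually_elim
    case (elim t)
    obtain a where a: "\<And>s. 0 < s \<Longrightarrow> a * s + (f t - a * t) \<le> f s"
      using convex_supporting_line[OF f, of t] elim by auto
    have "a * (1 - t) \<le> f 1" using a[of 1] f0[of t] elim by (simp add: algebra_simps)
    have "a \<le> 2 * f 1"
    proof (cases "a \<le> 0")
      case True then show ?thesis using f0[of 1] by simp
    next
      case False
      then have "a * (1/2) \<le> a * (1 - t)" using elim by (intro mult_left_mono) auto
      then show ?thesis using \<open>a * (1 - t) \<le> f 1\<close> by simp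
    qed
    then have "a * t \<le> 2 * f 1 * t" using elim by (intro mult_right_mono) auto
    then have "ennreal (f t) \<le> ennreal (2 * f 1 * t + max 0 (f t - a * t))"
      by (intro ennreal_leI) auto
    also have "\<dots> = ennreal (2 * f 1 * t) + ennreal (f t - a * t)"
      using elim f0[of 1] by simp
    also have "\<dots> \<le> ennreal (2 * f 1 * t) + persp f 0 1"
      using persp_upper[of a "f t - a * t" f 0 1, OF a] by (intro add_left_mono) simp
    finally show ?case using elim by auto
  qed
qed

text \<open>
  The upper bound uses the supporting line at a large \<open>t\<close>: its intercept is at most \<open>2 * f 1\<close>, and its
  slope is at most \<open>persp f 1 0\<close>.
\<close>

lemma tendsto_slope_persp:
  assumes f: "convex_on {0<..} f" and f0: "\<And>t. 0 < t \<Longrightarrow> 0 \<le> f t"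
  shows "((\<lambda>t. ennreal (f t / t)) \<longlongrightarrow> persp f 1 0) at_top"
proof (rule order_tendstoI)
  fix y assume "y < persp f 1 0"
  then obtain l where l: "l \<in> minorants f" "y < ennreal (fst l)"
    unfolding persp_def less_SUP_iff by auto
  have "((\<lambda>t. ennreal (fst l + snd l * inverse t)) \<longlongrightarrow> ennreal (fst l + snd l * 0)) at_top"
    by (intro tendsto_add tendsto_ennrealI tendsto_mult tendsto_const tendsto_inverse_0_at_top filterlim_ident)
  then have "\<forall>\<^sub>F t in at_top. y < ennreal (fst l + snd l * inverse t)"
    using l by (intro order_tendstoD) auto
  then show "\<forall>\<^sub>F t in at_top. y < ennreal (f t / t)"
    using eventually_gt_at_top[of "0::real"]
  proof eventually_elim
    case (elim t)
    then have "fst l * t + snd l \<le> f t" using l(1) unfolding minorants_def by auto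
    from divide_right_mono[OF this, of t] have "fst l + snd l * inverse t \<le> f t / t"
      using elim by (simp add: add_divide_distrib divide_inverse[of "snd l"])
    then show ?case using elim by (auto intro: less_le_trans ennreal_leI)
  qed
next
  fix y assume y: "persp f 1 0 < y"
  have "((\<lambda>t. ennreal (2 * f 1 * inverse t) + persp f 1 0) \<longlongrightarrow> ennreal (2 * f 1 * 0) + persp f 1 0) at_top"
    by (intro tendsto_add tendsto_ennrealI tendsto_mult tendsto_const tendsto_inverse_0_at_top filterlim_ident)
  then have "\<forall>\<^sub>F t in at_top. ennreal (2 * f 1 * inverse t) + persp f 1 0 < y"
    using y by (intro order_tendstoD) auto
  then show "\<forall>\<^sub>F t in at_top. ennreal (f t / t) < y"
    using eventually_gt_at_top[of "2::real"]
  proof eventually_elim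
    case (elim t)
    obtain a where a: "\<And>s. 0 < s \<Longrightarrow> a * s + (f t - a * t) \<le> f s"
      using convex_supporting_line[OF f, of t] elim by auto
    define b where "b = f t - a * t"
    have "b * (t - 1) \<le> t * f 1"
      using mult_left_mono[OF a[of 1], of t] f0[of t] elim by (simp add: b_def algebra_simps)
    have "b \<le> 2 * f 1"
    proof (cases "b \<le> 0")
      case True then show ?thesis using f0[of 1] by simp
    next
      case False
      then have "b * (t/2) \<le> b * (t - 1)" using elim by (intro mult_left_mono) auto
      then have "b * t \<le> (2 * f 1) * t" using \<open>b * (t - 1) \<le> t * f 1\<close> by (simp add: algebra_simps)
      then show ?thesis using elim by simp
    qed
    then have "b * inverse t \<le> 2 * f 1 * inverse t" using elim by (intro mult_right_mono) auto
    moreover have "f t / t = a + b * inverse t" using elim by (simp add: b_def field_simps)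
    ultimately have "ennreal (f t / t) \<le> ennreal (2 * f 1 * inverse t + max 0 a)"
      by (intro ennreal_leI) auto
    also have "\<dots> = ennreal (2 * f 1 * inverse t) + ennreal a"
      using elim f0[of 1] by simp
    also have "\<dots> \<le> ennreal (2 * f 1 * inverse t) + persp f 1 0"
      using persp_upper[of a b f 1 0] a by (intro add_left_mono) (simp add: b_def)
    finally show ?case using elim by auto
  qed
qed

text \<open>
  The supremum defining the perspective is uncountable; measurability comes from the explicit formula on
  the open quadrant and on its two edges.
\<close>

lemma borel_measurable_persp:
  assumes f: "convex_on {0<..} f"
    and [measurable]: "p \<in> borel_measurable M" "q \<in> borel_measurable M"
    and nn: "\<And>x. 0 \<le> p x" "\<And>x. 0 \<le> q x"
  shows "(\<lambda>x. persp f (p x) (q x)) \<in> borel_measurable M"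
proof -
  have cont: "continuous_on {0<..} f"
    using f by (rule convex_on_continuous[OF open_greaterThan])
  define k where "k t = (if t \<in> {0<..} then f t else 0)" for t
  have [measurable]: "k \<in> borel_measurable borel"
    unfolding k_def by (rule borel_measurable_continuous_on_if) (use cont in auto)
  have "persp f (p x) (q x) = (if q x = 0 then ennreal (p x) * persp f 1 0
      else if p x = 0 then ennreal (q x) * persp f 0 1 else ennreal (q x * k (p x / q x)))" for x
  proof (cases "q x = 0 \<or> p x = 0")
    case False
    then have "0 < p x" "0 < q x" using nn[of x] by auto
    then show ?thesis using persp_pos[OF f, of "p x" "q x"] by (simp add: k_def)
  qed (use nn[of x] persp_scale_left[of "p x" f] persp_scale_right[of "q x" f] in auto)
  then show ?thesis by simp
qed

text \<open>
  If \<open>u\<close> is a nonnegative function plus an integrable one, the difference of the integrals of the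
  positive and of the negative part of \<open>u\<close> can be computed from the two summands.
\<close>

lemma ereal_integral_split:
  assumes [measurable]: "v \<in> borel_measurable M" and w: "integrable M w"
    and u: "\<And>x. x \<in> space M \<Longrightarrow> u x = enn2ereal (v x) + ereal (w x)"
  shows "ereal_integral M u = enn2ereal (\<integral>\<^sup>+ x. v x \<partial>M) + ereal (\<integral>x. w x \<partial>M)"
proof -
  have [measurable]: "w \<in> borel_measurable M" using w by auto
  \<comment> \<open>\<open>U\<close> agrees with \<open>u\<close> on the space and is measurable; \<open>u\<close> is unconstrained outside the space.\<close>
  define U where "U x = enn2ereal (v x) + ereal (w x)" for x
  have [measurable]: "U \<in> borel_measurable M" unfolding U_def by measurable
  define up where "up = (\<integral>\<^sup>+ x. e2ennreal (U x) \<partial>M)"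
  define um where "um = (\<integral>\<^sup>+ x. e2ennreal (- U x) \<partial>M)"
  define wp where "wp = (\<integral>\<^sup>+ x. ennreal (w x) \<partial>M)"
  define wm where "wm = (\<integral>\<^sup>+ x. ennreal (- w x) \<partial>M)"
  define V where "V = (\<integral>\<^sup>+ x. v x \<partial>M)"
  have pt: "e2ennreal (U x) + ennreal (- w x) = v x + ennreal (w x) + e2ennreal (- U x)" for x
  proof (cases "v x" rule: ennreal_cases)
    case (real r)
    then have "U x = ereal (r + w x)" by (simp add: U_def enn2ereal_ennreal)
    then show ?thesis using real
      by (auto simp: e2ennreal_ereal ennreal_plus_if ennreal_neg)
  next
    case top
    then show ?thesis by (simp add: U_def)
  qed
  have le: "e2ennreal (- U x) \<le> ennreal (- w x)" for x
  proof -
    have "- U x \<le> ereal (- w x)" by (cases "v x" rule: ennreal_cases) (auto simp: U_def enn2ereal_ennreal)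
    then show ?thesis using e2ennreal_mono e2ennreal_ereal by metis
  qed
  have eq: "up + wm = V + wp + um"
    unfolding up_def wm_def V_def wp_def um_def
    by (simp add: nn_integral_add[symmetric] pt)
  have fin: "wp < \<infinity>" "wm < \<infinity>"
    using w unfolding wp_def wm_def real_integrable_def by (auto simp: less_top)
  have "um \<le> wm" unfolding um_def wm_def by (intro nn_integral_mono le)
  then have fin': "um < \<infinity>" using fin by auto
  have "ereal_integral M u = enn2ereal up - enn2ereal um"
    unfolding ereal_integral_def up_def um_def
    by (intro arg_cong2[where f="(-)"] arg_cong[where f=enn2ereal] nn_integral_cong) (auto simp: u U_def)
  moreover have "(\<integral>x. w x \<partial>M) = enn2real wp - enn2real wm"
    unfolding wp_def wm_def by (rule real_lebesgue_integral_def[OF w])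
  moreover have "enn2ereal up - enn2ereal um = enn2ereal V + ereal (enn2real wp - enn2real wm)"
    using eq fin fin'
    apply (cases up rule: ennreal_cases; cases um rule: ennreal_cases; cases V rule: ennreal_cases;
        cases wp rule: ennreal_cases; cases wm rule: ennreal_cases)
    by (auto simp: enn2ereal_ennreal ennreal_plus[symmetric] simp del: ennreal_plus)
  ultimately show ?thesis by (simp add: V_def)
qed

lemma persp_comparable_le:
  assumes f: "convex_on {0<..} f" and c: "0 < c"
  obtains M where "0 \<le> M" "\<And>p q. 0 < q \<Longrightarrow> c * q \<le> p \<Longrightarrow> c * p \<le> q \<Longrightarrow> persp f p q \<le> ennreal (M * q)"
proof -
  have "continuous_on {0<..} f" using f by (rule convex_on_continuous[OF open_greaterThan])
  then have "continuous_on {c..1/c} f" by (rule continuous_on_subset) (use c in auto)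
  then have "bounded (f ` {c..1/c})" by (intro compact_imp_bounded compact_continuous_image compact_Icc)
  then obtain M where M: "\<forall>t\<in>{c..1/c}. \<bar>f t\<bar> \<le> M" unfolding bounded_iff by auto
  show ?thesis
  proof (rule that[of "max 0 M"])
    fix p q assume pq: "0 < q" "c * q \<le> p" "c * p \<le> q"
    then have p: "0 < p" using c by (meson less_le_trans mult_pos_pos)
    have "p / q \<in> {c..1/c}" using pq p c by (simp add: field_simps)
    then have "f (p / q) \<le> max 0 M" using M by fastforce
    then have "q * f (p / q) \<le> max 0 M * q" using pq by (simp add: mult.commute mult_right_mono)
    then show "persp f p q \<le> ennreal (max 0 M * q)" unfolding persp_pos[OF f p pq(1)] by (rule ennreal_leI)
  qed simp
qed

section \<open>The divergence as an integral of the perspective\<close>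

text \<open>
  The function \<open>f\<close> minus a supporting line \<open>t \<mapsto> a * (t - 1)\<close> at \<open>1\<close>. For convex \<open>f\<close> with \<open>f 1 = 0\<close> such a
  line exists, so the result is nonnegative; two probability measures have the same divergence with
  respect to \<open>f\<close> and to \<open>normalized f\<close>, because the line integrates to \<open>0\<close>.
\<close>

definition normalized :: "(real \<Rightarrow> real) \<Rightarrow> real \<Rightarrow> real" where
  "normalized f t = f t - (SOME a. \<forall>s>0. a * (s - 1) \<le> f s) * (t - 1)"

lemma normalized_props:
  assumes f: "convex_on {0<..} f" and f1: "f 1 = 0"
  shows "convex_on {0<..} (normalized f)" and "0 < t \<Longrightarrow> 0 \<le> normalized f t"
    and "\<exists>c. normalized f = (\<lambda>t. f t - c * (t - 1))"
proof -
  define c where "c = (SOME a. \<forall>s>0. a * (s - 1) \<le> f s)"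
  obtain a where "\<And>s. 0 < s \<Longrightarrow> a * s + (f 1 - a * 1) \<le> f s"
    using convex_supporting_line[OF f, of 1] by auto
  then have "\<exists>a. \<forall>s>0. a * (s - 1) \<le> f s" using f1 by (intro exI[of _ a]) (auto simp: algebra_simps)
  then have c: "\<forall>s>0. c * (s - 1) \<le> f s" unfolding c_def by (rule someI_ex)
  have eq: "normalized f = (\<lambda>t. f t - c * (t - 1))" by (simp add: normalized_def c_def fun_eq_iff)
  have lin: "convex_on {0<..} (\<lambda>t::real. - c * (t - 1))"
    by (rule convex_onI) (auto simp: algebra_simps)
  show "convex_on {0<..} (normalized f)"
    using convex_on_add[OF f lin] by (simp add: eq)
  show "0 < t \<Longrightarrow> 0 \<le> normalized f t" using c by (simp add: eq)
  show "\<exists>c. normalized f = (\<lambda>t. f t - c * (t - 1))" using eq by blast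
qed

lemma at_zero_eq_persp:
  assumes f: "convex_on {0<..} f" and f1: "f 1 = 0" and c: "normalized f = (\<lambda>t. f t - c * (t - 1))"
  shows "at_zero f = enn2ereal (persp (normalized f) 0 1) + ereal (- c)"
proof -
  note g = normalized_props[OF f f1]
  have "((\<lambda>t. enn2ereal (ennreal (normalized f t)) + ereal (c * (t - 1))) \<longlongrightarrow>
      enn2ereal (persp (normalized f) 0 1) + ereal (c * (0 - 1))) (at_right 0)"
    by (intro tendsto_add_ereal_general1 tendsto_enn2erealI tendsto_at_zero_persp g) (auto intro!: tendsto_eq_intros)
  then have "((\<lambda>t. ereal (f t)) \<longlongrightarrow> enn2ereal (persp (normalized f) 0 1) + ereal (c * (0 - 1))) (at_right 0)"
  proof (rule Lim_transform_eventually)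
    show "\<forall>\<^sub>F t in at_right 0. enn2ereal (ennreal (normalized f t)) + ereal (c * (t - 1)) = ereal (f t)"
      using eventually_at_right_less[of 0]
      by eventually_elim (use g(2) in \<open>simp add: enn2ereal_ennreal\<close>, simp add: c)
  qed
  then show ?thesis unfolding at_zero_def by (simp add: tendsto_Lim)
qed

lemma slope_at_infinity_eq_persp:
  assumes f: "convex_on {0<..} f" and f1: "f 1 = 0" and c: "normalized f = (\<lambda>t. f t - c * (t - 1))"
  shows "slope_at_infinity f = enn2ereal (persp (normalized f) 1 0) + ereal c"
proof -
  note g = normalized_props[OF f f1]
  have "((\<lambda>t. c * (1 - inverse t)) \<longlongrightarrow> c * (1 - 0)) at_top"
    by (intro tendsto_mult tendsto_diff tendsto_const tendsto_inverse_0_at_top filterlim_ident)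
  then have "((\<lambda>t. enn2ereal (ennreal (normalized f t / t)) + ereal (c * (1 - inverse t))) \<longlongrightarrow>
      enn2ereal (persp (normalized f) 1 0) + ereal (c * (1 - 0))) at_top"
    by (intro tendsto_add_ereal_general1 tendsto_enn2erealI tendsto_slope_persp g) (auto intro!: tendsto_ereal)
  then have "((\<lambda>t. ereal (f t / t)) \<longlongrightarrow> enn2ereal (persp (normalized f) 1 0) + ereal (c * (1 - 0))) at_top"
  proof (rule Lim_transform_eventually)
    show "\<forall>\<^sub>F t in at_top. enn2ereal (ennreal (normalized f t / t)) + ereal (c * (1 - inverse t)) = ereal (f t / t)"
      using eventually_gt_at_top[of "0::real"]
    proof eventually_elim
      case (elim t)
      then have "normalized f t / t + c * (1 - inverse t) = f t / t" by (simp add: c field_simps)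
      then show ?case using g(2)[OF elim] elim by (simp add: enn2ereal_ennreal)
    qed
  qed
  then show ?thesis unfolding slope_at_infinity_def by (simp add: tendsto_Lim)
qed

lemma ereal_affine_mult: "0 \<le> e \<Longrightarrow> (e + ereal r) * ereal q = e * ereal q + ereal (r * q)"
  by (cases e) (auto simp: algebra_simps)

text \<open>
  The three regimes of the divergence, with limits at \<open>0\<close> and at infinity, are absorbed into one
  integral of the nonnegative perspective. In particular the divergence is nonnegative.
\<close>

lemma f_divergence_wrt_eq_persp:
  assumes f: "convex_on {0<..} f" and f1: "f 1 = 0"
    and P: "prob_space P" and Q: "prob_space Q" and R: "sigma_finite_measure R"
    and [measurable]: "p \<in> borel_measurable R" "q \<in> borel_measurable R"
    and nn: "\<And>x. 0 \<le> p x" "\<And>x. 0 \<le> q x"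
    and dP: "P = density R (\<lambda>x. ennreal (p x))" and dQ: "Q = density R (\<lambda>x. ennreal (q x))"
  shows "ereal_integral R (\<lambda>x. if 0 < q x then ext_zero f (p x / q x) * ereal (q x) else 0)
        + ereal (measure P {x \<in> space R. q x = 0}) * slope_at_infinity f
     = enn2ereal (\<integral>\<^sup>+ x. persp (normalized f) (p x) (q x) \<partial>R)" (is "?L = _")
proof -
  note g = normalized_props[OF f f1]
  obtain c where c: "normalized f = (\<lambda>t. f t - c * (t - 1))" using g(3) by blast
  interpret P: prob_space P by fact
  interpret Q: prob_space Q by fact
  have [measurable]: "(\<lambda>x. persp (normalized f) (p x) (q x)) \<in> borel_measurable R"
    by (intro borel_measurable_persp g nn) auto
  have ints: "integrable R p" "integrable R q" "(\<integral>x. p x \<partial>R) = 1" "(\<integral>x. q x \<partial>R) = 1"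
  proof -
    have "(\<integral>\<^sup>+x. ennreal (p x) \<partial>R) = ennreal 1" "(\<integral>\<^sup>+x. ennreal (q x) \<partial>R) = ennreal 1"
      using P.emeasure_space_1 Q.emeasure_space_1 by (simp_all add: dP dQ emeasure_density cong: nn_integral_cong)
    then show "integrable R p" "integrable R q" "(\<integral>x. p x \<partial>R) = 1" "(\<integral>x. q x \<partial>R) = 1"
      using nn_integral_eq_integrable[of p R 1] nn_integral_eq_integrable[of q R 1] nn by auto
  qed
  define Z where "Z = {x \<in> space R. q x = 0}"
  have Z[measurable]: "Z \<in> sets R" unfolding Z_def by measurable
  have P0: "emeasure P Z = (\<integral>\<^sup>+x. ennreal (p x) * indicator Z x \<partial>R)"
    unfolding dP by (simp add: emeasure_density)
  have "emeasure P Z = (\<integral>\<^sup>+x. ennreal (p x * indicator Z x) \<partial>R)"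
    unfolding P0 by (intro nn_integral_cong) (simp add: indicator_def)
  then have P0': "measure P Z = (\<integral>x. p x * indicator Z x \<partial>R)"
    unfolding measure_def by (subst integral_eq_nn_integral) (use nn in auto)
  define v where "v x = (if 0 < q x then persp (normalized f) (p x) (q x) else 0)" for x
  \<comment> \<open>On \<open>q x > 0\<close> this is the contribution \<open>c * (p x - q x)\<close> of the supporting line; it vanishes where \<open>q x = 0\<close>.\<close>
  define w where "w x = c * (p x - p x * indicator Z x - q x)" for x
  have [measurable]: "v \<in> borel_measurable R" unfolding v_def by measurable
  have pZ: "integrable R (\<lambda>x. p x * indicator Z x)"
    by (rule integrable_mult_indicator[OF Z ints(1), simplified mult.commute[of "_ :: real"] real_scaleR_def])
  have w: "integrable R w" unfolding w_def using ints(1,2) pZ by auto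
  have int_w: "(\<integral>x. w x \<partial>R) = - c * measure P Z"
    unfolding w_def P0' using ints pZ by (simp add: algebra_simps)
  have "ereal_integral R (\<lambda>x. if 0 < q x then ext_zero f (p x / q x) * ereal (q x) else 0)
    = enn2ereal (\<integral>\<^sup>+x. v x \<partial>R) + ereal (\<integral>x. w x \<partial>R)"
  proof (rule ereal_integral_split)
    fix x assume x: "x \<in> space R"
    show "(if 0 < q x then ext_zero f (p x / q x) * ereal (q x) else 0) = enn2ereal (v x) + ereal (w x)"
    proof (cases "0 < q x")
      case False
      then show ?thesis using x nn(2)[of x] by (simp add: v_def w_def Z_def zero_ennreal.rep_eq)
    next
      case q: True
      show ?thesis
      proof (cases "p x = 0")
        case True
        have "ext_zero f (p x / q x) * ereal (q x)
            = enn2ereal (persp (normalized f) 0 1) * ereal (q x) + ereal (- c * q x)"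
          using True by (simp add: ext_zero_def at_zero_eq_persp[OF f f1 c] ereal_affine_mult)
        also have "\<dots> = enn2ereal (v x) + ereal (w x)"
          using q True persp_scale_right[of "q x" "normalized f"]
          by (simp add: v_def w_def Z_def times_ennreal.rep_eq enn2ereal_ennreal mult.commute)
        finally show ?thesis using q by simp
      next
        case False
        then have p: "0 < p x" using nn(1)[of x] by simp
        have "f (p x / q x) * q x = q x * normalized f (p x / q x) + c * (p x - q x)"
          using q by (simp add: c field_simps)
        moreover have "0 \<le> normalized f (p x / q x)" using g(2) p q by simp
        ultimately show ?thesis using p q
          by (simp add: ext_zero_def v_def w_def Z_def persp_pos[OF g(1)] enn2ereal_ennreal)
      qed
    qed
  qed (fact, fact)
  then have "?L = enn2ereal (\<integral>\<^sup>+x. v x \<partial>R) + ereal (- c * measure P Z)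
      + ereal (measure P Z) * (enn2ereal (persp (normalized f) 1 0) + ereal c)"
    by (simp add: int_w slope_at_infinity_eq_persp[OF f f1 c] Z_def)
  also have "\<dots> = enn2ereal (\<integral>\<^sup>+x. v x \<partial>R) + enn2ereal (persp (normalized f) 1 0) * ereal (measure P Z)"
    using ereal_affine_mult[of "enn2ereal (persp (normalized f) 1 0)" c "measure P Z"]
    by (cases "enn2ereal (persp (normalized f) 1 0) * ereal (measure P Z)")
      (auto simp: mult.commute add.assoc)
  also have "\<dots> = enn2ereal ((\<integral>\<^sup>+x. v x \<partial>R) + persp (normalized f) 1 0 * emeasure P Z)"
    by (simp add: plus_ennreal.rep_eq times_ennreal.rep_eq P.emeasure_eq_measure enn2ereal_ennreal)
  also have "persp (normalized f) 1 0 * emeasure P Z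
      = (\<integral>\<^sup>+x. persp (normalized f) 1 0 * (ennreal (p x) * indicator Z x) \<partial>R)"
    unfolding P0 by (simp add: nn_integral_cmult)
  also have "(\<integral>\<^sup>+x. v x \<partial>R) + \<dots> = (\<integral>\<^sup>+x. v x + persp (normalized f) 1 0 * (ennreal (p x) * indicator Z x) \<partial>R)"
    by (simp add: nn_integral_add)
  also have "\<dots> = (\<integral>\<^sup>+x. persp (normalized f) (p x) (q x) \<partial>R)"
  proof (rule nn_integral_cong)
    fix x assume "x \<in> space R"
    then show "v x + persp (normalized f) 1 0 * (ennreal (p x) * indicator Z x) = persp (normalized f) (p x) (q x)"
      using nn(1,2)[of x] persp_scale_left[of "p x" "normalized f"]
      by (cases "q x = 0") (auto simp: v_def Z_def mult.commute)
  qed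
  finally show ?thesis .
qed

lemma f_divergence_eq_persp:
  assumes f: "convex_on {0<..} f" and f1: "f 1 = 0"
    and P: "prob_space P" and Q: "prob_space Q" and R: "sigma_finite_measure R"
    and [measurable]: "p \<in> borel_measurable R" "q \<in> borel_measurable R"
    and nn: "\<And>x. 0 \<le> p x" "\<And>x. 0 \<le> q x"
    and dP: "P = density R (\<lambda>x. ennreal (p x))" and dQ: "Q = density R (\<lambda>x. ennreal (q x))"
  shows "f_divergence f P Q = enn2ereal (\<integral>\<^sup>+ x. persp (normalized f) (p x) (q x) \<partial>R)"
proof -
  interpret P: prob_space P by fact
  interpret Q: prob_space Q by fact
  interpret R: sigma_finite_measure R by fact
  define p' where "p' x = enn2real (RN_deriv R P x)" for x
  define q' where "q' x = enn2real (RN_deriv R Q x)" for x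
  have [measurable]: "p' \<in> borel_measurable R" "q' \<in> borel_measurable R"
    unfolding p'_def q'_def by measurable
  have p': "AE x in R. p' x = p x" and q': "AE x in R. q' x = q x"
  proof -
    have "AE x in R. ennreal (p x) = RN_deriv R P x" "AE x in R. ennreal (q x) = RN_deriv R Q x"
      by (intro R.RN_deriv_unique; simp add: dP dQ)+
    then show "AE x in R. p' x = p x" "AE x in R. q' x = q x"
      unfolding p'_def q'_def by (eventually_elim, metis nn enn2real_ennreal)+
  qed
  have dP': "P = density R (\<lambda>x. ennreal (p' x))" and dQ': "Q = density R (\<lambda>x. ennreal (q' x))"
    unfolding dP dQ using p' q' by (auto intro!: density_cong)
  have "f_divergence f P Q = f_divergence_wrt R f P Q"
    by (rule f_divergence_eq_wrt[OF f R P.finite_measure_axioms Q.finite_measure_axioms])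
      (auto simp: dP dQ intro: absolutely_continuousI_density)
  also have "\<dots> = enn2ereal (\<integral>\<^sup>+ x. persp (normalized f) (p' x) (q' x) \<partial>R)"
    using f_divergence_wrt_eq_persp[OF f f1 P Q R _ _ _ _ dP' dQ']
    unfolding f_divergence_wrt_def Let_def p'_def[symmetric] q'_def[symmetric]
    by (simp add: p'_def q'_def)
  also have "(\<integral>\<^sup>+ x. persp (normalized f) (p' x) (q' x) \<partial>R) = (\<integral>\<^sup>+ x. persp (normalized f) (p x) (q x) \<partial>R)"
    using p' q' by (intro nn_integral_cong_AE) (auto elim!: eventually_mono[OF eventually_conj])
  finally show ?thesis .
qed

text \<open>
  The sub-Markov kernel \<open>k\<close> from the dominated space to the countable set \<open>Y\<close> sends the densities \<open>p\<close> and \<open>q\<close>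
  to weights on \<open>Y\<close>. Jensen's inequality holds for each \<open>y\<close> and is then summed over \<open>Y\<close>.
\<close>

lemma persp_data_processing:
  assumes f: "convex_on {0<..} f"
    and Y: "countable Y"
    and [measurable]: "p \<in> borel_measurable R" "q \<in> borel_measurable R"
    and nn: "\<And>x. 0 \<le> p x" "\<And>x. 0 \<le> q x"
    and k[measurable]: "\<And>y. y \<in> Y \<Longrightarrow> k y \<in> borel_measurable R"
    and k0: "\<And>y x. y \<in> Y \<Longrightarrow> 0 \<le> k y x"
    and k1: "\<And>x. x \<in> space R \<Longrightarrow> (\<integral>\<^sup>+ y. ennreal (k y x) \<partial>count_space Y) \<le> 1"
    and int: "\<And>y. y \<in> Y \<Longrightarrow> integrable R (\<lambda>x. k y x * p x)" "\<And>y. y \<in> Y \<Longrightarrow> integrable R (\<lambda>x. k y x * q x)"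
  shows "(\<integral>\<^sup>+ y. persp f (\<integral>x. k y x * p x \<partial>R) (\<integral>x. k y x * q x \<partial>R) \<partial>count_space Y)
    \<le> (\<integral>\<^sup>+ x. persp f (p x) (q x) \<partial>R)"
proof -
  have [measurable]: "(\<lambda>x. persp f (p x) (q x)) \<in> borel_measurable R"
    by (intro borel_measurable_persp f nn) auto
  have jensen: "persp f (\<integral>x. k y x * p x \<partial>R) (\<integral>x. k y x * q x \<partial>R)
      \<le> (\<integral>\<^sup>+ x. ennreal (k y x) * persp f (p x) (q x) \<partial>R)" if y: "y \<in> Y" for y
  proof (rule persp_least)
    fix a b assume ab: "\<And>t. 0 < t \<Longrightarrow> a * t + b \<le> f t"
    define h where "h x = k y x * (a * p x + b * q x)" for x
    have h: "integrable R h"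
    proof -
      have "h = (\<lambda>x. a * (k y x * p x) + b * (k y x * q x))" by (auto simp: h_def algebra_simps)
      then show ?thesis using int y by simp
    qed
    have "a * (\<integral>x. k y x * p x \<partial>R) + b * (\<integral>x. k y x * q x \<partial>R)
        = (\<integral>x. a * (k y x * p x) + b * (k y x * q x) \<partial>R)"
      using int[OF y] by simp
    also have "\<dots> = (\<integral>x. h x \<partial>R)" by (simp add: h_def algebra_simps)
    also have "\<dots> \<le> (\<integral>x. max 0 (h x) \<partial>R)"
      using h by (intro integral_mono) auto
    finally have "ennreal (a * (\<integral>x. k y x * p x \<partial>R) + b * (\<integral>x. k y x * q x \<partial>R))
        \<le> ennreal (\<integral>x. max 0 (h x) \<partial>R)" by (rule ennreal_leI)
    also have "\<dots> = (\<integral>\<^sup>+x. ennreal (max 0 (h x)) \<partial>R)"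
      using h by (intro nn_integral_eq_integral[symmetric]) auto
    also have "\<dots> \<le> (\<integral>\<^sup>+ x. ennreal (k y x) * persp f (p x) (q x) \<partial>R)"
    proof (rule nn_integral_mono)
      fix x
      have "ennreal (max 0 (h x)) = ennreal (k y x) * ennreal (a * p x + b * q x)"
        using k0[OF y] by (simp add: h_def ennreal_mult')
      also have "\<dots> \<le> ennreal (k y x) * persp f (p x) (q x)"
        by (intro mult_left_mono persp_upper ab) auto
      finally show "ennreal (max 0 (h x)) \<le> ennreal (k y x) * persp f (p x) (q x)" .
    qed
    finally show "ennreal (a * (\<integral>x. k y x * p x \<partial>R) + b * (\<integral>x. k y x * q x \<partial>R))
      \<le> (\<integral>\<^sup>+ x. ennreal (k y x) * persp f (p x) (q x) \<partial>R)" .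
  qed
  have "(\<integral>\<^sup>+ y. persp f (\<integral>x. k y x * p x \<partial>R) (\<integral>x. k y x * q x \<partial>R) \<partial>count_space Y)
      \<le> (\<integral>\<^sup>+ y. \<integral>\<^sup>+ x. ennreal (k y x) * persp f (p x) (q x) \<partial>R \<partial>count_space Y)"
    by (intro nn_integral_mono jensen) simp
  also have "\<dots> = (\<integral>\<^sup>+ x. \<integral>\<^sup>+ y. ennreal (k y x) * persp f (p x) (q x) \<partial>count_space Y \<partial>R)"
    by (intro nn_integral_count_space_nn_integral[symmetric] Y) measurable
  also have "\<dots> = (\<integral>\<^sup>+ x. (\<integral>\<^sup>+ y. ennreal (k y x) \<partial>count_space Y) * persp f (p x) (q x) \<partial>R)"
    by (intro nn_integral_cong nn_integral_multc) simp
  also have "\<dots> \<le> (\<integral>\<^sup>+ x. 1 * persp f (p x) (q x) \<partial>R)"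
    by (intro nn_integral_mono mult_right_mono k1) auto
  finally show ?thesis by simp
qed

section \<open>Data processing\<close>

lemma discrete_measure_eq_density:
  assumes "prob_space M" "sets M = sets (count_space C)" "countable C"
  shows "M = density (count_space C) (\<lambda>x. ennreal (measure M {x}))"
proof -
  interpret prob_space M by fact
  show ?thesis
  proof (rule measure_eqI_countable)
    show "sets M = Pow C" "sets (density (count_space C) (\<lambda>x. ennreal (measure M {x}))) = Pow C"
      using assms(2) by auto
    fix a assume "a \<in> C"
    then show "emeasure M {a} = emeasure (density (count_space C) (\<lambda>x. ennreal (measure M {x}))) {a}"
      by (simp add: emeasure_density emeasure_eq_measure nn_integral_indicator_singleton' )
  qed fact
qed

lemma integrable_density_prob:
  assumes "prob_space M" "M = density R (\<lambda>x. ennreal (p x))" "p \<in> borel_measurable R" "\<And>x. 0 \<le> p x"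
  shows "integrable R p"
proof -
  interpret prob_space M by fact
  have "(\<integral>\<^sup>+x. ennreal (p x) \<partial>R) = ennreal 1"
    using emeasure_space_1 assms(3) by (simp add: assms(2) emeasure_density cong: nn_integral_cong)
  then show ?thesis using nn_integral_eq_integrable[of p R 1] assms by auto
qed

lemma f_divergence_kernel_le:
  assumes f: "convex_on {0<..} f" "f 1 = 0"
    and P: "prob_space P" and Q: "prob_space Q" and sets: "sets P = sets Q"
    and Y: "countable Y" and k: "\<And>y. y \<in> Y \<Longrightarrow> k y \<in> borel_measurable Q"
    and k0: "\<And>y x. y \<in> Y \<Longrightarrow> 0 \<le> k y x"
    and k1: "\<And>x. x \<in> space Q \<Longrightarrow> (\<integral>\<^sup>+ y. ennreal (k y x) \<partial>count_space Y) \<le> 1"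
  shows "enn2ereal (\<integral>\<^sup>+ y. persp (normalized f) (\<integral>x. k y x \<partial>P) (\<integral>x. k y x \<partial>Q) \<partial>count_space Y)
    \<le> f_divergence f P Q"
proof -
  interpret P: prob_space P by fact
  interpret Q: prob_space Q by fact
  note g = normalized_props[OF f]
  define R where "R = plus_measure P Q"
  have sR: "sets R = sets P" "space R = space P" by (simp_all add: R_def)
  have sp: "space P = space Q" by (rule sets_eq_imp_space_eq[OF sets])
  have eR: "emeasure R A = emeasure P A + emeasure Q A" if "A \<in> sets P" for A
    unfolding R_def using that sets by (intro emeasure_plus_measure) auto
  interpret R: finite_measure R
    by standard (use eR[OF sets.top] P.emeasure_space_1 Q.emeasure_space_1 in \<open>simp add: sR sp\<close>)
  have ac: "absolutely_continuous R P" "absolutely_continuous R Q"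
    unfolding absolutely_continuous_def null_sets_def using eR sets sR by auto
  define p where "p x = enn2real (RN_deriv R P x)" for x
  define q where "q x = enn2real (RN_deriv R Q x)" for x
  have [measurable]: "p \<in> borel_measurable R" "q \<in> borel_measurable R"
    unfolding p_def q_def by measurable
  have nn: "\<And>x. 0 \<le> p x" "\<And>x. 0 \<le> q x" by (simp_all add: p_def q_def)
  have dens: "M = density R (\<lambda>x. ennreal (enn2real (RN_deriv R M x)))"
    if M: "finite_measure M" "absolutely_continuous R M" "sets M = sets R" for M
  proof -
    interpret M: finite_measure M by fact
    have "AE x in R. RN_deriv R M x \<noteq> \<infinity>"
      by (intro R.RN_deriv_finite M.sigma_finite_measure_axioms M)
    then have "density R (\<lambda>x. ennreal (enn2real (RN_deriv R M x))) = density R (RN_deriv R M)"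
      by (intro density_cong) (auto simp: less_top[symmetric])
    also have "\<dots> = M" by (rule R.density_RN_deriv[OF M(2,3)])
    finally show ?thesis by simp
  qed
  have dP: "P = density R (\<lambda>x. ennreal (p x))" and dQ: "Q = density R (\<lambda>x. ennreal (q x))"
    unfolding p_def q_def
    by (intro dens P.finite_measure_axioms Q.finite_measure_axioms ac; simp add: sR sets)+
  have km: "k y \<in> borel_measurable R" if "y \<in> Y" for y
    using k[OF that] sR(1) sets by (metis measurable_cong_sets)
  have kle: "k y x \<le> 1" if "y \<in> Y" "x \<in> space R" for y x
  proof -
    have "ennreal (k y x) \<le> (\<integral>\<^sup>+ y. ennreal (k y x) \<partial>count_space Y)" by (rule nn_integral_ge_point[OF that(1)])
    also have "\<dots> \<le> 1" using k1 that(2) by (simp add: sR sp)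
    finally show ?thesis by simp
  qed
  have int: "integrable R (\<lambda>x. k y x * r x)"
    if y: "y \<in> Y" and r: "integrable R r" "\<And>x. 0 \<le> r x" for y and r :: "_ \<Rightarrow> real"
  proof (rule Bochner_Integration.integrable_bound[OF r(1)])
    show "(\<lambda>x. k y x * r x) \<in> borel_measurable R" using km[OF y] r(1) by measurable
    show "AE x in R. norm (k y x * r x) \<le> norm (r x)"
      using kle[OF y] k0[OF y] r(2) by (intro AE_I2) (simp add: abs_mult mult_left_le_one_le)
  qed
  have ip: "integrable R p" by (rule integrable_density_prob[OF P dP]) (simp_all add: nn)
  have iq: "integrable R q" by (rule integrable_density_prob[OF Q dQ]) (simp_all add: nn)
  have eq: "(\<integral>x. k y x \<partial>P) = (\<integral>x. k y x * p x \<partial>R)" "(\<integral>x. k y x \<partial>Q) = (\<integral>x. k y x * q x \<partial>R)"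
    if y: "y \<in> Y" for y
    by (subst dP dQ, subst integral_density; use km[OF y] nn in \<open>simp add: mult.commute\<close>)+
  have "(\<integral>\<^sup>+ y. persp (normalized f) (\<integral>x. k y x \<partial>P) (\<integral>x. k y x \<partial>Q) \<partial>count_space Y)
    = (\<integral>\<^sup>+ y. persp (normalized f) (\<integral>x. k y x * p x \<partial>R) (\<integral>x. k y x * q x \<partial>R) \<partial>count_space Y)"
    using eq by (intro nn_integral_cong) simp
  also have "\<dots> \<le> (\<integral>\<^sup>+ x. persp (normalized f) (p x) (q x) \<partial>R)"
    using k0 k1 by (intro persp_data_processing g Y nn km int ip iq) (auto simp: sR sp)
  also have "enn2ereal \<dots> = f_divergence f P Q"
    by (rule f_divergence_eq_persp[OF f P Q R.sigma_finite_measure_axioms _ _ nn dP dQ, symmetric]) measurable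
  finally show ?thesis by (simp add: less_eq_ennreal.rep_eq)
qed

text \<open>
  Here the dominating measure is the counting measure on the countable set \<open>K\<close> that carries both
  measures, viewed as a measure on the whole space.
\<close>

lemma f_divergence_countable_support:
  assumes f: "convex_on {0<..} f" "f 1 = 0"
    and P: "prob_space P" and Q: "prob_space Q" and sets: "sets P = sets Q"
    and K: "countable K" "\<And>x. x \<in> K \<Longrightarrow> {x} \<in> sets Q"
    and PK: "emeasure P (space P - K) = 0" and QK: "emeasure Q (space Q - K) = 0"
  shows "f_divergence f P Q
    = enn2ereal (\<integral>\<^sup>+ x. persp (normalized f) (measure P {x}) (measure Q {x}) \<partial>count_space K)"
proof -
  note sp = sets_eq_imp_space_eq[OF sets]
  \<comment> \<open>Only the \<open>\<sigma>\<close>-algebra of \<open>Q\<close> matters here.\<close>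
  define R where "R = distr (count_space K) Q (\<lambda>x. x)"
  have OQ: "K \<subseteq> space Q" using K(2) sets.sets_into_space by fastforce
  have Ym: "Y \<in> sets Q" if "Y \<subseteq> K" for Y
    by (rule sets.countable[OF _ countable_subset[OF that K(1)]]) (use that K(2) in auto)
  have [measurable]: "(\<lambda>x. x) \<in> measurable (count_space K) Q" using OQ by auto
  have eR: "emeasure R A = emeasure (count_space K) (A \<inter> K)" if "A \<in> sets Q" for A
    unfolding R_def using that OQ by (subst emeasure_distr) auto
  have sR: "sets R = sets Q" "space R = space Q" by (auto simp: R_def)
  have R: "sigma_finite_measure R"
  proof
    show "\<exists>A. countable A \<and> A \<subseteq> sets R \<and> \<Union>A = space R \<and> (\<forall>a\<in>A. emeasure R a \<noteq> \<infinity>)"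
    proof (intro exI conjI ballI)
      show "countable (insert (space Q - K) ((\<lambda>x. {x}) ` K))" using K by auto
      show "insert (space Q - K) ((\<lambda>x. {x}) ` K) \<subseteq> sets R" using K Ym by (auto simp: sR)
      show "\<Union>(insert (space Q - K) ((\<lambda>x. {x}) ` K)) = space R" using OQ by (auto simp: sR)
      fix a assume "a \<in> insert (space Q - K) ((\<lambda>x. {x}) ` K)"
      then show "emeasure R a \<noteq> \<infinity>"
      proof
        assume "a = space Q - K"
        moreover have "(space Q - K) \<inter> K = {}" by blast
        ultimately show ?thesis using eR[of a] Ym by auto
      next
        assume "a \<in> (\<lambda>x. {x}) ` K"
        then show ?thesis using K by (auto simp: eR)
      qed
    qed
  qed
  have dens: "(\<lambda>x. if x \<in> K then measure M {x} else 0) \<in> borel_measurable R \<and>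
      M = density R (\<lambda>x. ennreal (if x \<in> K then measure M {x} else 0))"
    if M: "prob_space M" "sets M = sets Q" "emeasure M (space M - K) = 0" for M
  proof
    interpret M: prob_space M by fact
    show meas: "(\<lambda>x. if x \<in> K then measure M {x} else 0) \<in> borel_measurable R"
      unfolding borel_measurable_iff_greater
    proof
      fix a :: real
      show "{w \<in> space R. a < (if w \<in> K then measure M {w} else 0)} \<in> sets R"
      proof (cases "a < 0")
        case True
        then have "{w \<in> space R. a < (if w \<in> K then measure M {w} else 0)} = space R"
          by (auto intro: less_le_trans)
        then show ?thesis by simp
      next
        case False
        then have "{w \<in> space R. a < (if w \<in> K then measure M {w} else 0)} \<subseteq> K" by (auto split: if_splits)
        then show ?thesis unfolding sR(1) by (rule Ym)
      qed
    qed
    show "M = density R (\<lambda>x. ennreal (if x \<in> K then measure M {x} else 0))"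
    proof (rule measure_eqI)
      fix A assume A: "A \<in> sets M"
      have spM: "space M = space Q" using M(2) by (rule sets_eq_imp_space_eq)
      have "emeasure M A = emeasure M (A \<inter> K)"
      proof -
        have "A - A \<inter> K \<subseteq> space M - K" using sets.sets_into_space[OF A] by blast
        moreover have "space M - K \<in> sets M" using Ym M(2) by auto
        ultimately have "emeasure M (A - A \<inter> K) = 0" using M(3) emeasure_mono[of "A - A \<inter> K" "space M - K" M] by auto
        moreover have "A \<inter> K \<in> sets M" using Ym M(2) by auto
        moreover have "A \<inter> K \<union> (A - A \<inter> K) = A" by blast
        ultimately show ?thesis using A plus_emeasure[of "A \<inter> K" M "A - A \<inter> K"] by auto
      qed
      also have "\<dots> = (\<integral>\<^sup>+x. emeasure M {x} \<partial>count_space (A \<inter> K))"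
        using K M(2) by (intro emeasure_countable_singleton) (auto intro: countable_subset[OF _ K(1)])
      also have "\<dots> = (\<integral>\<^sup>+x. emeasure M {x} * indicator A x \<partial>count_space K)"
      proof -
        have "(\<integral>\<^sup>+x. emeasure M {x} \<partial>count_space (A \<inter> K))
            = (\<integral>\<^sup>+x. emeasure M {x} * indicator (A \<inter> K) x \<partial>count_space UNIV)"
          by (rule nn_integral_count_space_indicator) simp
        also have "\<dots> = (\<integral>\<^sup>+x. (emeasure M {x} * indicator A x) * indicator K x \<partial>count_space UNIV)"
          by (intro nn_integral_cong) (auto simp: indicator_def)
        also have "\<dots> = (\<integral>\<^sup>+x. emeasure M {x} * indicator A x \<partial>count_space K)"
          by (rule nn_integral_count_space_indicator[symmetric]) simp
        finally show ?thesis .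
      qed
      also have "\<dots> = (\<integral>\<^sup>+x. ennreal (if x \<in> K then measure M {x} else 0) * indicator A x \<partial>count_space K)"
        by (intro nn_integral_cong) (simp add: M.emeasure_eq_measure)
      also have "\<dots> = (\<integral>\<^sup>+x. ennreal (if x \<in> K then measure M {x} else 0) * indicator A x \<partial>R)"
        unfolding R_def using meas A M(2) OQ by (subst nn_integral_distr) (auto simp: sR R_def)
      also have "\<dots> = emeasure (density R (\<lambda>x. ennreal (if x \<in> K then measure M {x} else 0))) A"
        using meas A M(2) by (subst emeasure_density) (auto simp: sR)
      finally show "emeasure M A = \<dots>" .
    qed (use M(2) sR in auto)
  qed
  define p where "p x = (if x \<in> K then measure P {x} else 0)" for x
  define q where "q x = (if x \<in> K then measure Q {x} else 0)" for x
  have p: "p \<in> borel_measurable R" "P = density R (\<lambda>x. ennreal (p x))" "\<And>x. 0 \<le> p x"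
    using dens[OF P sets PK] by (auto simp: p_def[abs_def])
  have q: "q \<in> borel_measurable R" "Q = density R (\<lambda>x. ennreal (q x))" "\<And>x. 0 \<le> q x"
    using dens[OF Q refl QK] by (auto simp: q_def[abs_def])
  have "f_divergence f P Q = enn2ereal (\<integral>\<^sup>+ x. persp (normalized f) (p x) (q x) \<partial>R)"
    by (rule f_divergence_eq_persp[OF f P Q R p(1) q(1) p(3) q(3) p(2) q(2)])
  also have "(\<integral>\<^sup>+ x. persp (normalized f) (p x) (q x) \<partial>R)
      = (\<integral>\<^sup>+ x. persp (normalized f) (p x) (q x) \<partial>count_space K)"
  proof -
    have "(\<lambda>x. persp (normalized f) (p x) (q x)) \<in> borel_measurable R"
      by (intro borel_measurable_persp normalized_props f p q)
    then show ?thesis unfolding R_def using OQ by (subst nn_integral_distr) (auto simp: sR R_def)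
  qed
  also have "\<dots> = (\<integral>\<^sup>+ x. persp (normalized f) (measure P {x}) (measure Q {x}) \<partial>count_space K)"
    by (intro nn_integral_cong) (simp add: p_def q_def)
  finally show ?thesis .
qed

lemma f_divergence_distr_le:
  assumes f: "convex_on {0<..} f" "f 1 = 0"
    and P: "prob_space P" and Q: "prob_space Q" and sets: "sets P = sets Q"
    and \<phi>: "\<phi> \<in> measurable Q N"
    and K: "countable (\<phi> ` space Q)" "\<And>x. x \<in> space Q \<Longrightarrow> {\<phi> x} \<in> sets N"
  shows "f_divergence f (distr P N \<phi>) (distr Q N \<phi>) \<le> f_divergence f P Q"
proof -
  interpret P: prob_space P by fact
  interpret Q: prob_space Q by fact
  have sp: "space P = space Q" by (rule sets_eq_imp_space_eq[OF sets])
  have \<phi>P: "\<phi> \<in> measurable P N" using \<phi> measurable_cong_sets[OF sets refl, of N] by simp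
  define k where "k y x = (indicator (\<phi> -` {y} \<inter> space Q) x :: real)" for y x
  have KN: "\<phi> ` space Q \<in> sets N" by (rule sets.countable) (use K in auto)
  have null: "emeasure (distr M N \<phi>) (space (distr M N \<phi>) - \<phi> ` space Q) = 0"
    if "\<phi> \<in> measurable M N" "space M = space Q" for M
  proof -
    have "emeasure (distr M N \<phi>) (space N - \<phi> ` space Q) = emeasure M (\<phi> -` (space N - \<phi> ` space Q) \<inter> space M)"
      using that KN by (intro emeasure_distr) auto
    also have "\<phi> -` (space N - \<phi> ` space Q) \<inter> space M = {}" using that by auto
    finally show ?thesis by simp
  qed
  have meas: "measure (distr M N \<phi>) {y} = (\<integral>x. k y x \<partial>M)"
    if M: "\<phi> \<in> measurable M N" "space M = space Q" and y: "y \<in> \<phi> ` space Q" for M y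
  proof -
    have "{y} \<in> sets N" using K(2) y by auto
    then have "measure (distr M N \<phi>) {y} = measure M (\<phi> -` {y} \<inter> space M)"
      using M(1) by (intro measure_distr) auto
    then show ?thesis unfolding k_def by (simp add: M(2) Int_absorb1)
  qed
  have "f_divergence f (distr P N \<phi>) (distr Q N \<phi>) = enn2ereal
     (\<integral>\<^sup>+ y. persp (normalized f) (measure (distr P N \<phi>) {y}) (measure (distr Q N \<phi>) {y}) \<partial>count_space (\<phi> ` space Q))"
    using K by (intro f_divergence_countable_support f P.prob_space_distr Q.prob_space_distr \<phi> \<phi>P null) (auto simp: sp)
  also have "(\<integral>\<^sup>+ y. persp (normalized f) (measure (distr P N \<phi>) {y}) (measure (distr Q N \<phi>) {y}) \<partial>count_space (\<phi> ` space Q))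
    = (\<integral>\<^sup>+ y. persp (normalized f) (\<integral>x. k y x \<partial>P) (\<integral>x. k y x \<partial>Q) \<partial>count_space (\<phi> ` space Q))"
    using meas[OF \<phi>P sp] meas[OF \<phi> refl] by (intro nn_integral_cong) simp
  also have "enn2ereal \<dots> \<le> f_divergence f P Q"
  proof (rule f_divergence_kernel_le[OF f P Q sets K(1)])
    show "k y \<in> borel_measurable Q" if "y \<in> \<phi> ` space Q" for y
    proof -
      have "\<phi> -` {y} \<inter> space Q \<in> sets Q" using \<phi> K(2) that by (auto intro: measurable_sets)
      then show ?thesis unfolding k_def by measurable
    qed
    show "0 \<le> k y x" for y x by (simp add: k_def)
    show "(\<integral>\<^sup>+ y. ennreal (k y x) \<partial>count_space (\<phi> ` space Q)) \<le> 1" if x: "x \<in> space Q" for x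
    proof -
      have "(\<integral>\<^sup>+ y. ennreal (k y x) \<partial>count_space (\<phi> ` space Q))
          = (\<integral>\<^sup>+ y. indicator {\<phi> x} y \<partial>count_space (\<phi> ` space Q))"
        using x by (intro nn_integral_cong) (auto simp: k_def indicator_def)
      also have "\<dots> = 1" using x by (subst nn_integral_indicator) auto
      finally show ?thesis by simp
    qed
  qed
  finally show ?thesis .
qed

section \<open>Word metrics\<close>

text \<open>
  A group with a finite generating set. The length and the distance are those of the definition
  of hyperbolic groups.
\<close>

locale word_metric = group G for G (structure) +
  fixes S :: "'a set"
  assumes finite_S: "finite S" and S_carrier: "S \<subseteq> carrier G" and generate_S: "generate G S = carrier G"
begin

text \<open>
  The generators and their inverses.
\<close>

definition letters :: "'a set" where "letters = S \<union> m_inv G ` S"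

abbreviation word :: "'a list \<Rightarrow> 'a" where "word ws \<equiv> foldr (\<otimes>) ws \<one>"

abbreviation len :: "'a \<Rightarrow> nat" where "len \<equiv> word_length G S"

abbreviation dist :: "'a \<Rightarrow> 'a \<Rightarrow> real" where "dist \<equiv> word_dist G S"

lemma letters_carrier: "letters \<subseteq> carrier G"
  using S_carrier by (auto simp: letters_def)

lemma finite_letters: "finite letters"
  using finite_S by (simp add: letters_def)

lemma letters_inv: "a \<in> letters \<Longrightarrow> inv a \<in> letters"
  using S_carrier by (auto simp: letters_def)

lemma word_closed: "set ws \<subseteq> letters \<Longrightarrow> word ws \<in> carrier G"
  using letters_carrier by (induction ws) auto

lemma word_append:
  "set ws \<subseteq> letters \<Longrightarrow> set vs \<subseteq> letters \<Longrightarrow> word (ws @ vs) = word ws \<otimes> word vs"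
  using letters_carrier by (induction ws) (auto simp: m_assoc word_closed subset_iff)

lemma ex_word:
  assumes "g \<in> carrier G" shows "\<exists>ws. set ws \<subseteq> letters \<and> word ws = g"
proof -
  have "g \<in> generate G S" using assms generate_S by simp
  then show ?thesis
  proof induction
    case one then show ?case by (intro exI[of _ "[]"]) simp
  next
    case (incl h) then show ?case using S_carrier by (intro exI[of _ "[h]"]) (auto simp: letters_def)
  next
    case (inv h) then show ?case using S_carrier by (intro exI[of _ "[inv h]"]) (auto simp: letters_def)
  next
    case (eng h1 h2)
    then obtain v w where "set v \<subseteq> letters" "word v = h1" "set w \<subseteq> letters" "word w = h2" by blast
    then show ?case by (intro exI[of _ "v @ w"]) (auto simp: word_append simp del: foldr_append)
  qed
qed

lemma len_le: "set ws \<subseteq> letters \<Longrightarrow> len (word ws) \<le> length ws"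
  unfolding word_length_def letters_def by (rule Least_le) auto

lemma shortest_word:
  assumes "g \<in> carrier G"
  obtains ws where "set ws \<subseteq> letters" "word ws = g" "length ws = len g"
proof -
  have "\<exists>n ws. length ws = n \<and> set ws \<subseteq> letters \<and> word ws = g" using ex_word[OF assms] by blast
  then have "\<exists>ws. length ws = len g \<and> set ws \<subseteq> letters \<and> word ws = g"
    unfolding word_length_def letters_def by (rule LeastI_ex)
  then show ?thesis using that by blast
qed

lemma len_one [simp]: "len \<one> = 0"
  using len_le[of "[]"] by simp

lemma inv_mult_cancel: "g \<in> carrier G \<Longrightarrow> y \<in> carrier G \<Longrightarrow> inv g \<otimes> (g \<otimes> y) = y"
  and mult_inv_cancel: "g \<in> carrier G \<Longrightarrow> y \<in> carrier G \<Longrightarrow> g \<otimes> (inv g \<otimes> y) = y"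
  by (simp_all add: m_assoc[symmetric])

lemma len_eq_0: "g \<in> carrier G \<Longrightarrow> len g = 0 \<Longrightarrow> g = \<one>"
  by (auto elim!: shortest_word)

lemma len_mult: "g \<in> carrier G \<Longrightarrow> h \<in> carrier G \<Longrightarrow> len (g \<otimes> h) \<le> len g + len h"
proof -
  assume "g \<in> carrier G" "h \<in> carrier G"
  then obtain v w where "set v \<subseteq> letters" "word v = g" "length v = len g"
      "set w \<subseteq> letters" "word w = h" "length w = len h" by (metis shortest_word)
  then show ?thesis using len_le[of "v @ w"] by (simp add: word_append del: foldr_append)
qed

lemma inv_word: "set ws \<subseteq> letters \<Longrightarrow> inv (word ws) = word (rev (map (m_inv G) ws))"
proof (induction ws)
  case (Cons a ws)
  then have *: "a \<in> letters" "set ws \<subseteq> letters" "a \<in> carrier G" using letters_carrier by auto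
  have "set (rev (map (m_inv G) ws)) \<subseteq> letters" "set [inv a] \<subseteq> letters"
    using * letters_inv by auto
  from word_append[OF this] show ?case
    using Cons.IH * by (simp add: inv_mult_group word_closed)
qed simp

lemma len_inv_le: "g \<in> carrier G \<Longrightarrow> len (inv g) \<le> len g"
proof -
  assume "g \<in> carrier G"
  then obtain v where v: "set v \<subseteq> letters" "word v = g" "length v = len g" by (metis shortest_word)
  then have "set (rev (map (m_inv G) v)) \<subseteq> letters" using letters_inv by auto
  from len_le[OF this] show ?thesis using v inv_word[of v] by simp
qed

lemma len_inv [simp]: "g \<in> carrier G \<Longrightarrow> len (inv g) = len g"
  using len_inv_le[of g] len_inv_le[of "inv g"] by simp

lemma len_split:
  assumes "g \<in> carrier G" "n \<le> len g"
  obtains a b where "a \<in> carrier G" "b \<in> carrier G" "g = a \<otimes> b" "len a = n" "len b = len g - n"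
proof -
  obtain v where v: "set v \<subseteq> letters" "word v = g" "length v = len g" using assms by (metis shortest_word)
  define x y where "x = take n v" and "y = drop n v"
  have xy: "set x \<subseteq> letters" "set y \<subseteq> letters"
    using v(1) unfolding x_def y_def by (meson order_trans set_take_subset set_drop_subset)+
  have eq: "g = word x \<otimes> word y" using word_append[OF xy] v(2) by (simp add: x_def y_def)
  have "len (word x) \<le> n" "len (word y) \<le> len g - n"
    using len_le[OF xy(1)] len_le[OF xy(2)] v(3) assms(2) by (auto simp: x_def y_def)
  moreover have "len g \<le> len (word x) + len (word y)"
    unfolding eq by (intro len_mult word_closed xy)
  ultimately have "len (word x) = n" "len (word y) = len g - n" using assms(2) by auto
  then show ?thesis using that[of "word x" "word y"] eq xy word_closed by auto
qed

lemma sphere_subset: "{g \<in> carrier G. len g = n} \<subseteq> word ` {ws. set ws \<subseteq> letters \<and> length ws = n}"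
  by (auto elim!: shortest_word)

lemma finite_sphere: "finite {g \<in> carrier G. len g = n}"
  by (rule finite_subset[OF sphere_subset]) (intro finite_imageI finite_lists_length_eq finite_letters)

lemma card_sphere: "card {g \<in> carrier G. len g = n} \<le> card letters ^ n"
proof -
  have "card {g \<in> carrier G. len g = n} \<le> card (word ` {ws. set ws \<subseteq> letters \<and> length ws = n})"
    by (intro card_mono sphere_subset finite_imageI finite_lists_length_eq finite_letters)
  also have "\<dots> \<le> card {ws. set ws \<subseteq> letters \<and> length ws = n}"
    by (intro card_image_le finite_lists_length_eq finite_letters)
  finally show ?thesis by (simp add: card_lists_length_eq finite_letters)
qed

lemma finite_ball_one: "finite {g \<in> carrier G. len g \<le> n}"
proof -
  have "{g \<in> carrier G. len g \<le> n} = (\<Union>k\<le>n. {g \<in> carrier G. len g = k})" by auto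
  then show ?thesis using finite_sphere by simp
qed

lemma countable_carrier: "countable (carrier G)"
proof -
  have "carrier G = (\<Union>n. {g \<in> carrier G. len g = n})" by auto
  also have "countable \<dots>" by (intro countable_UN countableI_type countable_finite finite_sphere)
  finally show ?thesis .
qed

lemma dist_mult_left:
  "g \<in> carrier G \<Longrightarrow> x \<in> carrier G \<Longrightarrow> y \<in> carrier G \<Longrightarrow> dist (g \<otimes> x) (g \<otimes> y) = dist x y"
  by (simp add: word_dist_def inv_mult_group m_assoc inv_mult_cancel)

lemma dist_one: "x \<in> carrier G \<Longrightarrow> dist \<one> x = len x"
  by (simp add: word_dist_def)

lemma dist_self: "x \<in> carrier G \<Longrightarrow> dist x x = 0"
  by (simp add: word_dist_def)

lemma dist_commute: "x \<in> carrier G \<Longrightarrow> y \<in> carrier G \<Longrightarrow> dist x y = dist y x"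
  using len_inv[of "inv x \<otimes> y"] by (simp add: word_dist_def inv_mult_group)

lemma dist_triangle:
  assumes "x \<in> carrier G" "y \<in> carrier G" "z \<in> carrier G"
  shows "dist x z \<le> dist x y + dist y z"
proof -
  have "inv x \<otimes> z = (inv x \<otimes> y) \<otimes> (inv y \<otimes> z)"
    using assms by (simp add: m_assoc mult_inv_cancel)
  then show ?thesis using len_mult[of "inv x \<otimes> y" "inv y \<otimes> z"] assms
    by (simp add: word_dist_def flip: of_nat_add)
qed

lemma dist_geodesic:
  assumes "x \<in> carrier G" "y \<in> carrier G" "real n \<le> dist x y"
  obtains z where "z \<in> carrier G" "dist x z = n" "dist z y = dist x y - n"
proof -
  have "inv x \<otimes> y \<in> carrier G" "n \<le> len (inv x \<otimes> y)" using assms by (auto simp: word_dist_def)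
  then obtain a b where ab: "a \<in> carrier G" "b \<in> carrier G" "inv x \<otimes> y = a \<otimes> b" "len a = n"
      "len b = len (inv x \<otimes> y) - n"
    by (rule len_split)
  have y: "y = x \<otimes> (a \<otimes> b)" using assms ab(3)[symmetric] by (simp add: mult_inv_cancel)
  have "inv x \<otimes> (x \<otimes> a) = a" "inv (x \<otimes> a) \<otimes> y = b"
    unfolding y using assms(1) ab(1,2)
    by (simp_all add: inv_mult_group m_assoc inv_mult_cancel)
  then have "dist x (x \<otimes> a) = n" "dist (x \<otimes> a) y = dist x y - n"
    using ab(4,5) \<open>n \<le> len _\<close> by (simp_all add: word_dist_def)
  then show ?thesis using that[of "x \<otimes> a"] assms ab by simp
qed

lemma finite_ball:
  assumes x: "x \<in> carrier G" shows "finite {y \<in> carrier G. dist x y \<le> r}"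
proof -
  have "{y \<in> carrier G. dist x y \<le> r} \<subseteq> (\<lambda>g. x \<otimes> g) ` {g \<in> carrier G. len g \<le> nat \<lfloor>r\<rfloor>}"
  proof safe
    fix y assume y: "y \<in> carrier G" "dist x y \<le> r"
    then have "y = x \<otimes> (inv x \<otimes> y)" using x by (simp add: mult_inv_cancel)
    moreover have "len (inv x \<otimes> y) \<le> nat \<lfloor>r\<rfloor>" using y(2) by (simp add: word_dist_def le_nat_floor)
    ultimately show "y \<in> (\<lambda>g. x \<otimes> g) ` {g \<in> carrier G. len g \<le> nat \<lfloor>r\<rfloor>}"
      using x y by (intro image_eqI[of _ _ "inv x \<otimes> y"]) auto
  qed
  then show ?thesis by (rule finite_subset) (intro finite_imageI finite_ball_one)
qed

lemma card_ball_le: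
  assumes x: "x \<in> carrier G"
  shows "card {y \<in> carrier G. dist x y \<le> r} \<le> card {g \<in> carrier G. len g \<le> nat \<lfloor>r\<rfloor>}"
proof -
  have "(\<lambda>y. inv x \<otimes> y) ` {y \<in> carrier G. dist x y \<le> r} \<subseteq> {g \<in> carrier G. len g \<le> nat \<lfloor>r\<rfloor>}"
    using x by (auto simp: word_dist_def le_nat_floor)
  moreover have "inj_on (\<lambda>y. inv x \<otimes> y) {y \<in> carrier G. dist x y \<le> r}"
    using x by (intro inj_onI) auto
  ultimately show ?thesis using card_inj_on_le finite_ball_one by blast
qed

end

section \<open>The boundary as a Borel space with an action\<close>

lemma product_diverges_iff:
  "product_diverges d w u v \<longleftrightarrow> (\<forall>K. \<exists>N. \<forall>i\<ge>N. \<forall>j\<ge>N. K \<le> gromov_product d w (u i) (v j))"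
  unfolding product_diverges_def filterlim_at_top eventually_prod_sequentially prod.case
  by (rule iff_allI, rule iff_exI, blast)

lemma less_boundary_productD:
  assumes "ereal r < boundary_product d w \<xi> \<eta>"
  obtains u v N where "u \<in> \<xi>" "v \<in> \<eta>" "\<And>i j. i \<ge> N \<Longrightarrow> j \<ge> N \<Longrightarrow> r < gromov_product d w (u i) (v j)"
proof -
  from assms obtain u v where uv: "u \<in> \<xi>" "v \<in> \<eta>"
    and "ereal r < Liminf (sequentially \<times>\<^sub>F sequentially) (\<lambda>(i, j). ereal (gromov_product d w (u i) (v j)))"
    unfolding boundary_product_def less_SUP_iff by auto
  then have "\<forall>\<^sub>F x in sequentially \<times>\<^sub>F sequentially. ereal r < (case x of (i, j) \<Rightarrow> ereal (gromov_product d w (u i) (v j)))"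
    by (intro less_LiminfD)
  then obtain N where "\<forall>m\<ge>N. \<forall>n\<ge>N. r < gromov_product d w (u n) (v m)"
    unfolding eventually_prod_sequentially by auto
  then show ?thesis using that uv by blast
qed

text \<open>
  A lower bound along one pair of representing sequences suffices, since the boundary product is a supremum.
\<close>

lemma boundary_product_geI:
  assumes "u \<in> \<xi>" "v \<in> \<eta>" "\<And>i j. i \<ge> N \<Longrightarrow> j \<ge> N \<Longrightarrow> r \<le> gromov_product d w (u i) (v j)"
  shows "ereal r \<le> boundary_product d w \<xi> \<eta>"
proof -
  have "ereal r \<le> Liminf (sequentially \<times>\<^sub>F sequentially) (\<lambda>(i, j). ereal (gromov_product d w (u i) (v j)))"
    using assms(3) by (intro Liminf_bounded) (auto simp: eventually_prod_sequentially intro!: exI[of _ N])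
  then show ?thesis
    unfolding boundary_product_def using assms(1,2) by (blast intro: SUP_upper2)
qed

text \<open>
  The four-point condition of Gromov for the word metric, with an explicit constant.
\<close>

locale hyperbolic_word_metric = word_metric +
  fixes \<delta> :: real
  assumes four_point: "\<And>w x y z. \<lbrakk>w \<in> carrier G; x \<in> carrier G; y \<in> carrier G; z \<in> carrier G\<rbrakk> \<Longrightarrow>
    min (gromov_product dist w x y) (gromov_product dist w y z) - \<delta> \<le> gromov_product dist w x z"
begin

abbreviation gp :: "'a \<Rightarrow> 'a \<Rightarrow> real" where "gp \<equiv> gromov_product dist \<one>"

abbreviation conv :: "(nat \<Rightarrow> 'a) set" where "conv \<equiv> converging_to_infinity (carrier G) dist \<one>"

abbreviation bdry :: "(nat \<Rightarrow> 'a) set set" where "bdry \<equiv> gromov_boundary (carrier G) dist \<one>"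

abbreviation act :: "'a \<Rightarrow> (nat \<Rightarrow> 'a) set \<Rightarrow> (nat \<Rightarrow> 'a) set" where "act \<equiv> boundary_action G"

lemma delta_nonneg: "0 \<le> \<delta>"
  using four_point[of \<one> \<one> \<one> \<one>] by (simp add: gromov_product_def dist_self)

lemma gp_commute: "x \<in> carrier G \<Longrightarrow> y \<in> carrier G \<Longrightarrow> gp x y = gp y x"
  by (simp add: gromov_product_def dist_commute)

lemma gp_self: "x \<in> carrier G \<Longrightarrow> gp x x = len x"
  by (simp add: gromov_product_def dist_one dist_self)

lemma gp_hyp3:
  assumes "x \<in> carrier G" "y \<in> carrier G" "z \<in> carrier G" "K \<le> gp x y" "K \<le> gp y z"
  shows "K - \<delta> \<le> gp x z"
  using four_point[of \<one> x y z] assms by simp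

text \<open>
  Translation by \<open>g\<close> changes the Gromov product by at most the length of \<open>g\<close>. Hence the action preserves
  convergence to infinity and is continuous on the boundary.
\<close>

lemma gp_mult:
  assumes "g \<in> carrier G" "x \<in> carrier G" "y \<in> carrier G"
  shows "gp x y - len g \<le> gp (g \<otimes> x) (g \<otimes> y)"
proof -
  have "dist \<one> x \<le> len g + dist \<one> (g \<otimes> x)" if "x \<in> carrier G" for x
    using dist_triangle[of \<one> "inv g" x] dist_mult_left[of g "inv g" x] assms(1) that
    by (simp add: dist_one)
  from this[OF assms(2)] this[OF assms(3)] show ?thesis
    using dist_mult_left[OF assms] by (simp add: gromov_product_def field_simps)
qed

lemma convD: "u \<in> conv \<Longrightarrow> u n \<in> carrier G"
  by (auto simp: converging_to_infinity_def)

lemma product_diverges_trans: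
  assumes "u \<in> conv" "v \<in> conv" "w \<in> conv"
    and uv: "product_diverges dist \<one> u v" and vw: "product_diverges dist \<one> v w"
  shows "product_diverges dist \<one> u w"
  unfolding product_diverges_iff
proof
  fix K :: real
  obtain N where N: "\<forall>i\<ge>N. \<forall>j\<ge>N. K + \<delta> \<le> gp (u i) (v j)"
    using uv unfolding product_diverges_iff by blast
  obtain M where M: "\<forall>i\<ge>M. \<forall>j\<ge>M. K + \<delta> \<le> gp (v i) (w j)"
    using vw unfolding product_diverges_iff by blast
  have "K \<le> gp (u i) (w j)" if "i \<ge> max N M" "j \<ge> max N M" for i j
  proof -
    have "K + \<delta> - \<delta> \<le> gp (u i) (w j)"
      using that assms N M by (intro gp_hyp3[of _ "v (max N M)"] convD) auto
    then show ?thesis by simp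
  qed
  then show "\<exists>N. \<forall>i\<ge>N. \<forall>j\<ge>N. K \<le> gp (u i) (w j)" by blast
qed

lemma equiv_conv:
  "equiv conv {(u, v). u \<in> conv \<and> v \<in> conv \<and> product_diverges dist \<one> u v}"
proof (rule equivI)
  show "refl_on conv {(u, v). u \<in> conv \<and> v \<in> conv \<and> product_diverges dist \<one> u v}"
    by (auto simp: refl_on_def converging_to_infinity_def)
  show "sym {(u, v). u \<in> conv \<and> v \<in> conv \<and> product_diverges dist \<one> u v}"
    unfolding sym_def product_diverges_iff by (auto simp: gp_commute convD) blast
  show "trans {(u, v). u \<in> conv \<and> v \<in> conv \<and> product_diverges dist \<one> u v}"
    unfolding trans_def using product_diverges_trans by blast
qed auto

lemma bdry_subset: "\<xi> \<in> bdry \<Longrightarrow> u \<in> \<xi> \<Longrightarrow> u \<in> conv"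
  unfolding gromov_boundary_def using in_quotient_imp_subset[OF equiv_conv] by blast

lemma bdry_carrier: "\<xi> \<in> bdry \<Longrightarrow> u \<in> \<xi> \<Longrightarrow> u n \<in> carrier G"
  using bdry_subset convD by blast

lemma bdry_diverges: "\<xi> \<in> bdry \<Longrightarrow> u \<in> \<xi> \<Longrightarrow> v \<in> \<xi> \<Longrightarrow> product_diverges dist \<one> u v"
  unfolding gromov_boundary_def using in_quotient_imp_in_rel[OF equiv_conv, of \<xi> u v] by blast

lemma bdry_closed:
  assumes "\<xi> \<in> bdry" "u \<in> \<xi>" "v \<in> conv" "product_diverges dist \<one> u v" shows "v \<in> \<xi>"
  using in_quotient_imp_closed[OF equiv_conv, of \<xi> u v] assms bdry_subset[of \<xi> u]
  unfolding gromov_boundary_def by blast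

lemma bdry_ex: "\<xi> \<in> bdry \<Longrightarrow> \<exists>u. u \<in> \<xi>"
  unfolding gromov_boundary_def using in_quotient_imp_non_empty[OF equiv_conv] by blast

lemma bdry_eqI: "\<xi> \<in> bdry \<Longrightarrow> \<eta> \<in> bdry \<Longrightarrow> u \<in> \<xi> \<Longrightarrow> u \<in> \<eta> \<Longrightarrow> \<xi> = \<eta>"
  unfolding gromov_boundary_def using quotient_disj[OF equiv_conv, of \<xi> \<eta>] by blast

lemma bdryI:
  assumes "u \<in> conv" and "\<And>v. v \<in> \<xi> \<longleftrightarrow> v \<in> conv \<and> product_diverges dist \<one> u v"
  shows "\<xi> \<in> bdry"
proof -
  have "\<xi> = {(u, v). u \<in> conv \<and> v \<in> conv \<and> product_diverges dist \<one> u v} `` {u}"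
    using assms by auto
  then show ?thesis unfolding gromov_boundary_def using assms(1) by (simp only: quotientI)
qed

lemma product_diverges_mult:
  assumes u: "u \<in> conv" and v: "v \<in> conv" and g: "g \<in> carrier G" and uv: "product_diverges dist \<one> u v"
  shows "product_diverges dist \<one> (\<lambda>n. g \<otimes> u n) (\<lambda>n. g \<otimes> v n)"
  unfolding product_diverges_iff
proof
  fix K :: real
  obtain N where N: "\<forall>i\<ge>N. \<forall>j\<ge>N. K + len g \<le> gp (u i) (v j)"
    using uv unfolding product_diverges_iff by blast
  have "K \<le> gp (g \<otimes> u i) (g \<otimes> v j)" if "i \<ge> N" "j \<ge> N" for i j
    using N that gp_mult[of g "u i" "v j"] g convD[OF u] convD[OF v] by fastforce
  then show "\<exists>N. \<forall>i\<ge>N. \<forall>j\<ge>N. K \<le> gp (g \<otimes> u i) (g \<otimes> v j)" by blast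
qed

lemma conv_mult: "u \<in> conv \<Longrightarrow> g \<in> carrier G \<Longrightarrow> (\<lambda>n. g \<otimes> u n) \<in> conv"
  using product_diverges_mult[of u u g] by (auto simp: converging_to_infinity_def)

lemma seq_inv_mult: "u \<in> conv \<Longrightarrow> g \<in> carrier G \<Longrightarrow> (\<lambda>n. g \<otimes> (inv g \<otimes> u n)) = u"
  "u \<in> conv \<Longrightarrow> g \<in> carrier G \<Longrightarrow> (\<lambda>n. inv g \<otimes> (g \<otimes> u n)) = u"
  by (auto simp: fun_eq_iff mult_inv_cancel inv_mult_cancel convD)

lemma act_bdry:
  assumes \<xi>: "\<xi> \<in> bdry" and g: "g \<in> carrier G" shows "act g \<xi> \<in> bdry"
proof -
  obtain u where u: "u \<in> \<xi>" using bdry_ex[OF \<xi>] by blast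
  note uc = bdry_subset[OF \<xi> u]
  show ?thesis
  proof (rule bdryI[OF conv_mult[OF uc g]])
    fix v
    show "v \<in> act g \<xi> \<longleftrightarrow> v \<in> conv \<and> product_diverges dist \<one> (\<lambda>n. g \<otimes> u n) v"
    proof
      assume "v \<in> act g \<xi>"
      then obtain w where w: "w \<in> \<xi>" "v = (\<lambda>n. g \<otimes> w n)" by (auto simp: boundary_action_def)
      then show "v \<in> conv \<and> product_diverges dist \<one> (\<lambda>n. g \<otimes> u n) v"
        using conv_mult[OF bdry_subset[OF \<xi> w(1)] g]
          product_diverges_mult[OF uc bdry_subset[OF \<xi> w(1)] g bdry_diverges[OF \<xi> u w(1)]] by simp
    next
      assume v: "v \<in> conv \<and> product_diverges dist \<one> (\<lambda>n. g \<otimes> u n) v"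
      have "product_diverges dist \<one> (\<lambda>n. inv g \<otimes> (g \<otimes> u n)) (\<lambda>n. inv g \<otimes> v n)"
        using v g by (intro product_diverges_mult conv_mult uc) auto
      then have "(\<lambda>n. inv g \<otimes> v n) \<in> \<xi>"
        using v g by (intro bdry_closed[OF \<xi> u] conv_mult) (auto simp: seq_inv_mult[OF uc])
      then show "v \<in> act g \<xi>"
        unfolding boundary_action_def using v g seq_inv_mult(1)[of v g] by (intro image_eqI) auto
    qed
  qed
qed

lemma act_act:
  "\<xi> \<in> bdry \<Longrightarrow> g \<in> carrier G \<Longrightarrow> h \<in> carrier G \<Longrightarrow> act g (act h \<xi>) = act (g \<otimes> h) \<xi>"
  unfolding boundary_action_def image_image
  by (intro image_cong) (auto simp: m_assoc bdry_carrier fun_eq_iff)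

lemma act_one: "\<xi> \<in> bdry \<Longrightarrow> act \<one> \<xi> = \<xi>"
  unfolding boundary_action_def
  by (subst image_cong[of \<xi> \<xi> _ "\<lambda>u. u"]) (auto simp: bdry_carrier fun_eq_iff)

text \<open>
  The boundary points that are limits of sequences in \<open>A\<close>.
\<close>

definition Lim_set :: "'a set \<Rightarrow> (nat \<Rightarrow> 'a) set set" where
  "Lim_set A = {\<xi> \<in> bdry. \<exists>u\<in>\<xi>. range u \<subseteq> A}"

lemma Lim_set_act:
  assumes "\<xi> \<in> bdry" "g \<in> carrier G" "\<xi> \<in> Lim_set A"
  shows "act g \<xi> \<in> Lim_set ((\<otimes>) g ` A)"
proof -
  obtain u where u: "u \<in> \<xi>" "range u \<subseteq> A" using assms(3) by (auto simp: Lim_set_def)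
  then have "(\<lambda>n. g \<otimes> u n) \<in> act g \<xi>" "range (\<lambda>n. g \<otimes> u n) \<subseteq> (\<otimes>) g ` A"
    by (auto simp: boundary_action_def)
  then show ?thesis using act_bdry[OF assms(1,2)] unfolding Lim_set_def by blast
qed

text \<open>
  Limit sets are closed. If \<open>\<xi>\<close> is approached by limit points of \<open>A\<close>, then a diagonal choice of elements of
  the sequences in \<open>A\<close> that represent these points is a sequence in \<open>A\<close> converging to \<open>\<xi>\<close>.
\<close>

lemma boundary_open_compl_Lim_set:
  assumes A: "A \<subseteq> carrier G"
  shows "boundary_open (carrier G) dist \<one> (bdry - Lim_set A)"
  unfolding boundary_open_def
proof (intro conjI ballI)
  fix \<xi> assume \<xi>: "\<xi> \<in> bdry - Lim_set A"
  show "\<exists>r::real. \<forall>\<eta>\<in>bdry. ereal r < boundary_product dist \<one> \<xi> \<eta> \<longrightarrow> \<eta> \<in> bdry - Lim_set A"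
  proof (rule ccontr)
    assume "\<not> ?thesis"
    then have ex: "\<exists>\<eta>\<in>Lim_set A. ereal r < boundary_product dist \<one> \<xi> \<eta>" for r :: real
      by blast
    obtain u where u: "u \<in> \<xi>" using bdry_ex \<xi> by blast
    have uc: "u \<in> conv" using bdry_subset u \<xi> by blast
    have "\<exists>a\<in>A. \<exists>N. \<forall>i\<ge>N. real n - 2 * \<delta> \<le> gp (u i) a" for n :: nat
    proof -
      obtain \<eta> where \<eta>: "\<eta> \<in> Lim_set A" "ereal (real n) < boundary_product dist \<one> \<xi> \<eta>"
        using ex by blast
      obtain u' v N where uv: "u' \<in> \<xi>" "v \<in> \<eta>"
        "\<And>i j. i \<ge> N \<Longrightarrow> j \<ge> N \<Longrightarrow> real n < gp (u' i) (v j)"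
        by (rule less_boundary_productD[OF \<eta>(2)]) blast
      obtain w where w: "w \<in> \<eta>" "range w \<subseteq> A" and \<eta>b: "\<eta> \<in> bdry" using \<eta> by (auto simp: Lim_set_def)
      obtain N1 where N1: "\<forall>i\<ge>N1. \<forall>j\<ge>N1. real n \<le> gp (u i) (u' j)"
        using bdry_diverges[of \<xi> u u'] \<xi> u uv(1) unfolding product_diverges_iff by blast
      obtain N2 where N2: "\<forall>i\<ge>N2. \<forall>j\<ge>N2. real n \<le> gp (v i) (w j)"
        using bdry_diverges[of \<eta> v w] \<eta>b w uv(2) unfolding product_diverges_iff by blast
      define M where "M = max N (max N1 N2)"
      have "real n - 2 * \<delta> \<le> gp (u i) (w M)" if "i \<ge> M" for i
      proof -
        have 1: "real n \<le> gp (u i) (u' M)" using that N1 by (simp add: M_def)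
        have 2: "real n \<le> gp (u' M) (v M)" using uv(3)[of M M] by (simp add: M_def)
        have 3: "real n \<le> gp (v M) (w M)" using N2 by (simp add: M_def)
        have c: "u i \<in> carrier G" "u' M \<in> carrier G" "v M \<in> carrier G" "w M \<in> carrier G"
          using bdry_carrier \<xi> u uv(1,2) \<eta>b w(1) by blast+
        have "real n - \<delta> \<le> gp (u i) (v M)"
          by (rule gp_hyp3[OF c(1,2,3) 1 2])
        then have "real n - \<delta> - \<delta> \<le> gp (u i) (w M)"
          using 3 delta_nonneg by (intro gp_hyp3[OF c(1,3,4)]) auto
        then show ?thesis by simp
      qed
      then show ?thesis using w by blast
    qed
    then obtain a N where a: "\<And>n. a n \<in> A" and N: "\<And>n i. i \<ge> N n \<Longrightarrow> real n - 2 * \<delta> \<le> gp (u i) (a n)"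
      by metis
    have ac: "a n \<in> carrier G" for n using a A by blast
    have ua: "product_diverges dist \<one> u a"
      unfolding product_diverges_iff
    proof
      fix K :: real
      obtain M where M: "\<forall>i\<ge>M. \<forall>j\<ge>M. K + \<delta> \<le> gp (u i) (u j)"
        using uc unfolding converging_to_infinity_def product_diverges_iff by blast
      define L where "L = max M (nat \<lceil>K + 3 * \<delta>\<rceil>)"
      have "K \<le> gp (u i) (a n)" if "i \<ge> L" "n \<ge> L" for i n
      proof -
        define j where "j = max M (N n)"
        have "K + 3 * \<delta> \<le> real n" using that by (simp add: L_def)
        then have "K + \<delta> - \<delta> \<le> gp (u i) (a n)"
          using M that N[of n j] convD[OF uc] ac by (intro gp_hyp3[of _ "u j"]) (auto simp: j_def L_def)
        then show ?thesis by simp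
      qed
      then show "\<exists>N. \<forall>i\<ge>N. \<forall>j\<ge>N. K \<le> gp (u i) (a j)" by blast
    qed
    have "product_diverges dist \<one> a a"
      unfolding product_diverges_iff
    proof
      fix K :: real
      obtain M where M: "\<forall>i\<ge>M. \<forall>j\<ge>M. K + \<delta> \<le> gp (u i) (a j)"
        using ua unfolding product_diverges_iff by blast
      have "K \<le> gp (a i) (a j)" if "i \<ge> M" "j \<ge> M" for i j
      proof -
        have "K + \<delta> - \<delta> \<le> gp (a i) (a j)"
          using M that convD[OF uc] ac by (intro gp_hyp3[of _ "u M"]) (auto simp: gp_commute)
        then show ?thesis by simp
      qed
      then show "\<exists>N. \<forall>i\<ge>N. \<forall>j\<ge>N. K \<le> gp (a i) (a j)" by blast
    qed
    then have "a \<in> conv" using ac by (auto simp: converging_to_infinity_def)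
    then have "a \<in> \<xi>" using bdry_closed[of \<xi> u a] \<xi> u ua by blast
    then have "\<xi> \<in> Lim_set A" using \<xi> a by (auto simp: Lim_set_def)
    then show False using \<xi> by blast
  qed
qed blast

text \<open>
  Together with closedness of limit sets this makes points of the boundary measurable.
\<close>

lemma Lim_set_range:
  assumes \<xi>: "\<xi> \<in> bdry" and u: "u \<in> \<xi>" shows "Lim_set (range u) = {\<xi>}"
proof
  show "{\<xi>} \<subseteq> Lim_set (range u)" using assms by (auto simp: Lim_set_def)
  show "Lim_set (range u) \<subseteq> {\<xi>}"
  proof
    fix \<eta> assume "\<eta> \<in> Lim_set (range u)"
    then obtain w where \<eta>: "\<eta> \<in> bdry" and w: "w \<in> \<eta>" "range w \<subseteq> range u" by (auto simp: Lim_set_def)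
    from w(2) have "\<forall>k. \<exists>i. w k = u i" by blast
    then obtain i where i: "\<And>k. w k = u (i k)" by metis
    have uc: "u \<in> conv" and wc: "w \<in> conv" using bdry_subset assms \<eta> w by blast+
    have "product_diverges dist \<one> u w"
      unfolding product_diverges_iff
    proof
      fix K :: real
      obtain M where M: "\<forall>i\<ge>M. \<forall>j\<ge>M. K \<le> gp (u i) (u j)"
        using uc unfolding converging_to_infinity_def product_diverges_iff by blast
      define B where "B = (\<Sum>m<M. real (len (u m))) + 1"
      have B: "real (len (u m)) < B" if "m < M" for m
        using member_le_sum[of m "{..<M}" "\<lambda>m. real (len (u m))"] that by (simp add: B_def)
      obtain M' where M': "\<forall>i\<ge>M'. \<forall>j\<ge>M'. B \<le> gp (w i) (w j)"
        using wc unfolding converging_to_infinity_def product_diverges_iff by blast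
      have "i k \<ge> M" if "k \<ge> M'" for k
      proof (rule ccontr)
        assume "\<not> M \<le> i k"
        then have "real (len (w k)) < B" using B i by simp
        moreover have "B \<le> gp (w k) (w k)" using M' that by blast
        ultimately show False using gp_self[of "w k"] convD[OF wc] by simp
      qed
      then have "\<forall>j\<ge>max M M'. \<forall>k\<ge>max M M'. K \<le> gp (u j) (w k)" using M i by simp
      then show "\<exists>N. \<forall>i\<ge>N. \<forall>j\<ge>N. K \<le> gp (u i) (w j)" by blast
    qed
    then have "w \<in> \<xi>" using bdry_closed[OF \<xi> u wc] by blast
    then show "\<eta> \<in> {\<xi>}" using bdry_eqI[OF \<eta> \<xi> w(1)] by blast
  qed
qed

abbreviation bdry_borel :: "(nat \<Rightarrow> 'a) set measure" where
  "bdry_borel \<equiv> borel_of_topology (group_boundary G S)"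

lemma space_bdry_borel: "space bdry_borel = bdry"
  unfolding borel_of_topology_def group_boundary_def
  by (subst space_measure_of)
    (auto simp: topspace_boundary_topology openin_boundary_topology boundary_open_def)

lemma open_in_bdry_borel: "boundary_open (carrier G) dist \<one> U \<Longrightarrow> U \<in> sets bdry_borel"
  unfolding borel_of_topology_def group_boundary_def
  by (subst sets_measure_of) (auto simp: openin_boundary_topology topspace_boundary_topology boundary_open_def)

lemma Lim_set_measurable:
  assumes A: "A \<subseteq> carrier G" shows "Lim_set A \<in> sets bdry_borel"
proof -
  have "space bdry_borel - (bdry - Lim_set A) \<in> sets bdry_borel"
    by (intro sets.compl_sets open_in_bdry_borel boundary_open_compl_Lim_set A)
  moreover have "bdry - (bdry - Lim_set A) = Lim_set A" by (auto simp: Lim_set_def)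
  ultimately show ?thesis by (simp add: space_bdry_borel)
qed

lemma singleton_measurable:
  assumes "\<xi> \<in> bdry" shows "{\<xi>} \<in> sets bdry_borel"
proof -
  obtain u where u: "u \<in> \<xi>" using bdry_ex assms by blast
  have "range u \<subseteq> carrier G" using bdry_carrier assms u by blast
  from Lim_set_measurable[OF this] show ?thesis by (simp add: Lim_set_range[OF assms u])
qed

lemma act_measurable:
  assumes g: "g \<in> carrier G" shows "act g \<in> measurable bdry_borel bdry_borel"
  unfolding borel_of_topology_def group_boundary_def
proof (rule measurable_measure_of, safe)
  fix U assume "openin (boundary_topology (carrier G) dist \<one>) U"
  then have U: "boundary_open (carrier G) dist \<one> U" by (simp add: openin_boundary_topology)
  have "boundary_open (carrier G) dist \<one> (act g -` U \<inter> bdry)"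
    unfolding boundary_open_def
  proof (intro conjI ballI)
    fix \<xi> assume \<xi>: "\<xi> \<in> act g -` U \<inter> bdry"
    then obtain r :: real where r: "\<forall>\<eta>\<in>bdry. ereal r < boundary_product dist \<one> (act g \<xi>) \<eta> \<longrightarrow> \<eta> \<in> U"
      using U unfolding boundary_open_def by blast
    show "\<exists>r::real. \<forall>\<eta>\<in>bdry. ereal r < boundary_product dist \<one> \<xi> \<eta> \<longrightarrow> \<eta> \<in> act g -` U \<inter> bdry"
    proof (intro exI ballI impI)
      fix \<eta> assume \<eta>: "\<eta> \<in> bdry" and less: "ereal (r + len g + 1) < boundary_product dist \<one> \<xi> \<eta>"
      obtain u v N where uv: "u \<in> \<xi>" "v \<in> \<eta>"
        "\<And>i j. i \<ge> N \<Longrightarrow> j \<ge> N \<Longrightarrow> r + len g + 1 < gp (u i) (v j)"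
        using less by (rule less_boundary_productD) blast
      have "ereal (r + 1) \<le> boundary_product dist \<one> (act g \<xi>) (act g \<eta>)"
      proof (rule boundary_product_geI)
        show "(\<lambda>n. g \<otimes> u n) \<in> act g \<xi>" "(\<lambda>n. g \<otimes> v n) \<in> act g \<eta>"
          using uv by (auto simp: boundary_action_def)
        fix i j assume ij: "i \<ge> N" "j \<ge> N"
        show "r + 1 \<le> gp (g \<otimes> u i) (g \<otimes> v j)"
          using uv(3)[OF ij] gp_mult[of g "u i" "v j"] bdry_carrier uv(1,2) \<xi> \<eta> g by fastforce
      qed
      then have "ereal r < boundary_product dist \<one> (act g \<xi>) (act g \<eta>)"
        by (rule less_le_trans[rotated]) simp
      then show "\<eta> \<in> act g -` U \<inter> bdry" using r \<eta> act_bdry[OF \<eta> g] by blast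
    qed
  qed blast
  then show "act g -` U \<inter> space (sigma (topspace (boundary_topology (carrier G) dist \<one>))
      {U. openin (boundary_topology (carrier G) dist \<one>) U})
    \<in> sets (sigma (topspace (boundary_topology (carrier G) dist \<one>))
      {U. openin (boundary_topology (carrier G) dist \<one>) U})"
    using open_in_bdry_borel space_bdry_borel
    unfolding borel_of_topology_def group_boundary_def by simp
next
  fix \<xi> assume "\<xi> \<in> space (sigma (topspace (boundary_topology (carrier G) dist \<one>))
      {U. openin (boundary_topology (carrier G) dist \<one>) U})"
  then show "act g \<xi> \<in> topspace (boundary_topology (carrier G) dist \<one>)"
    using act_bdry[OF _ g] space_bdry_borel
    unfolding borel_of_topology_def group_boundary_def by (simp add: topspace_boundary_topology)
next
  fix U x assume "openin (boundary_topology (carrier G) dist \<one>) U" "x \<in> U"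
  then show "x \<in> topspace (boundary_topology (carrier G) dist \<one>)" using openin_subset by blast
qed

end

section \<open>Shells around geodesic rays\<close>

text \<open>
  Both uniform distributions are at least \<open>1 / card C1\<close> on \<open>C0\<close>, so their distance is at most
  \<open>2 * (1 - card C0 / card C1)\<close>. The logarithmic form of the bound is the one that telescopes.
\<close>

lemma l1_dist_uniform_le:
  fixes A B C0 C1 T :: "'x set"
  assumes fin: "finite C1" "finite T" and sub: "C0 \<subseteq> A" "C0 \<subseteq> B" "A \<subseteq> C1" "B \<subseteq> C1" and ne: "C0 \<noteq> {}"
  shows "(\<Sum>h\<in>T. \<bar>(if h \<in> A then 1 / card A else 0) - (if h \<in> B then 1 / card B else (0::real))\<bar>)
    \<le> 2 * (ln (card C1) - ln (card C0))"
proof -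
  define a b c where "a h = (if h \<in> A then 1 / real (card A) else 0)"
    and "b h = (if h \<in> B then 1 / real (card B) else 0)"
    and "c h = (if h \<in> C0 then 1 / real (card C1) else 0)" for h
  have finA: "finite A" "finite B" "finite C0"
    using finite_subset[OF _ fin(1)] sub by auto
  have pos: "0 < card C0" "0 < card A" "0 < card B" "0 < card C1"
    using ne sub finA fin by (auto simp: card_gt_0_iff)
  have le: "card A \<le> card C1" "card B \<le> card C1" using sub fin by (auto intro: card_mono)
  have pt: "\<bar>a h - b h\<bar> \<le> a h + b h - 2 * c h" for h
  proof -
    have "0 \<le> c h" "c h \<le> a h" "c h \<le> b h"
      using sub pos le by (auto simp: a_def b_def c_def intro!: divide_left_mono)
    then show ?thesis by linarith
  qed
  have "(\<Sum>h\<in>T. \<bar>a h - b h\<bar>) \<le> (\<Sum>h\<in>T \<union> C1. \<bar>a h - b h\<bar>)"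
    using fin by (intro sum_mono2) auto
  also have "\<dots> \<le> (\<Sum>h\<in>T \<union> C1. a h + b h - 2 * c h)" by (intro sum_mono pt)
  also have "\<dots> = (\<Sum>h\<in>T \<union> C1. a h) + (\<Sum>h\<in>T \<union> C1. b h) - 2 * (\<Sum>h\<in>T \<union> C1. c h)"
    by (simp add: sum.distrib sum_subtractf sum_distrib_left)
  also have "(\<Sum>h\<in>T \<union> C1. a h) = 1"
    unfolding a_def using sub fin pos by (subst sum.inter_restrict[symmetric]) (auto simp: Int_absorb1 le_supI2)
  also have "(\<Sum>h\<in>T \<union> C1. b h) = 1"
    unfolding b_def using sub fin pos by (subst sum.inter_restrict[symmetric]) (auto simp: Int_absorb1 le_supI2)
  also have "(\<Sum>h\<in>T \<union> C1. c h) = card C0 / card C1"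
  proof -
    have "C0 \<subseteq> T \<union> C1" using sub by blast
    then show ?thesis unfolding c_def using fin by (subst sum.inter_restrict[symmetric]) (auto simp: Int_absorb1)
  qed
  also have "1 + 1 - 2 * (real (card C0) / card C1) \<le> 2 * (ln (card C1) - ln (card C0))"
    using ln_le_minus_one[of "real (card C0) / card C1"] pos by (simp add: ln_div)
  finally show ?thesis by (simp add: a_def b_def)
qed

lemma sum_shift_diff:
  fixes a :: "nat \<Rightarrow> real"
  shows "(\<Sum>i<n. a (i + m) - a i) = (\<Sum>j<m. a (n + j) - a j)"
proof (induction m)
  case (Suc m)
  have "(\<Sum>i<n. a (i + Suc m) - a i) = (\<Sum>i<n. a (Suc i + m) - a (i + m)) + (\<Sum>i<n. a (i + m) - a i)"
    by (simp add: sum.distrib[symmetric])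
  also have "(\<Sum>i<n. a (Suc i + m) - a (i + m)) = a (n + m) - a m"
    using sum_lessThan_telescope[of "\<lambda>i. a (i + m)" n] by simp
  finally show ?case using Suc by simp
qed simp

context hyperbolic_word_metric
begin

lemma len_conv_at_top:
  assumes "u \<in> conv" shows "\<exists>N. \<forall>i\<ge>N. K \<le> real (len (u i))"
proof -
  obtain N where "\<forall>i\<ge>N. \<forall>j\<ge>N. K \<le> gp (u i) (u j)"
    using assms unfolding converging_to_infinity_def product_diverges_iff by blast
  then have "\<forall>i\<ge>N. K \<le> real (len (u i))" using gp_self convD[OF assms] by metis
  then show ?thesis by blast
qed

lemma bdry_subseq:
  assumes \<xi>: "\<xi> \<in> bdry" and u: "u \<in> \<xi>" and r: "strict_mono (r :: nat \<Rightarrow> nat)"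
  shows "(\<lambda>n. u (r n)) \<in> \<xi>"
proof -
  have uc: "u \<in> conv" using bdry_subset assms by blast
  have r': "n \<le> r n" for n using r by (rule seq_suble)
  have "product_diverges dist \<one> u (\<lambda>n. u (r n))" "product_diverges dist \<one> (\<lambda>n. u (r n)) (\<lambda>n. u (r n))"
    unfolding product_diverges_iff
  proof (safe)
    fix K :: real
    obtain N where N: "\<forall>i\<ge>N. \<forall>j\<ge>N. K \<le> gp (u i) (u j)"
      using uc unfolding converging_to_infinity_def product_diverges_iff by blast
    have "r i \<ge> N" if "i \<ge> N" for i using r'[of i] that by simp
    with N show "\<exists>N. \<forall>i\<ge>N. \<forall>j\<ge>N. K \<le> gp (u i) (u (r j))"
      "\<exists>N. \<forall>i\<ge>N. \<forall>j\<ge>N. K \<le> gp (u (r i)) (u (r j))" by blast+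
  qed
  then show ?thesis
    by (intro bdry_closed[OF \<xi> u]) (auto simp: converging_to_infinity_def convD[OF uc])
qed

text \<open>
  The points \<open>h\<close> for which \<open>y\<close> lies on a geodesic from \<open>x\<close> to \<open>h\<close>.
\<close>

definition cone :: "'a \<Rightarrow> 'a \<Rightarrow> 'a set" where
  "cone x y = {h \<in> carrier G. dist x h = dist x y + dist y h}"

lemma cone_carrier: "cone x y \<subseteq> carrier G"
  by (auto simp: cone_def)

lemma cone_mult:
  "g \<in> carrier G \<Longrightarrow> x \<in> carrier G \<Longrightarrow> y \<in> carrier G \<Longrightarrow> (\<otimes>) g ` cone x y \<subseteq> cone (g \<otimes> x) (g \<otimes> y)"
  by (auto simp: cone_def dist_mult_left)

text \<open>
  The point \<open>y\<close> lies on geodesics from \<open>x\<close> to the terms of a sequence converging to \<open>\<xi>\<close>. This replaces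
  "\<open>y\<close> lies on a geodesic ray from \<open>x\<close> to \<open>\<xi>\<close>" and is a closed condition on \<open>\<xi>\<close>.
\<close>

definition on_ray :: "'a \<Rightarrow> (nat \<Rightarrow> 'a) set \<Rightarrow> 'a \<Rightarrow> bool" where
  "on_ray x \<xi> y \<longleftrightarrow> \<xi> \<in> Lim_set (cone x y)"

lemma on_ray_act:
  assumes "\<xi> \<in> bdry" "g \<in> carrier G" "x \<in> carrier G" "y \<in> carrier G" "on_ray x \<xi> y"
  shows "on_ray (g \<otimes> x) (act g \<xi>) (g \<otimes> y)"
  using Lim_set_act[OF assms(1,2), of "cone x y"] cone_mult[OF assms(2-4)] assms(5)
  unfolding on_ray_def Lim_set_def by blast

text \<open>
  Points at distance \<open>l\<close> from \<open>x\<close> on geodesics to the terms of a sequence representing \<open>\<xi>\<close> lie in a finite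
  ball, so one of them occurs for infinitely many terms.
\<close>

lemma on_ray_exists:
  assumes \<xi>: "\<xi> \<in> bdry" and x: "x \<in> carrier G"
  shows "\<exists>y\<in>carrier G. dist x y = real l \<and> on_ray x \<xi> y"
proof -
  obtain u where u: "u \<in> \<xi>" using bdry_ex \<xi> by blast
  have uc: "u \<in> conv" using bdry_subset \<xi> u by blast
  obtain N where N: "\<forall>i\<ge>N. real l + len x \<le> real (len (u i))" using len_conv_at_top[OF uc] by blast
  have "\<exists>y. y \<in> carrier G \<and> dist x y = l \<and> dist y (u i) = dist x (u i) - l" if "i \<in> {N..}" for i
  proof -
    have "real l \<le> dist x (u i)"
      using dist_triangle[of \<one> x "u i"] N that x convD[OF uc] by (fastforce simp: dist_one)
    then show ?thesis using dist_geodesic[OF x convD[OF uc]] by metis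
  qed
  then obtain y where y: "\<And>i. i \<in> {N..} \<Longrightarrow> y i \<in> carrier G \<and> dist x (y i) = l \<and> dist (y i) (u i) = dist x (u i) - l"
    by metis
  have "y ` {N..} \<subseteq> {z \<in> carrier G. dist x z \<le> l}" using y by auto
  then have "finite (y ` {N..})" using finite_ball[OF x] finite_subset by blast
  then obtain i0 where i0: "i0 \<in> {N..}" "infinite {i \<in> {N..}. y i = y i0}"
    using pigeonhole_infinite[of "{N..}" y] infinite_Ici by blast
  define r where "r = enumerate {i \<in> {N..}. y i = y i0}"
  have r: "strict_mono r" "\<And>n. r n \<in> {i \<in> {N..}. y i = y i0}"
    unfolding r_def by (rule strict_mono_enumerate[OF i0(2)], rule enumerate_in_set[OF i0(2)])
  have "(\<lambda>n. u (r n)) \<in> \<xi>" by (rule bdry_subseq[OF \<xi> u r(1)])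
  moreover have "u (r n) \<in> cone x (y i0)" for n
  proof -
    have "r n \<in> {N..}" "y (r n) = y i0" using r(2)[of n] by auto
    then show ?thesis using y[of "r n"] convD[OF uc] by (simp add: cone_def)
  qed
  ultimately have "on_ray x \<xi> (y i0)"
    unfolding on_ray_def Lim_set_def using \<xi> by (auto intro!: bexI[of _ "\<lambda>n. u (r n)"])
  then show ?thesis using y[OF i0(1)] by blast
qed

text \<open>
  The points at distance \<open>l\<close> from a base point \<open>x'\<close> within distance \<open>k\<close> of \<open>x\<close>, on rays from \<open>x'\<close> to \<open>\<xi>\<close>. Moving
  \<open>x\<close> by \<open>r\<close> is compensated by increasing \<open>k\<close> by \<open>r\<close>.
\<close>

definition shell :: "nat \<Rightarrow> nat \<Rightarrow> 'a \<Rightarrow> (nat \<Rightarrow> 'a) set \<Rightarrow> 'a set" where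
  "shell l k x \<xi> = {y \<in> carrier G. \<exists>x'\<in>carrier G. dist x x' \<le> k \<and> dist x' y = l \<and> on_ray x' \<xi> y}"

lemma shell_mult:
  assumes "\<xi> \<in> bdry" "g \<in> carrier G" "x \<in> carrier G" "y \<in> shell l k x \<xi>"
  shows "g \<otimes> y \<in> shell l k (g \<otimes> x) (act g \<xi>)"
proof -
  obtain x' where x': "y \<in> carrier G" "x' \<in> carrier G" "dist x x' \<le> k" "dist x' y = l" "on_ray x' \<xi> y"
    using assms(4) by (auto simp: shell_def)
  then have "dist (g \<otimes> x) (g \<otimes> x') \<le> k \<and> dist (g \<otimes> x') (g \<otimes> y) = l \<and> on_ray (g \<otimes> x') (act g \<xi>) (g \<otimes> y)"
    using on_ray_act[OF assms(1,2), of x' y] assms by (simp add: dist_mult_left)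
  then show ?thesis using x' assms(2) unfolding shell_def by blast
qed

lemma shell_act:
  assumes "\<xi> \<in> bdry" "g \<in> carrier G" "x \<in> carrier G"
  shows "shell l k (g \<otimes> x) (act g \<xi>) = (\<otimes>) g ` shell l k x \<xi>"
proof
  show "(\<otimes>) g ` shell l k x \<xi> \<subseteq> shell l k (g \<otimes> x) (act g \<xi>)" using shell_mult[OF assms] by blast
  show "shell l k (g \<otimes> x) (act g \<xi>) \<subseteq> (\<otimes>) g ` shell l k x \<xi>"
  proof
    fix y assume y: "y \<in> shell l k (g \<otimes> x) (act g \<xi>)"
    then have yc: "y \<in> carrier G" by (simp add: shell_def)
    have "inv g \<otimes> y \<in> shell l k (inv g \<otimes> (g \<otimes> x)) (act (inv g) (act g \<xi>))"
      using assms y by (intro shell_mult act_bdry) auto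
    then have "inv g \<otimes> y \<in> shell l k x \<xi>"
      using assms by (simp add: inv_mult_cancel act_act act_one)
    then show "y \<in> (\<otimes>) g ` shell l k x \<xi>"
      using mult_inv_cancel[OF assms(2) yc] by (metis imageI)
  qed
qed

lemma shell_subset_shell:
  assumes "x \<in> carrier G" "x' \<in> carrier G" "dist x x' \<le> real r" "k + r \<le> k'"
  shows "shell l k x \<xi> \<subseteq> shell l k' x' \<xi>"
proof -
  have "dist x' z \<le> real k'" if "z \<in> carrier G" "dist x z \<le> k" for z
    using dist_triangle[of x' x z] dist_commute[of x x'] assms that by simp
  then show ?thesis unfolding shell_def by blast
qed

lemma shell_nonempty:
  assumes "\<xi> \<in> bdry" "x \<in> carrier G" shows "shell l k x \<xi> \<noteq> {}"
proof -
  obtain y where "y \<in> carrier G" "dist x y = l" "on_ray x \<xi> y" using on_ray_exists[OF assms] by blast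
  then have "y \<in> shell l k x \<xi>" using assms(2) by (auto simp: shell_def dist_self intro!: bexI[of _ x])
  then show ?thesis by blast
qed

lemma shell_dist:
  assumes "x \<in> carrier G" "y \<in> shell l k x \<xi>" shows "dist x y \<le> l + k" "real l \<le> dist x y + k"
proof -
  obtain x' where x': "y \<in> carrier G" "x' \<in> carrier G" "dist x x' \<le> k" "dist x' y = l"
    using assms(2) by (auto simp: shell_def)
  then show "dist x y \<le> l + k" "real l \<le> dist x y + k"
    using dist_triangle[of x x' y] dist_triangle[of x' x y] dist_commute[of x x'] assms(1) by auto
qed

lemma finite_shell: "x \<in> carrier G \<Longrightarrow> finite (shell l k x \<xi>)"
proof -
  assume x: "x \<in> carrier G"
  have "shell l k x \<xi> \<subseteq> {y \<in> carrier G. dist x y \<le> real l + real k}"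
    using shell_dist(1)[OF x, of _ l k \<xi>] by (auto simp: shell_def)
  then show ?thesis by (rule finite_subset) (rule finite_ball[OF x])
qed

text \<open>
  If \<open>l\<close> exceeds \<open>k + \<delta>\<close>, the points of the shell almost lie on geodesics from \<open>x\<close> itself
  towards \<open>\<xi>\<close>.
\<close>

lemma shell_coarse_ray:
  assumes x: "x \<in> carrier G" and y: "y \<in> shell l k x \<xi>" and l: "k + \<delta> < l"
  obtains u where "u \<in> \<xi>" "range u \<subseteq> carrier G" "\<And>i. dist x y + dist y (u i) \<le> dist x (u i) + 2 * \<delta>"
proof -
  obtain x' where x': "y \<in> carrier G" "x' \<in> carrier G" "dist x x' \<le> k" "dist x' y = l" "on_ray x' \<xi> y"
    using y by (auto simp: shell_def)
  obtain u where u: "u \<in> \<xi>" "range u \<subseteq> cone x' y" using x'(5) by (auto simp: on_ray_def Lim_set_def)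
  have "dist x y + dist y (u i) \<le> dist x (u i) + 2 * \<delta>" for i
  proof -
    have c: "u i \<in> carrier G" "dist x' (u i) = l + dist y (u i)"
      using u(2) x' by (auto simp: cone_def)
    have "real l \<le> dist x y + k" using shell_dist[OF x y] by simp
    then show ?thesis
      \<comment> \<open>The other alternative of the four-point condition would give \<open>l \<le> k + \<delta>\<close>.\<close>
      using four_point[of x' x "u i" y] x x' c l dist_commute[of x x'] dist_commute[of "u i" y]
      by (simp add: gromov_product_def min_def field_simps split: if_splits)
  qed
  then show ?thesis using that[of u] u cone_carrier by blast
qed

lemma gp_base_change:
  assumes "w \<in> carrier G" "x \<in> carrier G" "y \<in> carrier G"
  shows "gp x y - len w \<le> gromov_product dist w x y"
  using dist_triangle[of \<one> w x] dist_triangle[of \<one> w y] assms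
  by (simp add: gromov_product_def dist_one field_simps)

text \<open>
  Two points at equal distance from \<open>x\<close> near rays from \<open>x\<close> to the same boundary point are close.
\<close>

lemma coarse_rays_close:
  assumes \<xi>: "\<xi> \<in> bdry" and x: "x \<in> carrier G" and yz: "y \<in> carrier G" "z \<in> carrier G"
    and eq: "dist x y = dist x z"
    and u: "u \<in> \<xi>" "\<And>i. dist x y + dist y (u i) \<le> dist x (u i) + 2 * \<delta>"
    and v: "v \<in> \<xi>" "\<And>i. dist x z + dist z (v i) \<le> dist x (v i) + 2 * \<delta>"
  shows "dist y z \<le> 6 * \<delta>"
proof -
  obtain N where "\<forall>i\<ge>N. \<forall>j\<ge>N. dist x y + len x \<le> gp (u i) (v j)"
    using bdry_diverges[OF \<xi> u(1) v(1)] unfolding product_diverges_iff by blast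
  then have uv: "dist x y + len x \<le> gp (u N) (v N)" by blast
  have c: "u N \<in> carrier G" "v N \<in> carrier G" using bdry_carrier[OF \<xi>] u v by blast+
  have 1: "dist x y \<le> gromov_product dist x (u N) (v N)" using gp_base_change[OF x c] uv by simp
  have 2: "dist x y - \<delta> \<le> gromov_product dist x y (u N)"
    using u(2)[of N] by (simp add: gromov_product_def field_simps)
  have 3: "dist x y - \<delta> \<le> gromov_product dist x (v N) z"
    using v(2)[of N] eq dist_commute[OF yz(2) c(2)] by (simp add: gromov_product_def field_simps)
  have "dist x y - 2 * \<delta> \<le> gromov_product dist x y (v N)"
    using four_point[of x y "u N" "v N"] 1 2 x yz c delta_nonneg by auto
  then have "dist x y - 3 * \<delta> \<le> gromov_product dist x y z"
    using four_point[of x y "v N" z] 3 x yz c delta_nonneg by auto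
  then show ?thesis using eq by (simp add: gromov_product_def field_simps)
qed

text \<open>
  The distances from \<open>x\<close> to points of the shell take at most \<open>2 * k + 1\<close> values, and points with equal distance
  lie in a ball of radius \<open>6 * \<delta>\<close>.
\<close>

lemma card_shell_le:
  assumes \<xi>: "\<xi> \<in> bdry" and x: "x \<in> carrier G" and l: "k + \<delta> < real l"
  shows "card (shell l k x \<xi>) \<le> (2 * k + 1) * card {g \<in> carrier G. len g \<le> nat \<lfloor>6 * \<delta>\<rfloor>}"
proof -
  define D where "D = card {g \<in> carrier G. len g \<le> nat \<lfloor>6 * \<delta>\<rfloor>}"
  define A where "A j = {y \<in> shell l k x \<xi>. dist x y = real j}" for j
  have cA: "card (A j) \<le> D" for j
  proof (cases "A j = {}")
    case False
    then obtain y where y: "y \<in> A j" by blast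
    then have yc: "y \<in> carrier G" by (simp add: A_def shell_def)
    have "A j \<subseteq> {z \<in> carrier G. dist y z \<le> 6 * \<delta>}"
    proof
      fix z assume z: "z \<in> A j"
      then have zc: "z \<in> carrier G" by (simp add: A_def shell_def)
      obtain u where u: "u \<in> \<xi>" "range u \<subseteq> carrier G"
          "\<And>i. dist x y + dist y (u i) \<le> dist x (u i) + 2 * \<delta>"
        by (rule shell_coarse_ray[OF x _ l, of y \<xi>]) (use y in \<open>auto simp: A_def\<close>)
      obtain v where v: "v \<in> \<xi>" "range v \<subseteq> carrier G"
          "\<And>i. dist x z + dist z (v i) \<le> dist x (v i) + 2 * \<delta>"
        by (rule shell_coarse_ray[OF x _ l, of z \<xi>]) (use z in \<open>auto simp: A_def\<close>)
      have "dist y z \<le> 6 * \<delta>"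
        using y z by (intro coarse_rays_close[OF \<xi> x yc zc _ u(1,3) v(1,3)]) (auto simp: A_def)
      then show "z \<in> {z \<in> carrier G. dist y z \<le> 6 * \<delta>}" using zc by simp
    qed
    then have "card (A j) \<le> card {z \<in> carrier G. dist y z \<le> 6 * \<delta>}"
      by (intro card_mono finite_ball yc)
    also have "\<dots> \<le> D" unfolding D_def by (rule card_ball_le[OF yc])
    finally show ?thesis .
  qed simp
  have "shell l k x \<xi> \<subseteq> (\<Union>j\<in>{l - k..l + k}. A j)"
  proof
    fix y assume y: "y \<in> shell l k x \<xi>"
    define j where "j = len (inv x \<otimes> y)"
    have j: "dist x y = real j" by (simp add: word_dist_def j_def)
    then have "j \<in> {l - k..l + k}" using shell_dist[OF x y] by auto
    then show "y \<in> (\<Union>j\<in>{l - k..l + k}. A j)" using y j by (auto simp: A_def)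
  qed
  then have "card (shell l k x \<xi>) \<le> card (\<Union>j\<in>{l - k..l + k}. A j)"
    using finite_shell[OF x] by (intro card_mono) (auto simp: A_def)
  also have "\<dots> \<le> (\<Sum>j\<in>{l - k..l + k}. card (A j))" by (rule card_UN_le) simp
  also have "\<dots> \<le> (\<Sum>j\<in>{l - k..l + k}. D)" by (intro sum_mono cA)
  also have "\<dots> = (2 * k + 1) * D"
  proof -
    have "k \<le> l" using l delta_nonneg by linarith
    then show ?thesis by simp
  qed
  finally show ?thesis unfolding D_def .
qed

text \<open>
  A geodesic ray is built as in Koenig's lemma: if \<open>y\<close> lies on geodesics from \<open>1\<close> to infinitely many
  elements, then so does one of the finitely many points that follow it.
\<close>

lemma bdry_nonempty:
  assumes inf: "infinite (carrier G)" shows "bdry \<noteq> {}"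
proof -
  define P where "P n y \<longleftrightarrow> y \<in> carrier G \<and> len y = n \<and> infinite (cone \<one> y)" for n y
  have step: "\<exists>z. P (Suc n) z \<and> dist y z = 1" if y: "P n y" for n y
  proof -
    have yc: "y \<in> carrier G" using y by (simp add: P_def)
    define Z where "Z = {z \<in> carrier G. dist y z = 1 \<and> len z = Suc n}"
    have "finite Z" unfolding Z_def by (rule finite_subset[OF _ finite_ball[OF yc, of 1]]) auto
    have "cone \<one> y - {y} \<subseteq> (\<Union>z\<in>Z. cone \<one> z)"
    proof
      fix h assume h: "h \<in> cone \<one> y - {y}"
      then have hc: "h \<in> carrier G" "dist \<one> h = n + dist y h" using y yc by (auto simp: cone_def dist_one P_def)
      have "len (inv y \<otimes> h) \<noteq> 0"
      proof
        assume "len (inv y \<otimes> h) = 0"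
        then have "inv y \<otimes> h = \<one>" using yc hc by (intro len_eq_0) auto
        then have "h = y" using mult_inv_cancel[OF yc hc(1)] yc by simp
        then show False using h by simp
      qed
      then have "real 1 \<le> dist y h" by (simp add: word_dist_def)
      from dist_geodesic[OF yc hc(1) this] obtain z
        where z: "z \<in> carrier G" "dist y z = 1" "dist z h = dist y h - 1" by auto
      have "dist \<one> z \<le> n + 1" using dist_triangle[of \<one> y z] y yc z by (simp add: dist_one P_def)
      moreover have "dist \<one> h \<le> dist \<one> z + dist z h" by (intro dist_triangle) (use z hc in auto)
      ultimately have "dist \<one> z = n + 1" using hc z by simp
      then have "z \<in> Z" "h \<in> cone \<one> z" using z hc by (auto simp: Z_def cone_def dist_one)
      then show "h \<in> (\<Union>z\<in>Z. cone \<one> z)" by blast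
    qed
    moreover have "infinite (cone \<one> y - {y})" using y by (simp add: P_def)
    ultimately have "infinite (\<Union>z\<in>Z. cone \<one> z)" using finite_subset by blast
    then obtain z where "z \<in> Z" "infinite (cone \<one> z)" using \<open>finite Z\<close> by blast
    then show ?thesis by (auto simp: P_def Z_def)
  qed
  have "cone \<one> \<one> = carrier G" by (auto simp: cone_def dist_self)
  then have "P 0 \<one>" using inf by (simp add: P_def)
  from dependent_nat_choice[of P "\<lambda>_ y z. dist y z = 1"] this step
  obtain u where u: "\<And>n. P n (u n)" "\<And>n. dist (u n) (u (Suc n)) = 1" by metis
  have uc: "u n \<in> carrier G" "len (u n) = n" for n using u(1)[of n] by (auto simp: P_def)
  have d: "dist (u n) (u (n + k)) \<le> k" for n k
  proof (induction k)
    case (Suc k)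
    then show ?case using dist_triangle[of "u n" "u (n + k)" "u (n + Suc k)"] u(2)[of "n + k"] uc by simp
  qed (simp add: dist_self uc)
  have gp: "min (real i) (real j) \<le> gp (u i) (u j)" for i j
  proof (cases "i \<le> j")
    case True
    then show ?thesis using d[of i "j - i"] uc by (simp add: gromov_product_def dist_one)
  next
    case False
    then show ?thesis using d[of j "i - j"] uc dist_commute[of "u i" "u j"] by (simp add: gromov_product_def dist_one)
  qed
  have "product_diverges dist \<one> u u"
    unfolding product_diverges_iff
  proof
    fix K :: real
    have "K \<le> gp (u i) (u j)" if "i \<ge> nat \<lceil>K\<rceil>" "j \<ge> nat \<lceil>K\<rceil>" for i j
      using gp[of i j] that by linarith
    then show "\<exists>N. \<forall>i\<ge>N. \<forall>j\<ge>N. K \<le> gp (u i) (u j)" by blast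
  qed
  then have "u \<in> conv" using uc by (auto simp: converging_to_infinity_def)
  then have "{v. v \<in> conv \<and> product_diverges dist \<one> u v} \<in> bdry" by (intro bdryI) auto
  then show ?thesis by blast
qed

end

section \<open>Asymptotically invariant weights on the boundary\<close>

context hyperbolic_word_metric
begin

text \<open>
  The uniform distribution on a shell, as a weight on the group.
\<close>

definition ray_weight :: "nat \<Rightarrow> nat \<Rightarrow> 'a \<Rightarrow> (nat \<Rightarrow> 'a) set \<Rightarrow> 'a \<Rightarrow> real" where
  "ray_weight l k x \<xi> h = (if h \<in> shell l k x \<xi> then 1 / card (shell l k x \<xi>) else 0)"

lemma ray_weight_nonneg: "0 \<le> ray_weight l k x \<xi> h"
  by (simp add: ray_weight_def)

lemma sum_ray_weight:
  assumes "\<xi> \<in> bdry" "x \<in> carrier G" "finite B" "shell l k x \<xi> \<subseteq> B"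
  shows "(\<Sum>h\<in>B. ray_weight l k x \<xi> h) = 1"
  unfolding ray_weight_def using assms shell_nonempty[OF assms(1,2), of l k] finite_shell[OF assms(2), of l k \<xi>]
  by (subst sum.inter_restrict[symmetric]) (auto simp: Int_absorb1 card_gt_0_iff)

lemma ray_weight_act:
  assumes "\<xi> \<in> bdry" "g \<in> carrier G" "x \<in> carrier G" "h \<in> carrier G"
  shows "ray_weight l k (g \<otimes> x) (act g \<xi>) h = ray_weight l k x \<xi> (inv g \<otimes> h)"
proof -
  have inj: "inj_on ((\<otimes>) g) (shell l k x \<xi>)" using assms by (auto simp: inj_on_def shell_def)
  have "h \<in> (\<otimes>) g ` shell l k x \<xi> \<longleftrightarrow> inv g \<otimes> h \<in> shell l k x \<xi>"
  proof
    assume "h \<in> (\<otimes>) g ` shell l k x \<xi>"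
    then show "inv g \<otimes> h \<in> shell l k x \<xi>" using assms(2) by (auto simp: inv_mult_cancel shell_def)
  next
    assume "inv g \<otimes> h \<in> shell l k x \<xi>"
    then have "g \<otimes> (inv g \<otimes> h) \<in> (\<otimes>) g ` shell l k x \<xi>" by blast
    then show "h \<in> (\<otimes>) g ` shell l k x \<xi>" using assms by (simp add: mult_inv_cancel)
  qed
  then show ?thesis
    unfolding ray_weight_def shell_act[OF assms(1-3)] card_image[OF inj] by simp
qed

lemma ray_weight_measurable:
  assumes x: "x \<in> carrier G"
  shows "(\<lambda>\<xi>. ray_weight l k x \<xi> h) \<in> borel_measurable bdry_borel"
proof -
  have mem: "{\<xi> \<in> space bdry_borel. h \<in> shell l k x \<xi>} \<in> sets bdry_borel" for h
  proof (cases "h \<in> carrier G")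
    case True
    have "{\<xi> \<in> space bdry_borel. h \<in> shell l k x \<xi>}
        = (\<Union>x'\<in>{x' \<in> carrier G. dist x x' \<le> k \<and> dist x' h = l}. Lim_set (cone x' h))"
      using True by (auto simp: shell_def on_ray_def space_bdry_borel Lim_set_def)
    also have "\<dots> \<in> sets bdry_borel"
      using countable_subset[OF _ countable_carrier]
      by (intro sets.countable_UN'') (auto intro!: Lim_set_measurable cone_carrier)
    finally show ?thesis .
  qed (simp add: shell_def)
  define B where "B = {y \<in> carrier G. dist x y \<le> real l + real k}"
  have fin: "finite B" unfolding B_def by (rule finite_ball[OF x])
  have "shell l k x \<xi> \<subseteq> B" for \<xi>
    using shell_dist(1)[OF x, of _ l k \<xi>] by (auto simp: shell_def B_def)
  then have card: "real (card (shell l k x \<xi>)) = (\<Sum>y\<in>B. if y \<in> shell l k x \<xi> then 1 else 0)" for \<xi>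
    using fin by (simp add: sum.inter_restrict[symmetric] Int_absorb1)
  have [measurable]: "Measurable.pred bdry_borel (\<lambda>\<xi>. y \<in> shell l k x \<xi>)" for y
    using mem[of y] by (simp add: pred_def)
  show ?thesis unfolding ray_weight_def card by measurable
qed

lemma l1_dist_ray_weight_le:
  assumes \<xi>: "\<xi> \<in> bdry" and g: "g \<in> carrier G" "len g \<le> r" and T: "finite T" "T \<subseteq> carrier G"
    and k: "r \<le> k"
  shows "(\<Sum>h\<in>T. \<bar>ray_weight l k \<one> \<xi> (inv g \<otimes> h) - ray_weight l k \<one> (act g \<xi>) h\<bar>)
    \<le> 2 * (ln (card (shell l (k + r) \<one> (act g \<xi>))) - ln (card (shell l (k - r) \<one> (act g \<xi>))))"
proof -
  note \<xi>' = act_bdry[OF \<xi> g(1)]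
  have "ray_weight l k \<one> \<xi> (inv g \<otimes> h) = ray_weight l k g (act g \<xi>) h" if "h \<in> T" for h
    using ray_weight_act[OF \<xi> g(1) one_closed, of h l k] that T g by auto
  then have "(\<Sum>h\<in>T. \<bar>ray_weight l k \<one> \<xi> (inv g \<otimes> h) - ray_weight l k \<one> (act g \<xi>) h\<bar>)
      = (\<Sum>h\<in>T. \<bar>ray_weight l k g (act g \<xi>) h - ray_weight l k \<one> (act g \<xi>) h\<bar>)"
    by (intro sum.cong) auto
  also have "\<dots> \<le> 2 * (ln (card (shell l (k + r) \<one> (act g \<xi>))) - ln (card (shell l (k - r) \<one> (act g \<xi>))))"
    unfolding ray_weight_def
    using g k T(1) shell_nonempty[OF \<xi>' one_closed] finite_shell[OF one_closed]
    by (intro l1_dist_uniform_le shell_subset_shell[where r = r] shell_subset_shell[where r = 0])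
      (auto simp: dist_one dist_commute[of g] dist_self)
  finally show ?thesis .
qed

text \<open>
  The action on the boundary is amenable, with Borel maps into the probability distributions on one
  finite subset of the group.
\<close>

lemma boundary_action_amenable:
  assumes F: "finite F" "F \<subseteq> carrier G" and \<epsilon>: "0 < \<epsilon>"
  obtains m :: "'a \<Rightarrow> (nat \<Rightarrow> 'a) set \<Rightarrow> real" and B
  where "finite B" "B \<subseteq> carrier G" "\<And>h. m h \<in> borel_measurable bdry_borel" "\<And>h \<xi>. 0 \<le> m h \<xi>"
    "\<And>h \<xi>. \<xi> \<in> bdry \<Longrightarrow> h \<notin> B \<Longrightarrow> m h \<xi> = 0" "\<And>\<xi>. \<xi> \<in> bdry \<Longrightarrow> (\<Sum>h\<in>B. m h \<xi>) = 1"
    "\<And>g \<xi> T. \<lbrakk>g \<in> F; \<xi> \<in> bdry; finite T; T \<subseteq> carrier G\<rbrakk> \<Longrightarrow>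
      (\<Sum>h\<in>T. \<bar>m (inv g \<otimes> h) \<xi> - m h (act g \<xi>)\<bar>) \<le> \<epsilon>"
proof -
  define r where "r = Max (insert 0 (len ` F))"
  have r: "len g \<le> r" if "g \<in> F" for g unfolding r_def using F(1) that by (intro Max_ge) auto
  define D where "D = real (card {g \<in> carrier G. len g \<le> nat \<lfloor>6 * \<delta>\<rfloor>})"
  have "\<one> \<in> {g \<in> carrier G. len g \<le> nat \<lfloor>6 * \<delta>\<rfloor>}" by simp
  then have D: "0 < D" unfolding D_def using finite_ball_one by (auto simp: card_gt_0_iff)
  have "(\<lambda>n. 4 * real r * ln ((2 * (real n + 2 * real r) + 1) * D) / real n) \<longlonglongrightarrow> 0"
    using D by real_asymp
  then have "\<forall>\<^sub>F n in sequentially. 4 * real r * ln ((2 * (real n + 2 * real r) + 1) * D) / real n < \<epsilon>"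
    using \<epsilon> by (rule order_tendstoD)
  then have "\<forall>\<^sub>F n in sequentially. 0 < n \<and> 4 * real r * ln ((2 * (real n + 2 * real r) + 1) * D) / real n < \<epsilon>"
    by (intro eventually_conj eventually_gt_at_top)
  then obtain n where n: "0 < n" "4 * real r * ln ((2 * (real n + 2 * real r) + 1) * D) / real n < \<epsilon>"
    unfolding eventually_sequentially by blast
  \<comment> \<open>The radius exceeds \<open>k + \<delta>\<close> for every \<open>k \<le> n + 2 * r\<close>.\<close>
  define l where "l = n + 2 * r + nat \<lceil>\<delta>\<rceil> + 1"
  \<comment> \<open>Starting the average at \<open>k = r\<close> keeps \<open>k - r\<close> nonnegative.\<close>
  define m where "m h \<xi> = (\<Sum>i<n. ray_weight l (r + i) \<one> \<xi> h) / n" for h \<xi>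
  define B where "B = {y \<in> carrier G. dist \<one> y \<le> real (l + r + n)}"
  have finB: "finite B" unfolding B_def by (rule finite_ball) simp
  have sub: "shell l (r + i) \<one> \<xi> \<subseteq> B" if "i < n" for i \<xi>
    using shell_dist(1)[OF one_closed, of _ l "r + i" \<xi>] that by (fastforce simp: shell_def B_def)
  show ?thesis
  proof (rule that[of B m])
    show "finite B" "B \<subseteq> carrier G" using finB by (auto simp: B_def)
    show "m h \<in> borel_measurable bdry_borel" for h
      unfolding m_def using ray_weight_measurable[OF one_closed] by measurable
    show "0 \<le> m h \<xi>" for h \<xi>
      unfolding m_def by (intro divide_nonneg_nonneg sum_nonneg ray_weight_nonneg) auto
    show "m h \<xi> = 0" if "\<xi> \<in> bdry" "h \<notin> B" for h \<xi>
    proof -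
      have "h \<notin> shell l (r + i) \<one> \<xi>" if "i < n" for i using sub[OF that] \<open>h \<notin> B\<close> by blast
      then show ?thesis unfolding m_def ray_weight_def by simp
    qed
    show "(\<Sum>h\<in>B. m h \<xi>) = 1" if \<xi>: "\<xi> \<in> bdry" for \<xi>
    proof -
      have "(\<Sum>h\<in>B. m h \<xi>) = (\<Sum>i<n. \<Sum>h\<in>B. ray_weight l (r + i) \<one> \<xi> h) / n"
        unfolding m_def sum_divide_distrib[symmetric] by (subst sum.swap) simp
      also have "\<dots> = (\<Sum>i<n. 1) / n"
        using sum_ray_weight[OF \<xi> one_closed finB sub] by simp
      finally show ?thesis using n by simp
    qed
    show "(\<Sum>h\<in>T. \<bar>m (inv g \<otimes> h) \<xi> - m h (act g \<xi>)\<bar>) \<le> \<epsilon>"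
      if g: "g \<in> F" and \<xi>: "\<xi> \<in> bdry" and T: "finite T" "T \<subseteq> carrier G" for g \<xi> T
    proof -
      have gc: "g \<in> carrier G" using g F by blast
      note \<xi>' = act_bdry[OF \<xi> gc]
      define a where "a k = ln (card (shell l k \<one> (act g \<xi>)))" for k
      define L where "L = ln ((2 * (real n + 2 * real r) + 1) * D)"
      have a0: "0 \<le> a k" for k
        using shell_nonempty[OF \<xi>' one_closed, of l k] finite_shell[OF one_closed, of l k "act g \<xi>"]
        unfolding a_def by (intro ln_ge_zero) (simp add: Suc_le_eq card_gt_0_iff)
      have aL: "a k \<le> L" if "k \<le> n + 2 * r" for k
      proof -
        have "real k + \<delta> < real l" unfolding l_def using that by linarith
        from of_nat_mono[OF card_shell_le[OF \<xi>' one_closed this], where ?'a = real]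
        have "real (card (shell l k \<one> (act g \<xi>))) \<le> (2 * real k + 1) * D"
          unfolding D_def by (simp only: of_nat_mult of_nat_add of_nat_1 of_nat_numeral)
        also have "\<dots> \<le> (2 * (real n + 2 * real r) + 1) * D"
          using that D by (intro mult_right_mono) auto
        finally show ?thesis
          unfolding a_def L_def
          using shell_nonempty[OF \<xi>' one_closed, of l k] finite_shell[OF one_closed, of l k "act g \<xi>"]
          by (intro ln_mono) (auto simp: card_gt_0_iff)
      qed
      have "(\<Sum>h\<in>T. \<bar>m (inv g \<otimes> h) \<xi> - m h (act g \<xi>)\<bar>)
        \<le> (\<Sum>h\<in>T. (\<Sum>i<n. \<bar>ray_weight l (r + i) \<one> \<xi> (inv g \<otimes> h) - ray_weight l (r + i) \<one> (act g \<xi>) h\<bar>) / n)"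
        unfolding m_def diff_divide_distrib[symmetric] sum_subtractf[symmetric] abs_divide
        by (intro sum_mono) (auto intro!: divide_right_mono sum_abs)
      also have "\<dots> = (\<Sum>i<n. \<Sum>h\<in>T. \<bar>ray_weight l (r + i) \<one> \<xi> (inv g \<otimes> h) - ray_weight l (r + i) \<one> (act g \<xi>) h\<bar>) / n"
        unfolding sum_divide_distrib[symmetric] by (subst sum.swap) simp
      also have "\<dots> \<le> (\<Sum>i<n. 2 * (a (r + i + r) - a (r + i - r))) / n"
        unfolding a_def by (intro divide_right_mono sum_mono l1_dist_ray_weight_le[OF \<xi> gc r[OF g] T]) auto
      also have "(\<Sum>i<n. 2 * (a (r + i + r) - a (r + i - r))) = 2 * (\<Sum>i<n. a (i + 2 * r) - a i)"
      proof -
        have "r + i + r = i + 2 * r" "r + i - r = i" for i by auto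
        then show ?thesis by (simp only: sum_distrib_left)
      qed
      also have "(\<Sum>i<n. a (i + 2 * r) - a i) = (\<Sum>j<2 * r. a (n + j) - a j)"
        by (rule sum_shift_diff)
      also have "\<dots> \<le> (\<Sum>j<2 * r. L)"
      proof (rule sum_mono)
        fix j assume "j \<in> {..<2 * r}"
        then show "a (n + j) - a j \<le> L" using aL[of "n + j"] a0[of j] by simp
      qed
      finally have "(\<Sum>h\<in>T. \<bar>m (inv g \<otimes> h) \<xi> - m h (act g \<xi>)\<bar>) \<le> 2 * (\<Sum>j<2 * r. L) / n"
        by (simp add: divide_right_mono)
      also have "\<dots> = 4 * real r * L / n" by simp
      finally show ?thesis using n(2) by (simp add: L_def)
    qed
  qed
qed

end

section \<open>Weights comparable to their translates\<close>

context word_metric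
begin

lemma prob_space_translate:
  assumes "prob_space \<omega>" "sets \<omega> = sets (count_space (carrier G))" "g \<in> carrier G"
  shows "prob_space (distr \<omega> \<omega> (\<lambda>x. g \<otimes> x))" "(\<lambda>x. g \<otimes> x) \<in> measurable \<omega> \<omega>"
proof -
  show "(\<lambda>x. g \<otimes> x) \<in> measurable \<omega> \<omega>"
    unfolding measurable_cong_sets[OF assms(2) assms(2)] using assms(3) by auto
  then show "prob_space (distr \<omega> \<omega> (\<lambda>x. g \<otimes> x))" by (rule prob_space.prob_space_distr[OF assms(1)])
qed

lemma measure_translate:
  assumes "prob_space \<omega>" "sets \<omega> = sets (count_space (carrier G))" "g \<in> carrier G" "h \<in> carrier G"
  shows "measure (distr \<omega> \<omega> (\<lambda>x. g \<otimes> x)) {h} = measure \<omega> {inv g \<otimes> h}"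
proof -
  have sp: "space \<omega> = carrier G" using sets_eq_imp_space_eq[OF assms(2)] by simp
  have "(\<lambda>x. g \<otimes> x) -` {h} \<inter> space \<omega> = {inv g \<otimes> h}"
    using assms(3,4) by (auto simp: sp mult_inv_cancel inv_mult_cancel)
  then show ?thesis
    using prob_space_translate(2)[OF assms(1-3)] assms(2,4) by (subst measure_distr) auto
qed

lemma f_divergence_translate:
  assumes f: "convex_on {0<..} f" "f 1 = 0"
    and \<omega>: "prob_space \<omega>" "sets \<omega> = sets (count_space (carrier G))" and g: "g \<in> carrier G"
  shows "f_divergence f (distr \<omega> \<omega> (\<lambda>x. g \<otimes> x)) \<omega> = enn2ereal
    (\<integral>\<^sup>+ h. persp (normalized f) (measure \<omega> {inv g \<otimes> h}) (measure \<omega> {h}) \<partial>count_space (carrier G))"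
proof -
  have "f_divergence f (distr \<omega> \<omega> (\<lambda>x. g \<otimes> x)) \<omega> = enn2ereal
    (\<integral>\<^sup>+ h. persp (normalized f) (measure (distr \<omega> \<omega> (\<lambda>x. g \<otimes> x)) {h}) (measure \<omega> {h}) \<partial>count_space (carrier G))"
    by (intro f_divergence_eq_persp f prob_space_translate(1) \<omega> g discrete_measure_eq_density
        sigma_finite_measure_count_space_countable countable_carrier) (auto simp: \<omega>(2))
  also have "(\<integral>\<^sup>+ h. persp (normalized f) (measure (distr \<omega> \<omega> (\<lambda>x. g \<otimes> x)) {h}) (measure \<omega> {h}) \<partial>count_space (carrier G))
    = (\<integral>\<^sup>+ h. persp (normalized f) (measure \<omega> {inv g \<otimes> h}) (measure \<omega> {h}) \<partial>count_space (carrier G))"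
    using measure_translate[OF \<omega> g] by (intro nn_integral_cong) simp
  finally show ?thesis .
qed

text \<open>
  The base of the exponential weight \<open>h \<mapsto> decay ^ len h\<close>, small enough against the growth of the group for the
  weight to be summable.
\<close>

definition decay :: real where "decay = 1 / (2 * (card letters + 1))"

lemma decay: "0 < decay" "decay \<le> 1"
  by (auto simp: decay_def field_simps)

lemma nn_integral_decay_le:
  "(\<integral>\<^sup>+h. ennreal (decay ^ len h) \<partial>count_space (carrier G)) \<le> 2"
proof -
  have "(\<integral>\<^sup>+h. ennreal (decay ^ len h) \<partial>count_space (carrier G))
      = (\<integral>\<^sup>+h. (\<Sum>n. ennreal (decay ^ n) * indicator {h. len h = n} h) \<partial>count_space (carrier G))"
  proof (rule nn_integral_cong)
    fix h
    show "ennreal (decay ^ len h) = (\<Sum>n. ennreal (decay ^ n) * indicator {h. len h = n} h)"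
      by (rule suminf_cmult_indicator[symmetric]) (auto simp: disjoint_family_on_def)
  qed
  also have "\<dots> = (\<Sum>n. \<integral>\<^sup>+h. ennreal (decay ^ n) * indicator {h. len h = n} h \<partial>count_space (carrier G))"
    by (rule nn_integral_suminf) simp
  also have "\<dots> \<le> (\<Sum>n. ennreal ((1/2) ^ n))"
  proof (rule suminf_le[OF _ summableI summableI])
    fix n
    have "(\<integral>\<^sup>+h. ennreal (decay ^ n) * indicator {h. len h = n} h \<partial>count_space (carrier G))
        = (\<integral>\<^sup>+h. ennreal (decay ^ n) * indicator {h \<in> carrier G. len h = n} h \<partial>count_space (carrier G))"
      by (intro nn_integral_cong) (auto simp: indicator_def)
    also have "\<dots> = ennreal (decay ^ n) * ennreal (card {h \<in> carrier G. len h = n})"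
      using finite_sphere by (subst nn_integral_cmult_indicator) (auto simp: emeasure_count_space_finite ennreal_of_nat_eq_real_of_nat)
    also have "\<dots> = ennreal (decay ^ n * card {h \<in> carrier G. len h = n})"
      using decay by (simp add: ennreal_mult)
    also have "\<dots> \<le> ennreal (decay ^ n * (card letters + 1) ^ n)"
    proof (intro ennreal_leI mult_left_mono)
      have "card {h \<in> carrier G. len h = n} \<le> (card letters + 1) ^ n"
        using card_sphere[of n] power_mono[of "card letters" "card letters + 1" n] by simp
      then show "real (card {h \<in> carrier G. len h = n}) \<le> real ((card letters + 1) ^ n)"
        by (rule of_nat_mono)
    qed (use decay in simp)
    also have "decay ^ n * (card letters + 1) ^ n = (1/2) ^ n"
    proof -
      have "decay * (real (card letters) + 1) = 1 / 2" by (simp add: decay_def field_simps)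
      then show ?thesis by (simp only: of_nat_power power_mult_distrib[symmetric] of_nat_add of_nat_1)
    qed
    finally show "(\<integral>\<^sup>+h. ennreal (decay ^ n) * indicator {h. len h = n} h \<partial>count_space (carrier G)) \<le> ennreal ((1/2) ^ n)" .
  qed
  also have "\<dots> = ennreal (\<Sum>n. (1/2) ^ n)"
    by (intro suminf_ennreal_eq summable_sums summable_geometric) auto
  also have "(\<Sum>n. (1/2::real) ^ n) = 2" by (subst suminf_geometric) auto
  finally show ?thesis by simp
qed

text \<open>
  The convolution of the restriction of \<open>\<zeta>\<close> to \<open>B\<close> with the exponential weight dominates \<open>\<zeta>\<close> on \<open>B\<close>,
  has at most twice the mass of that restriction, and changes under a translation by \<open>g\<close> by a factor between \<open>decay ^ len g\<close> and its inverse, whatever \<open>\<zeta>\<close> is.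
\<close>

lemma smoothing_density:
  fixes \<zeta> :: "'a \<Rightarrow> real"
  assumes B: "finite B" "B \<subseteq> carrier G" "\<one> \<in> B" and \<zeta>: "\<And>k. 0 \<le> \<zeta> k" "0 < \<zeta> \<one>"
  obtains \<kappa> :: "'a \<Rightarrow> real" where
    "\<And>h. h \<in> carrier G \<Longrightarrow> 0 < \<kappa> h" "\<And>h. h \<in> B \<Longrightarrow> \<zeta> h \<le> \<kappa> h"
    "\<And>g h. g \<in> carrier G \<Longrightarrow> h \<in> carrier G \<Longrightarrow> decay ^ len g * \<kappa> h \<le> \<kappa> (inv g \<otimes> h)"
    "\<And>g h. g \<in> carrier G \<Longrightarrow> h \<in> carrier G \<Longrightarrow> decay ^ len g * \<kappa> (inv g \<otimes> h) \<le> \<kappa> h"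
    "(\<integral>\<^sup>+h. ennreal (\<kappa> h) \<partial>count_space (carrier G)) \<le> ennreal (2 * (\<Sum>k\<in>B. \<zeta> k))"
proof -
  define \<kappa> where "\<kappa> h = (\<Sum>k\<in>B. \<zeta> k * decay ^ len (h \<otimes> inv k))" for h
  have Bc: "k \<in> carrier G" if "k \<in> B" for k using B that by blast
  have le: "decay ^ len g * \<kappa> h \<le> \<kappa> (inv g \<otimes> h)" if g: "g \<in> carrier G" and h: "h \<in> carrier G" for g h
    unfolding \<kappa>_def sum_distrib_left
  proof (rule sum_mono)
    fix k assume k: "k \<in> B"
    have "len (inv g \<otimes> h \<otimes> inv k) \<le> len g + len (h \<otimes> inv k)"
      using len_mult[of "inv g" "h \<otimes> inv k"] g h Bc[OF k] by (simp add: m_assoc)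
    then have "decay ^ (len g + len (h \<otimes> inv k)) \<le> decay ^ len (inv g \<otimes> h \<otimes> inv k)"
      using decay by (intro power_decreasing) auto
    then have "\<zeta> k * (decay ^ len g * decay ^ len (h \<otimes> inv k)) \<le> \<zeta> k * decay ^ len (inv g \<otimes> h \<otimes> inv k)"
      using \<zeta>(1)[of k] by (intro mult_left_mono) (auto simp: power_add)
    then show "decay ^ len g * (\<zeta> k * decay ^ len (h \<otimes> inv k)) \<le> \<zeta> k * decay ^ len (inv g \<otimes> h \<otimes> inv k)"
      by (simp add: mult.left_commute)
  qed
  have term_nonneg: "0 \<le> \<zeta> k * decay ^ len (h \<otimes> inv k)" for h k using \<zeta> decay by auto
  have mem_le: "\<zeta> k * decay ^ len (h \<otimes> inv k) \<le> \<kappa> h" if "k \<in> B" for h k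
    unfolding \<kappa>_def using term_nonneg B(1) that by (intro member_le_sum) auto
  show ?thesis
  proof (rule that[of \<kappa>])
    fix h assume "h \<in> carrier G"
    have "0 < \<zeta> \<one> * decay ^ len (h \<otimes> inv \<one>)" using \<zeta> decay by simp
    also have "\<dots> \<le> \<kappa> h" by (rule mem_le[OF B(3)])
    finally show "0 < \<kappa> h" .
  next
    fix h assume "h \<in> B"
    then show "\<zeta> h \<le> \<kappa> h" using mem_le[of h h] Bc by simp
  next
    fix g h assume gh: "g \<in> carrier G" "h \<in> carrier G"
    then show "decay ^ len g * \<kappa> h \<le> \<kappa> (inv g \<otimes> h)" by (rule le)
    have "decay ^ len (inv g) * \<kappa> (inv g \<otimes> h) \<le> \<kappa> (inv (inv g) \<otimes> (inv g \<otimes> h))"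
      using gh by (intro le) auto
    then show "decay ^ len g * \<kappa> (inv g \<otimes> h) \<le> \<kappa> h" using gh by (simp add: mult_inv_cancel)
  next
    have "(\<integral>\<^sup>+h. ennreal (\<kappa> h) \<partial>count_space (carrier G))
        = (\<integral>\<^sup>+h. (\<Sum>k\<in>B. ennreal (\<zeta> k) * ennreal (decay ^ len (h \<otimes> inv k))) \<partial>count_space (carrier G))"
      unfolding \<kappa>_def using \<zeta> decay term_nonneg
      by (intro nn_integral_cong) (simp add: sum_ennreal[symmetric] ennreal_mult)
    also have "\<dots> = (\<Sum>k\<in>B. ennreal (\<zeta> k) * (\<integral>\<^sup>+h. ennreal (decay ^ len (h \<otimes> inv k)) \<partial>count_space (carrier G)))"
      by (subst nn_integral_sum) (auto simp: nn_integral_cmult)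
    also have "\<dots> \<le> (\<Sum>k\<in>B. ennreal (\<zeta> k) * 2)"
    proof (intro sum_mono mult_left_mono)
      fix k assume k: "k \<in> B"
      have "bij_betw (\<lambda>h. h \<otimes> inv k) (carrier G) (carrier G)"
        by (rule bij_betw_byWitness[of _ "\<lambda>h. h \<otimes> k"]) (use Bc[OF k] in \<open>auto simp: m_assoc\<close>)
      then have "(\<integral>\<^sup>+h. ennreal (decay ^ len (h \<otimes> inv k)) \<partial>count_space (carrier G))
          = (\<integral>\<^sup>+h. ennreal (decay ^ len h) \<partial>count_space (carrier G))"
        by (rule nn_integral_bij_count_space)
      then show "(\<integral>\<^sup>+h. ennreal (decay ^ len (h \<otimes> inv k)) \<partial>count_space (carrier G)) \<le> 2"
        using nn_integral_decay_le by simp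
    qed simp
    also have "\<dots> = ennreal (2 * (\<Sum>k\<in>B. \<zeta> k))"
      using \<zeta> by (simp add: sum_distrib_right[symmetric] sum_nonneg ennreal_mult mult.commute)
    finally show "(\<integral>\<^sup>+h. ennreal (\<kappa> h) \<partial>count_space (carrier G)) \<le> ennreal (2 * (\<Sum>k\<in>B. \<zeta> k))" .
  qed
qed

end

section \<open>Comparison of the two infima\<close>

lemma furstenberg_entropy_finite:
  assumes "finite (set_pmf lam)" "set_pmf lam \<subseteq> carrier G"
  shows "furstenberg_entropy G lam f act \<nu>
    = (\<Sum>g\<in>set_pmf lam. ereal (pmf lam g) * f_divergence f (distr \<nu> \<nu> (act g)) \<nu>)"
proof -
  have "furstenberg_entropy G lam f act \<nu>
      = infsum (\<lambda>g. ereal (pmf lam g) * f_divergence f (distr \<nu> \<nu> (act g)) \<nu>) (set_pmf lam)"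
    unfolding furstenberg_entropy_def using assms(2)
    by (intro infsum_cong_neutral) (auto simp: set_pmf_iff zero_ereal_def[symmetric])
  then show ?thesis using assms(1) by simp
qed

context hyperbolic_word_metric
begin

lemma act_measurable_sets_eq:
  assumes "sets \<nu> = sets bdry_borel" "g \<in> carrier G"
  shows "act g \<in> measurable \<nu> \<nu>" "space \<nu> = bdry"
proof -
  show "act g \<in> measurable \<nu> \<nu>"
    using act_measurable[OF assms(2)] measurable_cong_sets[OF assms(1) assms(1)] by simp
  show "space \<nu> = bdry" using sets_eq_imp_space_eq[OF assms(1)] space_bdry_borel by simp
qed

lemma I_top_le_I_group:
  assumes f: "convex_on {0<..} f" "f 1 = 0" and inf: "infinite (carrier G)"
    and lam: "finite (set_pmf lam)" "set_pmf lam \<subseteq> carrier G"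
  shows "I_top G lam f (group_boundary G S) (boundary_action G) \<le> I_group G lam f"
  unfolding I_group_def
proof (rule INF_greatest, clarify)
  fix \<omega> :: "'a measure"
  assume \<omega>: "prob_space \<omega>" "sets \<omega> = sets (count_space (carrier G))"
  interpret \<omega>: prob_space \<omega> by fact
  have sp: "space \<omega> = carrier G" using sets_eq_imp_space_eq[OF \<omega>(2)] by simp
  obtain \<xi> where \<xi>: "\<xi> \<in> bdry" using bdry_nonempty[OF inf] by blast
  define \<phi> where "\<phi> h = act h \<xi>" for h
  have \<phi>: "\<phi> \<in> measurable \<omega> bdry_borel"
    unfolding measurable_cong_sets[OF \<omega>(2) refl] by (auto simp: \<phi>_def space_bdry_borel act_bdry[OF \<xi>])
  define \<nu> where "\<nu> = distr \<omega> bdry_borel \<phi>"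
  have \<nu>: "prob_space \<nu>" "sets \<nu> = sets bdry_borel"
    unfolding \<nu>_def using \<omega>.prob_space_distr[OF \<phi>] by auto
  have le: "f_divergence f (distr \<nu> \<nu> (act g)) \<nu> \<le> f_divergence f (distr \<omega> \<omega> (\<lambda>x. g \<otimes> x)) \<omega>"
    if g: "g \<in> carrier G" for g
  proof -
    note tr = prob_space_translate[OF \<omega> g]
    have "distr \<nu> \<nu> (act g) = distr \<nu> bdry_borel (act g)"
      by (rule distr_cong) (simp_all add: \<nu>(2))
    also have "\<dots> = distr \<omega> bdry_borel (act g \<circ> \<phi>)"
      unfolding \<nu>_def by (rule distr_distr[OF act_measurable[OF g] \<phi>])
    also have "\<dots> = distr \<omega> bdry_borel (\<phi> \<circ> (\<lambda>x. g \<otimes> x))"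
      by (rule distr_cong) (auto simp: sp \<phi>_def act_act[OF \<xi> g])
    also have "\<dots> = distr (distr \<omega> \<omega> (\<lambda>x. g \<otimes> x)) bdry_borel \<phi>"
      by (rule distr_distr[OF \<phi> tr(2), symmetric])
    finally have eq: "distr \<nu> \<nu> (act g) = distr (distr \<omega> \<omega> (\<lambda>x. g \<otimes> x)) bdry_borel \<phi>" .
    show ?thesis
      unfolding eq unfolding \<nu>_def
    proof (rule f_divergence_distr_le[OF f tr(1) \<omega>(1) _ \<phi>])
      show "countable (\<phi> ` space \<omega>)" unfolding sp by (intro countable_image countable_carrier)
      show "{\<phi> x} \<in> sets bdry_borel" if "x \<in> space \<omega>" for x
        using that unfolding \<phi>_def sp by (intro singleton_measurable act_bdry \<xi>)
    qed simp
  qed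
  have "I_top G lam f (group_boundary G S) (boundary_action G) \<le> furstenberg_entropy G lam f act \<nu>"
    unfolding I_top_def by (rule INF_lower) (use \<nu> in auto)
  also have "\<dots> \<le> furstenberg_entropy G lam f (\<lambda>g x. g \<otimes> x) \<omega>"
    unfolding furstenberg_entropy_finite[OF lam]
    by (intro sum_mono ereal_mult_left_mono le) (use lam in auto)
  finally show "I_top G lam f (group_boundary G S) (boundary_action G) \<le> furstenberg_entropy G lam f (\<lambda>g x. g \<otimes> x) \<omega>" .
qed

text \<open>
  For finitely many \<open>g\<close>, a positive measure on the group has divergences at most \<open>\<eta>\<close> above those of \<open>\<nu>\<close>.
  Its weights are proportional to \<open>W + \<kappa>\<close>, where \<open>W\<close> is the average with respect to \<open>\<nu>\<close> of almost
  equivariant weights and \<open>\<kappa>\<close> absorbs their defect of equivariance.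
\<close>

lemma exists_group_measure:
  assumes f: "convex_on {0<..} f" "f 1 = 0"
    and \<nu>: "prob_space \<nu>" "sets \<nu> = sets bdry_borel"
    and F: "finite F" "F \<subseteq> carrier G" and \<eta>: "0 < \<eta>"
  obtains \<omega> where "prob_space \<omega>" "sets \<omega> = sets (count_space (carrier G))"
    "\<And>g. g \<in> carrier G \<Longrightarrow> 0 < measure \<omega> {g}"
    "\<And>g. g \<in> F \<Longrightarrow> f_divergence f (distr \<omega> \<omega> (\<lambda>x. g \<otimes> x)) \<omega> \<le> f_divergence f (distr \<nu> \<nu> (act g)) \<nu> + ereal \<eta>"
proof -
  interpret \<nu>: prob_space \<nu> by fact
  note nf = normalized_props[OF f]
  have sp: "space \<nu> = bdry" by (rule act_measurable_sets_eq(2)[OF \<nu>(2) one_closed])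
  define r where "r = Max (insert 0 (len ` F))"
  have r: "len g \<le> r" if "g \<in> F" for g unfolding r_def using F(1) that by (intro Max_ge) auto
  \<comment> \<open>Translation by an element of \<open>F\<close> changes \<open>\<kappa>\<close> by a factor between \<open>2 * c\<close> and \<open>1 / (2 * c)\<close>; the margin
    leaves room for the defects \<open>d g\<close>, which are bounded by \<open>c * \<kappa>\<close>.\<close>
  define c where "c = decay ^ r / 2"
  have c: "0 < c" "c \<le> 1 / 2" using decay by (auto simp: c_def power_le_one)
  have cg: "2 * c \<le> decay ^ len g" if "g \<in> F" for g
    using decay r[OF that] by (auto simp: c_def intro: power_decreasing)
  obtain M where M: "0 \<le> M"
    "\<And>p q. 0 < q \<Longrightarrow> c * q \<le> p \<Longrightarrow> c * p \<le> q \<Longrightarrow> persp (normalized f) p q \<le> ennreal (M * q)"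
    using persp_comparable_le[OF nf(1) c(1)] by blast
  define N where "N = real (card F) + 1"
  have N: "0 < N" by (simp add: N_def add_nonneg_pos)
  \<comment> \<open>The mass of \<open>\<kappa>\<close> is at most \<open>2 * N * \<epsilon> / c\<close>, and it enters the estimate with the factor \<open>M\<close>.\<close>
  define \<epsilon> where "\<epsilon> = \<eta> * c / (2 * N * (M + 1))"
  have \<epsilon>: "0 < \<epsilon>" using \<eta> c M N by (simp add: \<epsilon>_def add_nonneg_pos)
  obtain m B where B: "finite B" "B \<subseteq> carrier G" and m: "\<And>h. m h \<in> borel_measurable bdry_borel"
      "\<And>h \<xi>. 0 \<le> m h \<xi>" "\<And>h \<xi>. \<xi> \<in> bdry \<Longrightarrow> h \<notin> B \<Longrightarrow> m h \<xi> = 0"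
      "\<And>\<xi>. \<xi> \<in> bdry \<Longrightarrow> (\<Sum>h\<in>B. m h \<xi>) = 1"
    and am: "\<And>g \<xi> T. \<lbrakk>g \<in> F; \<xi> \<in> bdry; finite T; T \<subseteq> carrier G\<rbrakk> \<Longrightarrow>
      (\<Sum>h\<in>T. \<bar>m (inv g \<otimes> h) \<xi> - m h (act g \<xi>)\<bar>) \<le> \<epsilon>"
    by (rule boundary_action_amenable[OF F \<epsilon>]) (rule that, assumption+)
  have mm [measurable]: "m h \<in> borel_measurable \<nu>" for h
    using m(1)[of h] unfolding measurable_cong_sets[OF \<nu>(2) refl] .
  have m_le: "m h \<xi> \<le> 1" if "\<xi> \<in> bdry" for h \<xi>
  proof (cases "h \<in> B")
    case True
    then show ?thesis using member_le_sum[of h B "\<lambda>h. m h \<xi>"] B m(2,4) that by auto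
  qed (use m(3) that in simp)
  have mg [measurable]: "(\<lambda>\<xi>. m h (act g \<xi>)) \<in> borel_measurable \<nu>" if "g \<in> F" for g h
    by (rule measurable_compose[OF act_measurable_sets_eq(1)[OF \<nu>(2)] mm]) (use F(2) that in blast)
  have int1: "integrable \<nu> (m h)" for h
    by (rule \<nu>.integrable_const_bound[of _ 1]) (auto simp: sp m(2) m_le)
  have int2: "integrable \<nu> (\<lambda>\<xi>. m h (act g \<xi>))" if "g \<in> F" for g h
    using mg[OF that] F that
    by (intro \<nu>.integrable_const_bound[of _ 1]) (auto simp: sp m(2) intro!: m_le act_bdry)
  define W where "W h = (\<integral>\<xi>. m h \<xi> \<partial>\<nu>)" for h
  define \<rho> where "\<rho> g h = (\<integral>\<xi>. m h (act g \<xi>) \<partial>\<nu>)" for g h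
  define d where "d g h = W (inv g \<otimes> h) - \<rho> g h" for g h
  have W0: "0 \<le> W h" for h unfolding W_def by (intro integral_nonneg_AE AE_I2 m(2))
  have WB: "W h = 0" if "h \<notin> B" for h
  proof -
    have "W h = (\<integral>\<xi>. 0 \<partial>\<nu>)"
      unfolding W_def by (intro Bochner_Integration.integral_cong) (auto simp: sp m(3) that)
    then show ?thesis by simp
  qed
  have sumW: "(\<Sum>h\<in>B. W h) = 1"
  proof -
    have "(\<Sum>h\<in>B. W h) = (\<integral>\<xi>. (\<Sum>h\<in>B. m h \<xi>) \<partial>\<nu>)" unfolding W_def using int1 by simp
    also have "\<dots> = (\<integral>\<xi>. 1 \<partial>\<nu>)"
      by (intro Bochner_Integration.integral_cong) (auto simp: sp m(4))
    finally show ?thesis using \<nu>.prob_space by simp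
  qed
  \<comment> \<open>The defects \<open>d g\<close>, \<open>g \<in> F\<close>, vanish outside this finite set.\<close>
  define B' where "B' = insert \<one> (B \<union> (\<Union>g\<in>F. (\<otimes>) g ` B))"
  have B': "finite B'" "B' \<subseteq> carrier G" "\<one> \<in> B'" using B F by (auto simp: B'_def)
  have d0: "d g h = 0" if g: "g \<in> F" and h: "h \<in> carrier G" "h \<notin> B'" for g h
  proof -
    have gc: "g \<in> carrier G" using g F by blast
    have "inv g \<otimes> h \<notin> B"
    proof
      assume "inv g \<otimes> h \<in> B"
      then have "g \<otimes> (inv g \<otimes> h) \<in> B'" using g by (auto simp: B'_def)
      then show False using h gc by (simp add: mult_inv_cancel)
    qed
    moreover have "\<rho> g h = (\<integral>\<xi>. 0 \<partial>\<nu>)"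
      unfolding \<rho>_def using h(2) gc
      by (intro Bochner_Integration.integral_cong) (auto simp: sp B'_def intro!: m(3) act_bdry)
    ultimately show ?thesis by (simp add: d_def WB)
  qed
  have sum_d: "(\<Sum>h\<in>B'. \<bar>d g h\<bar>) \<le> \<epsilon>" if g: "g \<in> F" for g
  proof -
    define D where "D h \<xi> = m (inv g \<otimes> h) \<xi> - m h (act g \<xi>)" for h \<xi>
    have D: "integrable \<nu> (D h)" for h
      unfolding D_def by (intro Bochner_Integration.integrable_diff int1 int2[OF g])
    have "\<bar>d g h\<bar> \<le> (\<integral>\<xi>. \<bar>D h \<xi>\<bar> \<partial>\<nu>)" for h
    proof -
      have "d g h = (\<integral>\<xi>. D h \<xi> \<partial>\<nu>)"
        unfolding d_def W_def \<rho>_def D_def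
        by (rule Bochner_Integration.integral_diff[OF int1 int2[OF g], symmetric])
      then show ?thesis by (simp only: integral_abs_bound)
    qed
    then have "(\<Sum>h\<in>B'. \<bar>d g h\<bar>) \<le> (\<Sum>h\<in>B'. \<integral>\<xi>. \<bar>D h \<xi>\<bar> \<partial>\<nu>)"
      by (rule sum_mono)
    also have "\<dots> = (\<integral>\<xi>. (\<Sum>h\<in>B'. \<bar>D h \<xi>\<bar>) \<partial>\<nu>)"
      by (rule Bochner_Integration.integral_sum[symmetric]) (rule integrable_abs[OF D])
    also have "\<dots> \<le> (\<integral>\<xi>. \<epsilon> \<partial>\<nu>)"
    proof (rule integral_mono)
      show "integrable \<nu> (\<lambda>\<xi>. \<Sum>h\<in>B'. \<bar>D h \<xi>\<bar>)"
        by (rule Bochner_Integration.integrable_sum) (rule integrable_abs[OF D])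
      show "(\<Sum>h\<in>B'. \<bar>D h \<xi>\<bar>) \<le> \<epsilon>" if "\<xi> \<in> space \<nu>" for \<xi>
        unfolding D_def using that by (intro am[OF g _ B'(1,2)]) (simp add: sp)
    qed simp
    finally show ?thesis using \<nu>.prob_space by simp
  qed
  \<comment> \<open>The summand \<open>\<epsilon>\<close> at \<open>1\<close> makes \<open>\<kappa>\<close> positive on the whole group.\<close>
  define \<zeta> where "\<zeta> h = ((\<Sum>g\<in>F. \<bar>d g h\<bar>) + (if h = \<one> then \<epsilon> else 0)) / c" for h
  have \<zeta>0: "0 \<le> \<zeta> h" for h using c \<epsilon> by (auto simp: \<zeta>_def intro!: divide_nonneg_pos add_nonneg_nonneg sum_nonneg)
  have \<zeta>1: "0 < \<zeta> \<one>" using c \<epsilon> by (auto simp: \<zeta>_def intro!: divide_pos_pos add_nonneg_pos sum_nonneg)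
  have sum_\<zeta>: "(\<Sum>h\<in>B'. \<zeta> h) \<le> N * \<epsilon> / c"
  proof -
    have "(\<Sum>h\<in>B'. \<zeta> h) = ((\<Sum>g\<in>F. \<Sum>h\<in>B'. \<bar>d g h\<bar>) + \<epsilon>) / c"
      unfolding \<zeta>_def sum_divide_distrib[symmetric] sum.distrib
      using B' by (subst sum.swap) (simp add: sum.delta)
    also have "(\<Sum>g\<in>F. \<Sum>h\<in>B'. \<bar>d g h\<bar>) \<le> (\<Sum>g\<in>F. \<epsilon>)" by (intro sum_mono sum_d)
    finally show ?thesis using c by (simp add: N_def divide_right_mono algebra_simps)
  qed
  obtain \<kappa> where \<kappa>: "\<And>h. h \<in> carrier G \<Longrightarrow> 0 < \<kappa> h" "\<And>h. h \<in> B' \<Longrightarrow> \<zeta> h \<le> \<kappa> h"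
    "\<And>g h. g \<in> carrier G \<Longrightarrow> h \<in> carrier G \<Longrightarrow> decay ^ len g * \<kappa> h \<le> \<kappa> (inv g \<otimes> h)"
    "\<And>g h. g \<in> carrier G \<Longrightarrow> h \<in> carrier G \<Longrightarrow> decay ^ len g * \<kappa> (inv g \<otimes> h) \<le> \<kappa> h"
    "(\<integral>\<^sup>+h. ennreal (\<kappa> h) \<partial>count_space (carrier G)) \<le> ennreal (2 * (\<Sum>k\<in>B'. \<zeta> k))"
    by (rule smoothing_density[OF B', where \<zeta> = \<zeta>, OF \<zeta>0 \<zeta>1]) (rule that, assumption+)
  have d_le: "\<bar>d g h\<bar> \<le> c * \<kappa> h" if g: "g \<in> F" and h: "h \<in> carrier G" for g h
  proof (cases "h \<in> B'")
    case True
    have "\<bar>d g h\<bar> \<le> (\<Sum>g\<in>F. \<bar>d g h\<bar>)" using g F by (intro member_le_sum) auto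
    also have "\<dots> \<le> c * \<zeta> h" using c \<epsilon> by (simp add: \<zeta>_def)
    also have "\<dots> \<le> c * \<kappa> h" using \<kappa>(2)[OF True] c by (intro mult_left_mono) auto
    finally show ?thesis .
  next
    case False
    then show ?thesis using d0[OF g h] \<kappa>(1)[OF h] c by simp
  qed
  have M_mass: "ennreal M * (\<integral>\<^sup>+h. ennreal (\<kappa> h) \<partial>count_space (carrier G)) \<le> ennreal \<eta>"
  proof -
    have "ennreal M * (\<integral>\<^sup>+h. ennreal (\<kappa> h) \<partial>count_space (carrier G))
        \<le> ennreal M * ennreal (2 * (N * \<epsilon> / c))"
      using sum_\<zeta> by (intro mult_left_mono order_trans[OF \<kappa>(5)] ennreal_leI) auto
    also have "\<dots> = ennreal (M * (2 * (N * \<epsilon> / c)))"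
      using M(1) by (rule ennreal_mult'[symmetric])
    also have "M * (2 * (N * \<epsilon> / c)) = \<eta> * (M / (M + 1))"
    proof -
      have "M * (2 * (N * (\<eta> * c / (2 * N * L)) / c)) = \<eta> * (M / L)" if "0 < L" for L
        using c N that by (simp add: field_simps)
      then show ?thesis using M(1) by (simp add: \<epsilon>_def add_nonneg_pos)
    qed
    also have "ennreal (\<eta> * (M / (M + 1))) \<le> ennreal \<eta>"
    proof (rule ennreal_leI, rule mult_left_le)
      show "M / (M + 1) \<le> 1" using M(1) by simp
    qed (use \<eta> in simp)
    finally show ?thesis .
  qed
  define V where "V h = W h + \<kappa> h" for h
  have V: "0 < V h" if "h \<in> carrier G" for h using W0[of h] \<kappa>(1)[OF that] by (simp add: V_def)
  have nnV: "(\<integral>\<^sup>+h. ennreal (V h) \<partial>count_space (carrier G)) = 1 + (\<integral>\<^sup>+h. ennreal (\<kappa> h) \<partial>count_space (carrier G))"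
  proof -
    have "(\<integral>\<^sup>+h. ennreal (V h) \<partial>count_space (carrier G))
        = (\<integral>\<^sup>+h. ennreal (W h) + ennreal (\<kappa> h) \<partial>count_space (carrier G))"
      unfolding V_def using W0 \<kappa>(1) by (intro nn_integral_cong ennreal_plus) (auto intro: less_imp_le)
    also have "\<dots> = (\<integral>\<^sup>+h. ennreal (W h) \<partial>count_space (carrier G)) + (\<integral>\<^sup>+h. ennreal (\<kappa> h) \<partial>count_space (carrier G))"
      by (intro nn_integral_add) auto
    also have "(\<integral>\<^sup>+h. ennreal (W h) \<partial>count_space (carrier G)) = (\<Sum>h\<in>B. ennreal (W h))"
      using B WB by (intro nn_integral_count_space'[of B]) auto
    also have "\<dots> = 1" using W0 sumW by (simp add: sum_ennreal)
    finally show ?thesis .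
  qed
  define Z where "Z = enn2real (\<integral>\<^sup>+h. ennreal (V h) \<partial>count_space (carrier G))"
  have Zeq: "(\<integral>\<^sup>+h. ennreal (V h) \<partial>count_space (carrier G)) = ennreal Z"
  proof -
    have "(\<integral>\<^sup>+h. ennreal (\<kappa> h) \<partial>count_space (carrier G)) < \<top>" using \<kappa>(5) by (rule le_less_trans) simp
    then show ?thesis unfolding Z_def nnV by simp
  qed
  have Z1: "1 \<le> Z"
  proof -
    have "ennreal 1 \<le> ennreal Z" unfolding Zeq[symmetric] nnV by simp
    then show ?thesis by (simp add: ennreal_le_iff2)
  qed
  define \<omega> where "\<omega> = density (count_space (carrier G)) (\<lambda>h. ennreal (V h / Z))"
  have s\<omega>: "sets \<omega> = sets (count_space (carrier G))" by (simp add: \<omega>_def)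
  have p\<omega>: "prob_space \<omega>"
  proof
    have "emeasure \<omega> (space \<omega>) = (\<integral>\<^sup>+h. ennreal (V h / Z) \<partial>count_space (carrier G))"
      unfolding \<omega>_def by (subst emeasure_density) (auto intro!: nn_integral_cong)
    also have "\<dots> = (\<integral>\<^sup>+h. ennreal (V h) / ennreal Z \<partial>count_space (carrier G))"
      using V Z1 by (intro nn_integral_cong divide_ennreal[symmetric]) (auto intro: less_imp_le)
    also have "\<dots> = ennreal Z / ennreal Z" by (simp add: nn_integral_divide Zeq)
    also have "\<dots> = 1" using Z1 by (simp add: divide_ennreal)
    finally show "emeasure \<omega> (space \<omega>) = 1" .
  qed
  have \<omega>h: "measure \<omega> {h} = V h / Z" if h: "h \<in> carrier G" for h
  proof -
    have "emeasure \<omega> {h} = ennreal (V h / Z)"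
      unfolding \<omega>_def using h by (subst emeasure_density) (auto simp: nn_integral_indicator_singleton')
    then show ?thesis using V[OF h] Z1 by (simp add: measure_def)
  qed
  show ?thesis
  proof (rule that[of \<omega>])
    show "prob_space \<omega>" "sets \<omega> = sets (count_space (carrier G))" by fact+
    show "0 < measure \<omega> {g}" if "g \<in> carrier G" for g using \<omega>h[OF that] V[OF that] Z1 by simp
    fix g assume g: "g \<in> F"
    then have gc: "g \<in> carrier G" using F by blast
    have "f_divergence f (distr \<omega> \<omega> (\<lambda>x. g \<otimes> x)) \<omega> = enn2ereal
      (\<integral>\<^sup>+ h. persp (normalized f) (measure \<omega> {inv g \<otimes> h}) (measure \<omega> {h}) \<partial>count_space (carrier G))"
      by (rule f_divergence_translate[OF f p\<omega> s\<omega> gc])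
    also have "\<dots> \<le> enn2ereal (\<integral>\<^sup>+ h. persp (normalized f) (\<rho> g h) (W h) + ennreal (M * \<kappa> h) \<partial>count_space (carrier G))"
      unfolding less_eq_ennreal.rep_eq[symmetric]
    proof (rule nn_integral_mono)
      fix h assume "h \<in> space (count_space (carrier G))"
      then have h: "h \<in> carrier G" by simp
      have gh: "inv g \<otimes> h \<in> carrier G" using gc h by simp
      have "persp (normalized f) (measure \<omega> {inv g \<otimes> h}) (measure \<omega> {h})
          = persp (normalized f) ((1 / Z) * V (inv g \<otimes> h)) ((1 / Z) * V h)"
        by (simp add: \<omega>h h gh)
      also have "\<dots> = ennreal (1 / Z) * persp (normalized f) (V (inv g \<otimes> h)) (V h)"
        using Z1 by (intro persp_scale) simp
      also have "\<dots> \<le> 1 * persp (normalized f) (V (inv g \<otimes> h)) (V h)"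
      proof (rule mult_right_mono)
        have "ennreal (1 / Z) \<le> ennreal 1" by (rule ennreal_leI) (use Z1 in simp)
        then show "ennreal (1 / Z) \<le> 1" by simp
      qed simp
      \<comment> \<open>Up to the factor \<open>Z\<close>, the translate of \<open>\<omega>\<close> is the transported part \<open>\<rho> g\<close>, which is compared with \<open>W\<close>, plus
        the remainder, which is comparable with \<open>\<kappa>\<close>.\<close>
      also have "\<dots> = persp (normalized f) (\<rho> g h + (d g h + \<kappa> (inv g \<otimes> h))) (W h + \<kappa> h)"
        by (simp add: V_def d_def)
      also have "\<dots> \<le> persp (normalized f) (\<rho> g h) (W h) + persp (normalized f) (d g h + \<kappa> (inv g \<otimes> h)) (\<kappa> h)"
        by (rule persp_add_le)
      also have "persp (normalized f) (d g h + \<kappa> (inv g \<otimes> h)) (\<kappa> h) \<le> ennreal (M * \<kappa> h)"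
      proof (rule M(2)[OF \<kappa>(1)[OF h]])
        have "2 * c * \<kappa> h \<le> decay ^ len g * \<kappa> h" using cg[OF g] \<kappa>(1)[OF h] by (intro mult_right_mono) auto
        then have "2 * c * \<kappa> h \<le> \<kappa> (inv g \<otimes> h)" using \<kappa>(3)[OF gc h] by simp
        then show "c * \<kappa> h \<le> d g h + \<kappa> (inv g \<otimes> h)" using d_le[OF g h] by simp
        have "2 * c * \<kappa> (inv g \<otimes> h) \<le> decay ^ len g * \<kappa> (inv g \<otimes> h)"
          using cg[OF g] \<kappa>(1)[OF gh] by (intro mult_right_mono) auto
        then have 1: "c * \<kappa> (inv g \<otimes> h) \<le> \<kappa> h / 2" using \<kappa>(4)[OF gc h] by simp
        have "c * d g h \<le> c * (c * \<kappa> h)" using d_le[OF g h] c by (intro mult_left_mono) auto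
        also have "\<dots> \<le> 1 / 2 * (1 * \<kappa> h)" using c \<kappa>(1)[OF h] by (intro mult_mono) auto
        finally show "c * (d g h + \<kappa> (inv g \<otimes> h)) \<le> \<kappa> h" using 1 by (simp add: distrib_left)
      qed
      finally show "persp (normalized f) (measure \<omega> {inv g \<otimes> h}) (measure \<omega> {h})
          \<le> persp (normalized f) (\<rho> g h) (W h) + ennreal (M * \<kappa> h)"
        by (simp add: add_left_mono)
    qed
    also have "\<dots> = enn2ereal (\<integral>\<^sup>+ h. persp (normalized f) (\<rho> g h) (W h) \<partial>count_space (carrier G))
        + enn2ereal (\<integral>\<^sup>+ h. ennreal (M * \<kappa> h) \<partial>count_space (carrier G))"
      by (simp add: nn_integral_add plus_ennreal.rep_eq)
    also have "\<dots> \<le> f_divergence f (distr \<nu> \<nu> (act g)) \<nu> + ereal \<eta>"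
    proof (rule add_mono)
      have actm: "act g \<in> measurable \<nu> \<nu>" by (rule act_measurable_sets_eq(1)[OF \<nu>(2) gc])
      have "\<rho> g h = (\<integral>\<xi>. m h \<xi> \<partial>distr \<nu> \<nu> (act g))" for h
        unfolding \<rho>_def by (rule integral_distr[OF actm mm, symmetric])
      then have "enn2ereal (\<integral>\<^sup>+ h. persp (normalized f) (\<rho> g h) (W h) \<partial>count_space (carrier G))
        = enn2ereal (\<integral>\<^sup>+ h. persp (normalized f) (\<integral>\<xi>. m h \<xi> \<partial>distr \<nu> \<nu> (act g)) (\<integral>\<xi>. m h \<xi> \<partial>\<nu>) \<partial>count_space (carrier G))"
        by (simp add: W_def)
      also have "\<dots> \<le> f_divergence f (distr \<nu> \<nu> (act g)) \<nu>"
      proof (rule f_divergence_kernel_le[OF f \<nu>.prob_space_distr[OF actm] \<nu>(1) _ countable_carrier mm m(2)])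
        fix \<xi> assume "\<xi> \<in> space \<nu>"
        then have \<xi>: "\<xi> \<in> bdry" by (simp add: sp)
        have "(\<integral>\<^sup>+ h. ennreal (m h \<xi>) \<partial>count_space (carrier G)) = (\<Sum>h\<in>B. ennreal (m h \<xi>))"
          using B m(3)[OF \<xi>] by (intro nn_integral_count_space'[of B]) auto
        then show "(\<integral>\<^sup>+ h. ennreal (m h \<xi>) \<partial>count_space (carrier G)) \<le> 1"
          using m(2) m(4)[OF \<xi>] by (simp add: sum_ennreal)
      qed simp
      finally show "enn2ereal (\<integral>\<^sup>+ h. persp (normalized f) (\<rho> g h) (W h) \<partial>count_space (carrier G))
        \<le> f_divergence f (distr \<nu> \<nu> (act g)) \<nu>" .
      have "(\<integral>\<^sup>+ h. ennreal (M * \<kappa> h) \<partial>count_space (carrier G)) \<le> ennreal \<eta>"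
        using M_mass M(1) by (simp add: ennreal_mult' nn_integral_cmult)
      then show "enn2ereal (\<integral>\<^sup>+ h. ennreal (M * \<kappa> h) \<partial>count_space (carrier G)) \<le> ereal \<eta>"
        using \<eta> by (simp add: less_eq_ennreal.rep_eq enn2ereal_ennreal)
    qed
    finally show "f_divergence f (distr \<omega> \<omega> (\<lambda>x. g \<otimes> x)) \<omega> \<le> f_divergence f (distr \<nu> \<nu> (act g)) \<nu> + ereal \<eta>" .
  qed
qed

lemma I_group_le_I_top:
  assumes f: "convex_on {0<..} f" "f 1 = 0"
    and lam: "finite (set_pmf lam)" "set_pmf lam \<subseteq> carrier G"
  shows "I_group G lam f \<le> I_top G lam f (group_boundary G S) (boundary_action G)"
  unfolding I_top_def
proof (rule INF_greatest, clarify)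
  fix \<nu> :: "(nat \<Rightarrow> 'a) set measure"
  assume \<nu>: "prob_space \<nu>" "sets \<nu> = sets bdry_borel"
  show "I_group G lam f \<le> furstenberg_entropy G lam f act \<nu>"
  proof (rule ereal_le_epsilon2)
    fix \<eta> :: real assume "0 < \<eta>"
    from exists_group_measure[OF f \<nu> lam this] obtain \<omega>
      where \<omega>: "prob_space \<omega>" "sets \<omega> = sets (count_space (carrier G))"
        "\<And>g. g \<in> carrier G \<Longrightarrow> 0 < measure \<omega> {g}"
      and le: "\<And>g. g \<in> set_pmf lam \<Longrightarrow> f_divergence f (distr \<omega> \<omega> (\<lambda>x. g \<otimes> x)) \<omega>
        \<le> f_divergence f (distr \<nu> \<nu> (act g)) \<nu> + ereal \<eta>"
      by blast
    have "I_group G lam f \<le> furstenberg_entropy G lam f (\<lambda>g x. g \<otimes> x) \<omega>"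
      unfolding I_group_def by (rule INF_lower) (use \<omega> in auto)
    also have "\<dots> \<le> (\<Sum>g\<in>set_pmf lam. ereal (pmf lam g) * (f_divergence f (distr \<nu> \<nu> (act g)) \<nu> + ereal \<eta>))"
      unfolding furstenberg_entropy_finite[OF lam] by (intro sum_mono ereal_mult_left_mono le) auto
    also have "\<dots> = (\<Sum>g\<in>set_pmf lam. ereal (pmf lam g) * f_divergence f (distr \<nu> \<nu> (act g)) \<nu> + ereal (pmf lam g * \<eta>))"
      by (intro sum.cong) (auto simp: ereal_left_distrib ereal_distrib_left)
    also have "\<dots> = furstenberg_entropy G lam f act \<nu> + ereal (\<Sum>g\<in>set_pmf lam. pmf lam g * \<eta>)"
      unfolding furstenberg_entropy_finite[OF lam] by (simp add: sum.distrib)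
    also have "(\<Sum>g\<in>set_pmf lam. pmf lam g * \<eta>) = \<eta>"
      using sum_pmf_eq_1[OF lam(1)] by (simp add: sum_distrib_right[symmetric])
    finally show "I_group G lam f \<le> furstenberg_entropy G lam f act \<nu> + ereal \<eta>" .
  qed
qed

end

theorem theorem2:
  fixes G :: "('a, 'b) monoid_scheme" and S :: "'a set"
    and lam :: "'a pmf" and f :: "real \<Rightarrow> real"
  assumes "hyperbolic_group G S"
    and "infinite (carrier G)"
    and "finite (set_pmf lam)"
    and "generating G lam"
    and "convex_on {0<..} f"
    and "f 1 = 0"
  shows "I_top G lam f (group_boundary G S) (boundary_action G) = I_group G lam f"
proof -
  from assms(1) obtain \<delta> where gr: "group G" "finite S" "S \<subseteq> carrier G" "generate G S = carrier G"
    and \<delta>: "\<forall>w\<in>carrier G. \<forall>x\<in>carrier G. \<forall>y\<in>carrier G. \<forall>z\<in>carrier G.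
      min (gromov_product (word_dist G S) w x y) (gromov_product (word_dist G S) w y z) - \<delta>
        \<le> gromov_product (word_dist G S) w x z"
    unfolding hyperbolic_group_def gromov_hyperbolic_def by blast
  interpret hyperbolic_word_metric G S \<delta>
    by (intro hyperbolic_word_metric.intro word_metric.intro word_metric_axioms.intro
        hyperbolic_word_metric_axioms.intro gr) (use \<delta> in blast)
  have lam: "set_pmf lam \<subseteq> carrier G" using assms(4) by (simp add: generating_def)
  show ?thesis
    by (intro antisym I_top_le_I_group I_group_le_I_top assms lam)
qed

end
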